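(* There exist positive absolute constants $c_1,c_2,c_3,c_4,C,L,K$ with $c_4<1$ such that for all $n_1,n_2,m\in\mathbb{N}$, $s_1\in\{1,\dots,n_1\}$, $s_2\in\{1,\dots,n_2\}$ with $$m\ge c_1(s_1+s_2)\log\left(\max\{e n_1/s_1,\ e n_2/s_2\}\right),$$ the following holds with probability at least $1-\exp(-c_2 m)$ over the draw of an i.i.d. Gaussian measurement operator $\mathcal{A}:\mathbb{C}^{n_1\times n_2}\to\mathbb{C}^m$. For all $X=\lambda u v^*$ with $\lambda>0$, $u\in\mathbb{C}^{n_1}$, $v\in\mathbb{C}^{n_2}$, $\|u\|_2=\|v\|_2=1$, $\|u\|_0\le s_1$, $\|v\|_0\le s_2$ and $\min(\|u\|_\infty,\|v\|_\infty)\ge c_4$, and for all $z\in\mathbb{C}^m$ with $\|z\|_2\le c_3\|\mathcal{A}(X)\|_2$, the algorithm SPF applied to $\mathcal{A}$ and $b=\mathcal{A}(X)+z$, initialized by the thresholding initialization $v_0^{\rm Th}$ and with every inner HTP call at sparsity level $s$ run for at least $\lceil L+Ks\rceil$ iterations, produces iterates $(X_t)_{t\in\mathbb{N}}$ satisfying $$\limsup_{t\to\infty}\frac{\|X_t-X\|_F}{\|X\|_F}\le C\,\frac{\|z\|_2}{\|\mathcal{A}(X)\|_2}.$$ In the special case $s_2=n_2$ (row sparsity), the condition $\min(\|u\|_\infty,\|v\|_\infty)\ge c_4$ is replaced by $\|u\|_\infty\ge c_4$.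
   Context: Notation: $\langle A,B\rangle=\mathrm{trace}(A^*B)$; $\|\cdot\|_F$ is the Frobenius norm; $\|x\|_0$ is the number of nonzero entries of $x$; $\overline{b}$ is the entrywise complex conjugate; for $J\subset\{1,\dots,n\}$, $\Pi_J\in\mathbb{C}^{n\times n}$ is the coordinate projection keeping the coordinates in $J$ and setting the others to $0$. Ties in selections and choices of singular vectors are broken arbitrarily. A linear operator $\mathcal{A}:\mathbb{C}^{n_1\times n_2}\to\mathbb{C}^m$ is written $\mathcal{A}(Z)=[\langle M_1,Z\rangle,\dots,\langle M_m,Z\rangle]^\top$ with $M_\ell\in\mathbb{C}^{n_1\times n_2}$; its adjoint is $\mathcal{A}^*(z)=\sum_\ell z_\ell M_\ell$. It is an i.i.d. Gaussian measurement operator if all entries of all $M_\ell$ are i.i.d. circular complex Gaussian $\mathcal{CN}(0,1/m)$. For $y\in\mathbb{C}^{n_2}$, $F(y)\in\mathbb{C}^{m\times n_1}$ is the matrix whose $\ell$th row is $y^*M_\ell^*$; for $x\in\mathbb{C}^{n_1}$, $G(x)\in\mathbb{C}^{m\times n_2}$ is the matrix whose $\ell$th row is $x^*M_\ell$. Thus $\mathcal{A}(xy^* )=F(y)x=\overline{G(x)y}$. HTP$(\Phi,b,s)$ (hard thresholding pursuit): $x_0=0$; for $k\ge1$, $J_k$ is the set of indices of the $s$ largest-magnitude entries of $x_{k-1}+\Phi^*(b-\Phi x_{k-1})$, and $x_k=\arg\min_x\{\|b-\Phi x\|_2:\mathrm{supp}(x)\subset J_k\}$. SPF (sparse power factorization)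 with input $\mathcal{A},b,s_1,s_2$ and initial vector $v_0$: for $t=1,2,\dots$: (i) replace $v_{t-1}$ by $v_{t-1}/\|v_{t-1}\|_2$; (ii) if $s_1<n_1$ let $u_t$ be the final iterate of HTP$(F(v_{t-1}),b,s_1)$, otherwise $u_t=\arg\min_x\|b-F(v_{t-1})x\|_2^2$; (iii) replace $u_t$ by $u_t/\|u_t\|_2$; (iv) if $s_2<n_2$ let $v_t$ be the final iterate of HTP$(G(u_t),\overline{b},s_2)$, otherwise $v_t=\arg\min_y\|\overline{b}-G(u_t)y\|_2^2$; (v) $X_t=u_tv_t^*$ (with $v_t$ not yet normalized). Thresholding initialization $v_0^{\rm Th}$: let $M=\mathcal{A}^*(b)$; for $k=1,\dots,n_1$ let $\zeta_k$ be the $\ell_2$ norm of the vector of the $s_2$ largest-magnitude entries of the $k$th row of $M$; let $\widehat{J}_1$ be the indices of the $s_1$ largest $\zeta_k$; let $\widehat{J}_2$ be the indices of the $s_2$ columns of $\Pi_{\widehat{J}_1}M$ with largest $\ell_2$ norm; $v_0^{\rm Th}$ is the leading right singular vector of $\Pi_{\widehat{J}_1}M\Pi_{\widehat{J}_2}$. *)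

theory Defs
  imports "HOL-Probability.Probability" "Jordan_Normal_Form.Schur_Decomposition"
begin

unbundle no vec_syntax
hide_const (open) Finite_Cartesian_Product.vec Finite_Cartesian_Product.mat
  Finite_Cartesian_Product.row Finite_Cartesian_Product.column

section \<open>Vectors and matrices over the complex numbers\<close>

definition vec_norm2 :: "complex vec \<Rightarrow> real" where
  "vec_norm2 x = sqrt (\<Sum>i<dim_vec x. (cmod (x $ i))\<^sup>2)"

definition vec_supp :: "complex vec \<Rightarrow> nat set" where
  "vec_supp x = {i. i < dim_vec x \<and> x $ i \<noteq> 0}"

definition vec_norm0 :: "complex vec \<Rightarrow> nat" where
  "vec_norm0 x = card (vec_supp x)"

text \<open>Only meant for vectors of positive dimension.\<close>

definition vec_norm_inf :: "complex vec \<Rightarrow> real" where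
  "vec_norm_inf x = Max ((\<lambda>i. cmod (x $ i)) ` {..<dim_vec x})"

text \<open>Division by zero makes the normalization of the zero vector the zero vector.\<close>

definition normalize_vec :: "complex vec \<Rightarrow> complex vec" where
  "normalize_vec x = complex_of_real (1 / vec_norm2 x) \<cdot>\<^sub>v x"

definition mat_trace :: "complex mat \<Rightarrow> complex" where
  "mat_trace A = (\<Sum>i<dim_row A. A $$ (i, i))"

definition mat_inner :: "complex mat \<Rightarrow> complex mat \<Rightarrow> complex" where
  "mat_inner A B = mat_trace (mat_adjoint A * B)"

definition frob_norm :: "complex mat \<Rightarrow> real" where
  "frob_norm A = sqrt (\<Sum>i<dim_row A. \<Sum>j<dim_col A. (cmod (A $$ (i, j)))\<^sup>2)"

text \<open>The rank-one matrix \<open>u v\<^sup>*\<close>.\<close>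

definition outer_prod :: "complex vec \<Rightarrow> complex vec \<Rightarrow> complex mat" where
  "outer_prod u v = mat (dim_vec u) (dim_vec v) (\<lambda>(i, j). u $ i * cnj (v $ j))"

definition coord_proj :: "nat \<Rightarrow> nat set \<Rightarrow> complex mat" where
  "coord_proj n J = mat n n (\<lambda>(i, j). if i = j \<and> i \<in> J then 1 else 0)"

definition singular_triple :: "complex mat \<Rightarrow> real \<Rightarrow> complex vec \<Rightarrow> complex vec \<Rightarrow> bool" where
  "singular_triple A \<sigma> u v \<longleftrightarrow>
     0 \<le> \<sigma> \<and> u \<in> carrier_vec (dim_row A) \<and> v \<in> carrier_vec (dim_col A) \<and>
     vec_norm2 u = 1 \<and> vec_norm2 v = 1 \<and>
     A *\<^sub>v v = complex_of_real \<sigma> \<cdot>\<^sub>v u \<and> mat_adjoint A *\<^sub>v u = complex_of_real \<sigma> \<cdot>\<^sub>v v"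

definition leading_right_singular_vector :: "complex mat \<Rightarrow> complex vec \<Rightarrow> bool" where
  "leading_right_singular_vector A v \<longleftrightarrow>
     (\<exists>\<sigma> u. singular_triple A \<sigma> u v \<and>
        (\<forall>\<sigma>' u' v'. singular_triple A \<sigma>' u' v' \<longrightarrow> \<sigma>' \<le> \<sigma>))"

section \<open>Measurement operators\<close>

text \<open>
  A linear operator from \<open>n\<^sub>1 \<times> n\<^sub>2\<close> matrices to vectors of dimension \<open>m\<close> is given by the
  family \<open>M 0, \<dots>, M (m - 1)\<close> of its measurement matrices; indices are zero-based throughout.
\<close>

definition meas_op :: "nat \<Rightarrow> (nat \<Rightarrow> complex mat) \<Rightarrow> complex mat \<Rightarrow> complex vec" where
  "meas_op m M Z = vec m (\<lambda>l. mat_inner (M l) Z)"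

definition meas_adj ::
  "nat \<Rightarrow> nat \<Rightarrow> nat \<Rightarrow> (nat \<Rightarrow> complex mat) \<Rightarrow> complex vec \<Rightarrow> complex mat" where
  "meas_adj n1 n2 m M z = mat n1 n2 (\<lambda>(i, j). \<Sum>l<m. z $ l * M l $$ (i, j))"

text \<open>
  The row vector \<open>y\<^sup>* M\<^sub>\<ell>\<^sup>*\<close> is the entrywise conjugate of \<open>M\<^sub>\<ell> y\<close>, and \<open>x\<^sup>* M\<^sub>\<ell>\<close> has the
  entries of \<open>M\<^sub>\<ell>\<^sup>T\<close> applied to the conjugate of \<open>x\<close>.
\<close>

definition F_mat :: "nat \<Rightarrow> nat \<Rightarrow> (nat \<Rightarrow> complex mat) \<Rightarrow> complex vec \<Rightarrow> complex mat" where
  "F_mat n1 m M y = mat_of_rows n1 (map (\<lambda>l. conjugate (M l *\<^sub>v y)) [0..<m])"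

definition G_mat :: "nat \<Rightarrow> nat \<Rightarrow> (nat \<Rightarrow> complex mat) \<Rightarrow> complex vec \<Rightarrow> complex mat" where
  "G_mat n2 m M x = mat_of_rows n2 (map (\<lambda>l. transpose_mat (M l) *\<^sub>v conjugate x) [0..<m])"

text \<open>\<open>CN(0, q)\<close> with variance \<open>q\<close>: independent real and imaginary parts of variance \<open>q / 2\<close>.\<close>

definition complex_gaussian :: "real \<Rightarrow> complex measure" where
  "complex_gaussian q =
     distr (density lborel (normal_density 0 (sqrt (q / 2))) \<Otimes>\<^sub>M
            density lborel (normal_density 0 (sqrt (q / 2))))
       borel (\<lambda>(a, b). Complex a b)"

text \<open>
  The sample space consists of all entries; \<open>\<omega> (l, i, j)\<close> is the \<open>(i, j)\<close> entry of the matrix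
  with index \<open>l\<close>.
\<close>

definition gaussian_entries :: "nat \<Rightarrow> nat \<Rightarrow> nat \<Rightarrow> (nat \<times> nat \<times> nat \<Rightarrow> complex) measure" where
  "gaussian_entries n1 n2 m =
     (\<Pi>\<^sub>M e\<in>{..<m} \<times> {..<n1} \<times> {..<n2}. complex_gaussian (1 / real m))"

definition meas_mats :: "nat \<Rightarrow> nat \<Rightarrow> (nat \<times> nat \<times> nat \<Rightarrow> complex) \<Rightarrow> nat \<Rightarrow> complex mat" where
  "meas_mats n1 n2 \<omega> l = mat n1 n2 (\<lambda>(i, j). \<omega> (l, i, j))"

section \<open>The algorithms\<close>

text \<open>
  Ties and non-unique choices are broken arbitrarily, so every algorithm is a relation between
  its input and all outputs it can produce.
\<close>

text \<open>\<open>J\<close> is a possible set of indices of the \<open>s\<close> largest among \<open>f 0, \<dots>, f (n - 1)\<close>.\<close>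

definition top_indices :: "nat \<Rightarrow> (nat \<Rightarrow> real) \<Rightarrow> nat \<Rightarrow> nat set \<Rightarrow> bool" where
  "top_indices n f s J \<longleftrightarrow>
     J \<subseteq> {..<n} \<and> card J = s \<and> (\<forall>i\<in>J. \<forall>j\<in>{..<n} - J. f j \<le> f i)"

text \<open>\<open>HTP \<Phi> b s k x\<close>: the vector \<open>x\<close> is a possible \<open>k\<close>-th iterate.\<close>

inductive HTP :: "complex mat \<Rightarrow> complex vec \<Rightarrow> nat \<Rightarrow> nat \<Rightarrow> complex vec \<Rightarrow> bool"
  for \<Phi> :: "complex mat" and b :: "complex vec" and s :: nat where
  HTP_0: "HTP \<Phi> b s 0 (0\<^sub>v (dim_col \<Phi>))"
| HTP_Suc: "HTP \<Phi> b s k x \<Longrightarrow>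
    top_indices (dim_col \<Phi>) (\<lambda>i. cmod ((x + mat_adjoint \<Phi> *\<^sub>v (b - \<Phi> *\<^sub>v x)) $ i)) s J \<Longrightarrow>
    is_arg_min (\<lambda>y. vec_norm2 (b - \<Phi> *\<^sub>v y))
      (\<lambda>y. y \<in> carrier_vec (dim_col \<Phi>) \<and> vec_supp y \<subseteq> J) x' \<Longrightarrow>
    HTP \<Phi> b s (Suc k) x'"

text \<open>
  One half-step of SPF: the final iterate of HTP after at least \<open>N s\<close> iterations if the sparsity
  level is nontrivial, and a least squares solution otherwise. The number of iterations may differ
  from call to call.
\<close>

definition SPF_half_step ::
  "(nat \<Rightarrow> nat) \<Rightarrow> complex mat \<Rightarrow> complex vec \<Rightarrow> nat \<Rightarrow> complex vec \<Rightarrow> bool" where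
  "SPF_half_step N \<Phi> b s x \<longleftrightarrow>
     (if s < dim_col \<Phi> then \<exists>k\<ge>N s. HTP \<Phi> b s k x
      else is_arg_min (\<lambda>y. (vec_norm2 (b - \<Phi> *\<^sub>v y))\<^sup>2) (\<lambda>y. y \<in> carrier_vec (dim_col \<Phi>)) x)"

text \<open>
  \<open>X t\<close> for \<open>t \<ge> 1\<close> are the iterates of a run of SPF; \<open>X 0\<close> is irrelevant. Here \<open>u t\<close> is the
  normalized left factor, whereas \<open>v t\<close> is stored before its normalization in the next step.
\<close>

definition SPF_run ::
  "(nat \<Rightarrow> nat) \<Rightarrow> nat \<Rightarrow> nat \<Rightarrow> nat \<Rightarrow> (nat \<Rightarrow> complex mat) \<Rightarrow> complex vec \<Rightarrow> nat \<Rightarrow> nat \<Rightarrow>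
   complex vec \<Rightarrow> (nat \<Rightarrow> complex mat) \<Rightarrow> bool" where
  "SPF_run N n1 n2 m M b s1 s2 v0 X \<longleftrightarrow>
     (\<exists>u v. v 0 = v0 \<and>
        (\<forall>t\<ge>1.
           (\<exists>u'. SPF_half_step N (F_mat n1 m M (normalize_vec (v (t - 1)))) b s1 u' \<and>
                 u t = normalize_vec u') \<and>
           SPF_half_step N (G_mat n2 m M (u t)) (conjugate b) s2 (v t) \<and>
           X t = outer_prod (u t) (v t)))"

text \<open>Applied with \<open>A\<close> the adjoint of the measurement operator at the measurements \<open>b\<close>.\<close>

definition thresholding_init ::
  "nat \<Rightarrow> nat \<Rightarrow> nat \<Rightarrow> nat \<Rightarrow> complex mat \<Rightarrow> complex vec \<Rightarrow> bool" where
  "thresholding_init n1 n2 s1 s2 A v0 \<longleftrightarrow>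
     (\<exists>S \<zeta> J1 J2.
        (\<forall>k<n1. top_indices n2 (\<lambda>j. cmod (A $$ (k, j))) s2 (S k) \<and>
                \<zeta> k = sqrt (\<Sum>j\<in>S k. (cmod (A $$ (k, j)))\<^sup>2)) \<and>
        top_indices n1 \<zeta> s1 J1 \<and>
        top_indices n2 (\<lambda>j. vec_norm2 (col (coord_proj n1 J1 * A) j)) s2 J2 \<and>
        leading_right_singular_vector (coord_proj n1 J1 * A * coord_proj n2 J2) v0)"

section \<open>Consistency of the conventions\<close>

lemma prob_space_complex_gaussian:
  assumes "q > 0"
  shows "prob_space (complex_gaussian q)"
proof -
  let ?N = "density lborel (normal_density 0 (sqrt (q / 2)))"
  interpret N: prob_space ?N
    using assms by (intro prob_space_normal_density) simp
  interpret P: pair_prob_space ?N ?N ..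
  have "(\<lambda>(a, b). Complex a b) \<in> borel_measurable (borel \<Otimes>\<^sub>M borel)"
    unfolding Complex_eq split_beta by measurable
  hence "(\<lambda>(a, b). Complex a b) \<in> borel_measurable (?N \<Otimes>\<^sub>M ?N)"
    by (subst measurable_cong_sets[OF sets_pair_measure_cong[of _ borel _ borel] refl]) auto
  thus ?thesis
    unfolding complex_gaussian_def by (rule P.prob_space_distr)
qed

lemma meas_op_outer_prod:
  assumes "x \<in> carrier_vec n1" "y \<in> carrier_vec n2" "\<And>l. l < m \<Longrightarrow> M l \<in> carrier_mat n1 n2"
  shows "meas_op m M (outer_prod x y) = F_mat n1 m M y *\<^sub>v x"
    and "meas_op m M (outer_prod x y) = conjugate (G_mat n2 m M x *\<^sub>v y)"
proof -
  have inner: "mat_inner (M l) (outer_prod x y) =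
      (\<Sum>j<n2. \<Sum>i<n1. cnj (M l $$ (i, j)) * (x $ i * cnj (y $ j)))" if "l < m" for l
    using assms(1,2) assms(3)[OF that]
    by (auto simp: mat_inner_def mat_trace_def outer_prod_def mat_adjoint_def scalar_prod_def
        mat_of_rows_def atLeast0LessThan intro!: sum.cong)
  show "meas_op m M (outer_prod x y) = F_mat n1 m M y *\<^sub>v x"
  proof (rule eq_vecI)
    fix l assume "l < dim_vec (F_mat n1 m M y *\<^sub>v x)"
    hence l: "l < m" by (simp add: F_mat_def)
    have "(F_mat n1 m M y *\<^sub>v x) $ l =
        (\<Sum>i<n1. (\<Sum>j<n2. cnj (M l $$ (i, j)) * cnj (y $ j)) * x $ i)"
      using l assms(1,2) assms(3)[OF l]
      by (auto simp: F_mat_def mat_of_rows_def scalar_prod_def atLeast0LessThan intro!: sum.cong)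
    also have "\<dots> = (\<Sum>j<n2. \<Sum>i<n1. cnj (M l $$ (i, j)) * (x $ i * cnj (y $ j)))"
      by (subst sum.swap) (simp add: sum_distrib_left sum_distrib_right mult_ac)
    finally show "meas_op m M (outer_prod x y) $ l = (F_mat n1 m M y *\<^sub>v x) $ l"
      using l by (simp add: meas_op_def inner)
  qed (simp add: meas_op_def F_mat_def)
  show "meas_op m M (outer_prod x y) = conjugate (G_mat n2 m M x *\<^sub>v y)"
  proof (rule eq_vecI)
    fix l assume "l < dim_vec (conjugate (G_mat n2 m M x *\<^sub>v y))"
    hence l: "l < m" by (simp add: G_mat_def)
    have "(G_mat n2 m M x *\<^sub>v y) $ l =
        (\<Sum>j<n2. (\<Sum>i<n1. M l $$ (i, j) * cnj (x $ i)) * y $ j)"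
      using l assms(1,2) assms(3)[OF l]
      by (auto simp: G_mat_def mat_of_rows_def scalar_prod_def atLeast0LessThan intro!: sum.cong)
    hence "conjugate (G_mat n2 m M x *\<^sub>v y) $ l =
        (\<Sum>j<n2. \<Sum>i<n1. cnj (M l $$ (i, j)) * (x $ i * cnj (y $ j)))"
      using l by (simp add: G_mat_def sum_distrib_left sum_distrib_right mult_ac)
    thus "meas_op m M (outer_prod x y) $ l = conjugate (G_mat n2 m M x *\<^sub>v y) $ l"
      using l by (simp add: meas_op_def inner)
  qed (simp add: meas_op_def G_mat_def)
qed

end

theory Submission
  imports Defs
begin

text \<open>
  With high probability the Gaussian operator satisfies a restricted isometry property on pairs of
  sparse rank-one matrices, in the bilinear form \<open>\<langle>A(x y\<^sup>*), A(x' y'\<^sup>*)\<rangle> \<approx> \<langle>x y\<^sup>*, x' y'\<^sup>*\<rangle>\<close>: polarization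
  and chi-square tails control it on a finite net, and multilinearity extends it from the net one
  argument at a time. Everything else is deterministic.

  If the current right factor \<open>y\<close> has length one and \<open>v = \<alpha> y + w\<close> with \<open>w\<close> orthogonal to \<open>y\<close>, then the
  measurements of \<open>u w\<^sup>*\<close> are noise that is almost orthogonal to the sparse part of the range of
  \<open>F y\<close>. So a half-step returns a multiple of \<open>u\<close> up to an error of order \<open>\<delta> |w| + |z|\<close>, and the
  misalignment of the factors contracts once it is bounded away from \<open>1\<close>. For this the inner HTP
  must be accurate up to its noise level, for arbitrarily fast decaying \<open>u\<close>, after a number of
  iterations proportional to \<open>s\<close>: as long as the largest missed entry \<open>\<mu>\<close> exceeds the noise, all
  entries of size at least \<open>\<mu> / 2\<close> are found after about \<open>D = (|missed part| / \<mu>)\<^sup>2\<close> iterations,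
  and \<open>4 |Q| - D\<close>, where \<open>Q\<close> is the set of missed indices, pays for all of these phases.

  Since \<open>c4\<close> is close to \<open>1\<close>, the dominant row and column survive the thresholding, which makes
  the leading singular vector a starting point within the region of contraction.
\<close>

section \<open>Support identification by hard thresholding pursuit\<close>

text \<open>There can be as many phases as entries, and bounding each phase by its worst case would
  give more than linearly many iterations in total. The potential comes from charging the indices
  instead: the share (a i / \<mu>)^2 of an index in \<open>D\<close> grows by a factor of at least 4
  from phase to phase and never exceeds 1, so its shares add up to at most 4/3. A phase costs at
  most 3 D iterations, whence 4 per index. A final \<open>s\<close> iterations remove the factor
  sqrt D at the noise level, so 5 s suffice. The part of the signal that acts as noise in a
  half-step need not be small in norm. Therefore the recovery bounds assume only that the
  correlations of the noise with images of sparse vectors are small. Treating the four arguments of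
  the isometry separately multiplies the deviation by an absolute constant, which is absorbed in the
  accuracy demanded on the net. What must not grow faster than exponentially in \<open>s\<close> is
  the number of lattice points on one support; this is why the lattice points are limited by the sum
  of their coordinates.\<close>

lemma geometric_contraction:
  fixes d :: "nat \<Rightarrow> real"
  assumes "\<And>k. d (Suc k) \<le> d k / 4 + 6 * \<eta>" "0 \<le> \<eta>"
  shows "d (n + j) \<le> d n / 4 ^ j + 8 * \<eta>"
proof (induction j)
  \<comment> \<open>8 \<eta> is the fixed point of d -> d / 4 + 6 \<eta>.\<close>
  case (Suc j)
  have "d (n + Suc j) \<le> d (n + j) / 4 + 6 * \<eta>" using assms(1)[of "n + j"] by simp
  also have "\<dots> \<le> (d n / 4 ^ j + 8 * \<eta>) / 4 + 6 * \<eta>" using Suc by simp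
  finally show ?case by (simp add: field_simps)
qed (use assms in simp)

text \<open>
  \<open>a\<close> holds the magnitudes of the entries of the target, whose support is \<open>S\<close>, \<open>d k\<close> is the distance
  of the \<open>k\<close>-th iterate from the target, and \<open>J k\<close> is the support selected in step \<open>k\<close>.
\<close>

locale htp_error_sequence =
  fixes S :: "nat set" and s :: nat and a :: "nat \<Rightarrow> real" and \<eta> :: real
    and d :: "nat \<Rightarrow> real" and J :: "nat \<Rightarrow> nat set"
  assumes fin: "finite S" and card_S: "card S \<le> s" and a_pos: "\<And>i. i \<in> S \<Longrightarrow> 0 < a i"
    and eta: "0 \<le> \<eta>"
    and contr: "\<And>k. d (Suc k) \<le> d k / 4 + 6 * \<eta>"
    and capture: "\<And>k i. i \<in> S \<Longrightarrow> d k / 8 + 2 * \<eta> < a i \<Longrightarrow> i \<in> J (Suc k)"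
    and miss: "\<And>k. d k \<le> 2 * L2_set a (S - J k) + 2 * \<eta>"
begin

text \<open>
  With \<open>D = (\<Sum>i\<in>Q. (a i)\<^sup>2) / \<mu>\<^sup>2\<close>, about \<open>D\<close> iterations suffice to capture all entries of
  size at least \<open>\<mu> / 2\<close>, so \<open>4 |Q| - D\<close> is a potential that bounds the number of iterations
  that are still needed.
\<close>

lemma few_iterations_from:
  assumes "Q = {i \<in> S. a i \<le> \<mu>}" "S - J n \<subseteq> Q" "j0 \<in> Q" "a j0 = \<mu>"
  shows "\<exists>n'. real n' \<le> real n + 4 * card Q - (\<Sum>i\<in>Q. (a i)\<^sup>2) / \<mu>\<^sup>2 + s \<and> d n' \<le> 34 * \<eta>"
  using assms
proof (induction "card Q" arbitrary: Q \<mu> n j0 rule: less_induct)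
  case less
  have QS: "Q \<subseteq> S" and finQ: "finite Q" using less.prems fin by auto
  have mu: "\<mu> > 0" using less.prems a_pos by auto
  define D where "D = (\<Sum>i\<in>Q. (a i)\<^sup>2) / \<mu>\<^sup>2"
  have le: "(a i)\<^sup>2 \<le> \<mu>\<^sup>2" if "i \<in> Q" for i
    using that less.prems a_pos[of i] by (auto intro!: power_mono)
  have D_card: "D \<le> card Q"
    using sum_bounded_above[of Q "\<lambda>i. (a i)\<^sup>2" "\<mu>\<^sup>2"] le mu by (simp add: D_def field_simps)
  have D1: "1 \<le> D"
  proof -
    have "\<mu>\<^sup>2 \<le> (\<Sum>i\<in>Q. (a i)\<^sup>2)"
      using member_le_sum[of j0 Q "\<lambda>i. (a i)\<^sup>2"] less.prems finQ by auto
    thus ?thesis using mu by (simp add: D_def)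
  qed
  have T: "L2_set a (S - J n) \<le> \<mu> * sqrt D"
  proof -
    have "L2_set a (S - J n) \<le> sqrt (\<Sum>i\<in>Q. (a i)\<^sup>2)"
      unfolding L2_set_def using less.prems finQ by (intro real_sqrt_le_mono sum_mono2) auto
    also have "\<dots> = \<mu> * sqrt D" using mu by (simp add: D_def real_sqrt_divide)
    finally show ?thesis .
  qed
  have card_Qs: "card Q \<le> s" using card_mono[OF fin QS] card_S by simp
  show ?case
  proof (cases "\<mu> \<le> 12 * \<eta>")
    case True
    \<comment> \<open>All missed entries are at noise level here, so only the factor
      \<open>sqrt D\<close> is left to remove. The \<open>s\<close> contractions that end the
      recursion turn 26 \<eta> 4^s into 26 \<eta> + 8 \<eta>, the origin of 34.\<close>
    have "sqrt D \<le> 4 ^ s"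
    proof -
      have "real s < 2 ^ s" by simp
      hence "D \<le> 2 ^ s" using D_card card_Qs by linarith
      also have "\<dots> \<le> (4 ^ s)\<^sup>2" by (simp flip: power_mult add: power_mono power2_eq_square power_mult_distrib[symmetric])
      finally show ?thesis by (simp add: real_le_lsqrt)
    qed
    hence "L2_set a (S - J n) \<le> 12 * \<eta> * 4 ^ s"
      using T mult_mono[OF True, of "sqrt D" "4 ^ s"] eta D1 by simp
    hence "d n \<le> (24 * \<eta>) * 4 ^ s + 2 * \<eta>" using miss[of n] by simp
    moreover have "\<eta> * 1 \<le> \<eta> * 4 ^ s" using eta by (intro mult_left_mono) auto
    ultimately have "d n \<le> (26 * \<eta>) * 4 ^ s" by (simp add: algebra_simps)
    hence "d n / 4 ^ s \<le> 26 * \<eta>" by (simp add: field_simps)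
    hence "d (n + s) \<le> 34 * \<eta>" using geometric_contraction[of d \<eta> n s] contr eta by force
    moreover have "real (n + s) \<le> real n + 4 * card Q - D + s" using D_card by simp
    ultimately show ?thesis unfolding D_def by blast
  next
    case False
    \<comment> \<open>After \<open>j\<close> contractions the distance is at most 2 \<mu> + 8
      \<eta>, so entries above \<mu> / 4 + 3 \<eta> are captured; this is below \<mu> / 2 exactly
      when \<mu> > 12 \<eta>. The capturing step adds one iteration, and D >= 1 bounds j + 1 <= D +
      2 by 3 D.\<close>
    define j where "j = nat \<lceil>D\<rceil>"
    define n1 where "n1 = Suc (n + j)"
    have j: "D \<le> j" "real j \<le> D + 1" using D1 by (auto simp: j_def)
    have n1: "real n1 \<le> real n + 3 * D" using j D1 by (simp add: n1_def)
    have pow: "D + 1 \<le> 4 ^ j"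
    proof -
      have "real j + 1 \<le> 4 ^ j" using Bernoulli_inequality[of "3::real" j] by (simp add: algebra_simps)
      thus ?thesis using j by linarith
    qed
    have cap: "i \<in> J n1" if "i \<in> S" "\<mu> / 2 \<le> a i" for i
    proof -
      have "sqrt D \<le> D" using D1 by (simp add: real_le_lsqrt power2_eq_square)
      hence "\<mu> * sqrt D \<le> \<mu> * D" using mu by (intro mult_left_mono) auto
      hence "d n \<le> 2 * (\<mu> * D) + 2 * \<eta>" using miss[of n] T by linarith
      hence "d n \<le> 2 * (\<mu> * (D + 1))" using False mu by (simp add: algebra_simps)
      also have "\<dots> \<le> 2 * (\<mu> * 4 ^ j)" using pow mu by simp
      finally have "d n / 4 ^ j \<le> 2 * \<mu>" by (simp add: field_simps)
      hence "d (n + j) / 8 + 2 * \<eta> < \<mu> / 2"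
        using geometric_contraction[of d \<eta> n j] contr eta False by force
      thus ?thesis unfolding n1_def using that by (intro capture) auto
    qed
    define Q' where "Q' = {i \<in> S. a i < \<mu> / 2}"
    have sub: "S - J n1 \<subseteq> Q'" using cap by (force simp: Q'_def)
    show ?thesis
    proof (cases "Q' = {}")
      case True
      hence "S - J n1 = {}" using sub by simp
      hence "d n1 \<le> 2 * \<eta>" using miss[of n1] by (metis L2_set_empty mult_zero_right add_0)
      moreover have "real n1 \<le> real n + 4 * card Q - D + s" using n1 D_card by linarith
      ultimately show ?thesis using eta unfolding D_def by (intro exI[of _ n1]) auto
    next
      case Q'ne: False
      have finQ': "finite Q'" using fin by (simp add: Q'_def)
      define \<mu>' where "\<mu>' = Max (a ` Q')"
      obtain j1 where j1: "j1 \<in> Q'" "a j1 = \<mu>'"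
        using Max_in[of "a ` Q'"] finQ' Q'ne unfolding \<mu>'_def by fastforce
      have max: "a i \<le> \<mu>'" if "i \<in> Q'" for i using that finQ' by (simp add: \<mu>'_def)
      have mu': "0 < \<mu>'" "\<mu>' < \<mu> / 2" using j1 a_pos by (auto simp: Q'_def)
      have Q'eq: "Q' = {i \<in> S. a i \<le> \<mu>'}" using max mu' by (force simp: Q'_def)
      have "Q' \<subseteq> Q" using mu less.prems by (auto simp: Q'_def)
      moreover have "j0 \<notin> Q'" using less.prems mu by (auto simp: Q'_def)
      ultimately have psub: "Q' \<subset> Q" using less.prems by blast
      hence cless: "card Q' < card Q" using finQ by (rule psubset_card_mono[rotated])
      \<comment> \<open>Passing from \<mu> to \<open>\<mu>'\<close> multiplies the share of
        \<open>Q'\<close> in \<open>D\<close> by at least 4. The resulting bound 4 D <= 4 (|Q| -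
        |Q'|) + D' is exactly what pays for the 3 D iterations of this phase.\<close>
      define D' where "D' = (\<Sum>i\<in>Q'. (a i)\<^sup>2) / \<mu>'\<^sup>2"
      obtain n' where n': "real n' \<le> real n1 + 4 * card Q' - D' + s" "d n' \<le> 34 * \<eta>"
        using less.hyps[OF cless Q'eq sub j1] unfolding D'_def by blast
      have "D = (\<Sum>i\<in>Q - Q'. (a i)\<^sup>2) / \<mu>\<^sup>2 + (\<Sum>i\<in>Q'. (a i)\<^sup>2) / \<mu>\<^sup>2"
        using psub finQ sum.subset_diff[of Q' Q "\<lambda>i. (a i)\<^sup>2"]
        by (simp add: D_def add_divide_distrib psubset_imp_subset)
      moreover have "(\<Sum>i\<in>Q - Q'. (a i)\<^sup>2) / \<mu>\<^sup>2 \<le> card (Q - Q')"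
        using sum_bounded_above[of "Q - Q'" "\<lambda>i. (a i)\<^sup>2" "\<mu>\<^sup>2"] le mu by (simp add: field_simps)
      moreover have "card (Q - Q') = real (card Q) - card Q'"
        using psub finQ' cless by (simp add: card_Diff_subset psubset_imp_subset)
      moreover have "(\<Sum>i\<in>Q'. (a i)\<^sup>2) / \<mu>\<^sup>2 \<le> (\<Sum>i\<in>Q'. (a i)\<^sup>2) / (4 * \<mu>'\<^sup>2)"
      proof -
        have "(2 * \<mu>')\<^sup>2 \<le> \<mu>\<^sup>2" using mu' by (intro power_mono) auto
        thus ?thesis using mu' by (intro divide_left_mono sum_nonneg) auto
      qed
      ultimately have "D \<le> real (card Q) - card Q' + D' / 4" by (simp add: D'_def)
      hence "real n' \<le> real n + 4 * card Q - D + s" using n' n1 by linarith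
      thus ?thesis using n' unfolding D_def by blast
    qed
  qed
qed

text \<open>The potential started at all of \<open>S\<close> allows at most 4 |S| + s <= 5 s
  iterations. The level 34 \<eta> is preserved by the contraction, since 34 / 4 + 6 < 34, so running
  longer does no harm.\<close>

lemma error_after_many_iterations:
  assumes "5 * s \<le> k"
  shows "d k \<le> 34 * \<eta>"
proof -
  have "\<exists>n'. n' \<le> 5 * s \<and> d n' \<le> 34 * \<eta>"
  proof (cases "S = {}")
    case True
    thus ?thesis using miss[of 0] eta by (intro exI[of _ 0]) auto
  next
    case False
    define \<mu> where "\<mu> = Max (a ` S)"
    obtain j0 where j0: "j0 \<in> S" "a j0 = \<mu>"
      using Max_in[of "a ` S"] fin False unfolding \<mu>_def by fastforce
    have "S = {i \<in> S. a i \<le> \<mu>}" using fin by (auto simp: \<mu>_def)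
    from few_iterations_from[OF this _ j0, of 0] obtain n'
      where n': "real n' \<le> 4 * card S - (\<Sum>i\<in>S. (a i)\<^sup>2) / \<mu>\<^sup>2 + s" "d n' \<le> 34 * \<eta>" by auto
    have "0 \<le> (\<Sum>i\<in>S. (a i)\<^sup>2) / \<mu>\<^sup>2" by (simp add: sum_nonneg)
    hence "real n' \<le> real (5 * s)" using n'(1) card_S by simp
    thus ?thesis using n' by (metis of_nat_le_iff)
  qed
  then obtain n' where n': "n' \<le> 5 * s" "d n' \<le> 34 * \<eta>" by blast
  have "d (n' + j) \<le> 34 * \<eta>" for j
  proof (induction j)
    case (Suc j)
    have "d (n' + Suc j) \<le> d (n' + j) / 4 + 6 * \<eta>" using contr[of "n' + j"] by simp
    thus ?case using Suc eta by linarith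
  qed (use n' in simp)
  from this[of "k - n'"] show ?thesis using n' assms by simp
qed

end

section \<open>Sparse recovery\<close>

text \<open>Vectors are functions on all naturals of which only the entries below the dimension
  count, so restrictions and linear combinations carry no dimension conditions. \<open>fn\<close>
  links them to the vectors of the algorithms.\<close>

definition ip :: "nat \<Rightarrow> (nat \<Rightarrow> complex) \<Rightarrow> (nat \<Rightarrow> complex) \<Rightarrow> complex" where
  "ip n x y = (\<Sum>i<n. cnj (x i) * y i)"

text \<open>The index type is left open because index pairs give the Frobenius norm.\<close>

definition nrm :: "'a set \<Rightarrow> ('a \<Rightarrow> complex) \<Rightarrow> real" where
  "nrm I x = L2_set (\<lambda>i. cmod (x i)) I"

definition restr :: "nat set \<Rightarrow> (nat \<Rightarrow> complex) \<Rightarrow> nat \<Rightarrow> complex" where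
  "restr I x = (\<lambda>i. if i \<in> I then x i else 0)"

definition sparse :: "nat \<Rightarrow> nat \<Rightarrow> (nat \<Rightarrow> complex) \<Rightarrow> bool" where
  "sparse n s x \<longleftrightarrow> card {i. i < n \<and> x i \<noteq> 0} \<le> s"

definition lin :: "nat \<Rightarrow> (nat \<Rightarrow> nat \<Rightarrow> complex) \<Rightarrow> (nat \<Rightarrow> complex) \<Rightarrow> nat \<Rightarrow> complex" where
  "lin n P x l = (\<Sum>i<n. P l i * x i)"

lemma nrm_nonneg [simp]: "0 \<le> nrm I x"
  by (simp add: nrm_def L2_set_nonneg)

lemma nrm_empty [simp]: "nrm {} x = 0"
  by (simp add: nrm_def)

lemma nrm_sq: "(nrm I x)\<^sup>2 = (\<Sum>i\<in>I. (cmod (x i))\<^sup>2)"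
  by (simp add: nrm_def L2_set_def sum_nonneg)

lemma nrm_cong: "(\<And>i. i \<in> I \<Longrightarrow> x i = y i) \<Longrightarrow> nrm I x = nrm I y"
  by (simp add: nrm_def cong: L2_set_cong)

lemma nrm_add: "nrm I (\<lambda>i. x i + y i) \<le> nrm I x + nrm I y"
  unfolding nrm_def
  by (rule order_trans[OF L2_set_mono L2_set_triangle_ineq]) (auto intro: norm_triangle_ineq)

lemma nrm_scale: "nrm I (\<lambda>i. c * x i) = cmod c * nrm I x"
  by (simp add: nrm_def norm_mult L2_set_right_distrib)

lemma nrm_minus_commute: "nrm I (\<lambda>i. x i - y i) = nrm I (\<lambda>i. y i - x i)"
  by (simp add: nrm_def norm_minus_commute)

lemma nrm_diff: "nrm I (\<lambda>i. x i - y i) \<le> nrm I x + nrm I y"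
  using nrm_add[of I x "\<lambda>i. - y i"] by (simp add: nrm_def)

lemma nrm_mono: "finite K \<Longrightarrow> I \<subseteq> K \<Longrightarrow> nrm I x \<le> nrm K x"
  unfolding nrm_def L2_set_def by (intro real_sqrt_le_mono sum_mono2) auto

lemma nrm_eq_of_zero: "finite K \<Longrightarrow> I \<subseteq> K \<Longrightarrow> (\<And>i. i \<in> K - I \<Longrightarrow> x i = 0) \<Longrightarrow> nrm K x = nrm I x"
  unfolding nrm_def L2_set_def by (subst sum.mono_neutral_right[of K I]) auto

lemma nrm_Un: "finite I \<Longrightarrow> finite K \<Longrightarrow> nrm (I \<union> K) x \<le> nrm I x + nrm K x"
proof -
  assume fin: "finite I" "finite K"
  have "(nrm (I \<union> K) x)\<^sup>2 \<le> (nrm I x)\<^sup>2 + (nrm K x)\<^sup>2"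
    unfolding nrm_sq using fin by (subst sum.union_inter[symmetric]) (auto simp: sum_nonneg)
  also have "\<dots> \<le> (nrm I x + nrm K x)\<^sup>2" by (simp add: power2_sum)
  finally show ?thesis by (rule power2_le_imp_le) simp
qed

lemma cmod_le_nrm: "finite I \<Longrightarrow> i \<in> I \<Longrightarrow> cmod (x i) \<le> nrm I x"
  unfolding nrm_def by (rule member_le_L2_set) auto

lemma ip_self: "ip n x x = of_real ((nrm {..<n} x)\<^sup>2)"
  by (simp add: ip_def nrm_sq complex_norm_square mult.commute flip: of_real_power)

lemma ip_cong: "(\<And>i. i < n \<Longrightarrow> x i = x' i) \<Longrightarrow> (\<And>i. i < n \<Longrightarrow> y i = y' i) \<Longrightarrow> ip n x y = ip n x' y'"
  by (simp add: ip_def)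

lemma ip_cnj: "cnj (ip n x y) = ip n y x"
  by (simp add: ip_def mult.commute)

lemma ip_add_right: "ip n x (\<lambda>i. y i + z i) = ip n x y + ip n x z"
  by (simp add: ip_def algebra_simps sum.distrib)

lemma ip_diff_right: "ip n x (\<lambda>i. y i - z i) = ip n x y - ip n x z"
  by (simp add: ip_def algebra_simps sum_subtractf)

lemma ip_scale_right: "ip n x (\<lambda>i. c * y i) = c * ip n x y"
  by (simp add: ip_def sum_distrib_left algebra_simps)

lemma ip_scale_left: "ip n (\<lambda>i. c * x i) y = cnj c * ip n x y"
  by (simp add: ip_def sum_distrib_left algebra_simps)

lemma ip_diff_left: "ip n (\<lambda>i. x i - z i) y = ip n x y - ip n z y"
  by (simp add: ip_def algebra_simps sum_subtractf)

lemma cauchy_schwarz: "cmod (ip n x y) \<le> nrm {..<n} x * nrm {..<n} y"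
proof -
  have "cmod (ip n x y) \<le> (\<Sum>i<n. \<bar>cmod (x i)\<bar> * \<bar>cmod (y i)\<bar>)"
    unfolding ip_def by (rule order_trans[OF norm_sum]) (simp add: norm_mult)
  also have "\<dots> \<le> nrm {..<n} x * nrm {..<n} y" unfolding nrm_def by (rule L2_set_mult_ineq)
  finally show ?thesis .
qed

lemma le_of_sq_le_mult: "0 \<le> (t::real) \<Longrightarrow> 0 \<le> B \<Longrightarrow> t\<^sup>2 \<le> B * t \<Longrightarrow> t \<le> B"
  by (cases "t = 0") (auto simp: power2_eq_square)

text \<open>Without the common part, \<open>J - T\<close> has at least as many elements as
  \<open>T - J\<close>, and its smallest magnitude dominates everything on
  \<open>T - J\<close>.\<close>

lemma top_difference_le:
  assumes fin: "finite J" "finite T" and card: "card T \<le> card J"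
    and top: "\<And>i j. i \<in> J \<Longrightarrow> j \<in> T - J \<Longrightarrow> cmod (f j) \<le> cmod (f i)"
  shows "nrm (T - J) f \<le> nrm (J - T) f"
proof (cases "T - J = {}")
  case True
  thus ?thesis by (simp only: nrm_empty nrm_nonneg)
next
  case False
  have cards: "card (T - J) \<le> card (J - T)"
  proof -
    have "card (T - J) = card T - card (T \<inter> J)" "card (J - T) = card J - card (T \<inter> J)"
      using fin by (simp_all add: card_Diff_subset_Int Int_commute)
    thus ?thesis using card by simp
  qed
  have ne: "J - T \<noteq> {}"
    using cards False fin by (metis card.empty card_0_eq finite_Diff le_zero_eq)
  define \<mu> where "\<mu> = Min ((\<lambda>i. cmod (f i)) ` (J - T))"
  have "\<mu> \<in> (\<lambda>i. cmod (f i)) ` (J - T)" unfolding \<mu>_def using ne fin by (intro Min_in) auto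
  then obtain i0 where i0: "i0 \<in> J - T" "\<mu> = cmod (f i0)" by blast
  have "(nrm (T - J) f)\<^sup>2 \<le> card (T - J) * \<mu>\<^sup>2"
    unfolding nrm_sq using top[of i0] i0 by (intro sum_bounded_above power_mono) auto
  also have "\<dots> \<le> card (J - T) * \<mu>\<^sup>2" using cards by (intro mult_right_mono) auto
  also have "\<dots> \<le> (nrm (J - T) f)\<^sup>2"
    unfolding nrm_sq
  proof (intro sum_bounded_below power_mono)
    show "0 \<le> \<mu>" by (simp add: i0(2))
  qed (use fin in \<open>simp add: \<mu>_def\<close>)
  finally show ?thesis by (rule power2_le_imp_le) simp
qed

lemma top_nrm_le:
  assumes "finite J" "finite T" "card T \<le> card J"
    "\<And>i j. i \<in> J \<Longrightarrow> j \<in> T - J \<Longrightarrow> cmod (f j) \<le> cmod (f i)"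
  shows "nrm T f \<le> nrm J f"
proof -
  have "(nrm T f)\<^sup>2 = (nrm (T \<inter> J) f)\<^sup>2 + (nrm (T - J) f)\<^sup>2"
    unfolding nrm_sq using assms sum.Int_Diff by blast
  also have "\<dots> \<le> (nrm (J \<inter> T) f)\<^sup>2 + (nrm (J - T) f)\<^sup>2"
    using top_difference_le[OF assms] by (simp add: Int_commute power_mono)
  also have "\<dots> = (nrm J f)\<^sup>2"
    unfolding nrm_sq by (rule sum.Int_Diff[OF assms(1), symmetric])
  finally show ?thesis by (rule power2_le_imp_le) simp
qed

lemma restr_nrm: "I \<subseteq> {..<n} \<Longrightarrow> nrm {..<n} (restr I x) = nrm I x"
  by (subst nrm_eq_of_zero[of _ I]) (auto simp: restr_def intro!: nrm_cong)

lemma restr_ip: "I \<subseteq> {..<n} \<Longrightarrow> ip n (restr I x) x = of_real ((nrm I x)\<^sup>2)"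
proof -
  assume I: "I \<subseteq> {..<n}"
  have "ip n (restr I x) x = ip n (restr I x) (restr I x)" by (auto simp: ip_def restr_def intro!: sum.cong)
  thus ?thesis by (simp add: ip_self restr_nrm[OF I])
qed

lemma restr_sparse: "finite I \<Longrightarrow> card I \<le> s \<Longrightarrow> sparse n s (restr I x)"
  unfolding sparse_def restr_def by (rule order_trans[OF card_mono[of I]]) auto

lemma sparseI: "finite I \<Longrightarrow> card I \<le> s \<Longrightarrow> (\<And>i. i < n \<Longrightarrow> i \<notin> I \<Longrightarrow> x i = 0) \<Longrightarrow> sparse n s x"
  unfolding sparse_def by (rule order_trans[OF card_mono[of I]]) auto

section \<open>One step of HTP under restricted isometry\<close>

lemma lin_diff: "lin n P (\<lambda>i. x i - y i) l = lin n P x l - lin n P y l"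
  by (simp add: lin_def algebra_simps sum_subtractf)

lemma lin_adjoint: "ip n y (\<lambda>i. \<Sum>l<m. cnj (P l i) * r l) = ip m (lin n P y) r"
  unfolding ip_def lin_def
  by (simp add: sum_distrib_left sum_distrib_right mult_ac) (subst sum.swap, simp)

text \<open>\<open>xs\<close> is the target and \<open>e\<close> the noise. The assumption
  \<open>noise\<close> controls \<open>e\<close> only through its correlation with images of sparse
  vectors, because in the application \<open>e\<close> contains measurements of a component of the
  signal and can be large in norm.\<close>

locale sparse_recovery =
  fixes n m s :: nat and P :: "nat \<Rightarrow> nat \<Rightarrow> complex" and \<delta> \<eta> :: real
    and xs b e :: "nat \<Rightarrow> complex"
  assumes rip: "\<And>y z. sparse n (3 * s) y \<Longrightarrow> sparse n (3 * s) z \<Longrightarrow>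
      cmod (ip m (lin n P y) (lin n P z) - ip n y z) \<le> \<delta> * nrm {..<n} y * nrm {..<n} z"
    and noise: "\<And>y. sparse n (3 * s) y \<Longrightarrow> cmod (ip m (lin n P y) e) \<le> \<eta> * nrm {..<n} y"
    and delta: "0 \<le> \<delta>" "\<delta> \<le> 1 / 16" and eta: "0 \<le> \<eta>"
    and xs: "sparse n s xs"
    and b: "\<And>l. l < m \<Longrightarrow> b l = lin n P xs l + e l"
begin

definition S where "S = {i. i < n \<and> xs i \<noteq> 0}"

text \<open>Gradient step of length one for half the squared residual; HTP selects its largest
  entries.\<close>

definition upd :: "(nat \<Rightarrow> complex) \<Rightarrow> nat \<Rightarrow> complex" where
  "upd x = (\<lambda>i. x i + (\<Sum>l<m. cnj (P l i) * (b l - lin n P x l)))"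

definition dst :: "(nat \<Rightarrow> complex) \<Rightarrow> real" where
  "dst x = nrm {..<n} (\<lambda>i. x i - xs i)"

lemma finite_S: "finite S" and S_sub: "S \<subseteq> {..<n}" and card_S: "card S \<le> s"
  using xs by (auto simp: S_def sparse_def)

lemma residual_correlation:
  "ip m (lin n P y) (\<lambda>l. b l - lin n P x l) = ip m (lin n P y) e - ip m (lin n P y) (lin n P (\<lambda>i. x i - xs i))"
proof -
  have "ip m (lin n P y) (\<lambda>l. b l - lin n P x l) = ip m (lin n P y) (\<lambda>l. e l - lin n P (\<lambda>i. x i - xs i) l)"
    by (rule ip_cong) (simp_all add: lin_diff b)
  thus ?thesis by (simp add: ip_diff_right)
qed

text \<open>Tested against its own restriction to \<open>I\<close>, the error of the updated vector
  equals the correlation with the noise minus the deviation of the Gram form from the identity. Both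
  are bounded by multiples of the norm on \<open>I\<close>, one factor of which cancels.\<close>

lemma update_error:
  assumes I: "I \<subseteq> {..<n}" "card I \<le> 3 * s" and sp: "sparse n (3 * s) (\<lambda>i. x i - xs i)"
  shows "nrm I (\<lambda>i. upd x i - xs i) \<le> \<delta> * dst x + \<eta>"
proof -
  define w where "w = (\<lambda>i. upd x i - xs i)"
  define h where "h = (\<lambda>i. x i - xs i)"
  define y where "y = restr I w"
  have y: "sparse n (3 * s) y" "nrm {..<n} y = nrm I w"
    using I finite_subset[OF I(1)] by (auto simp: y_def restr_nrm intro!: restr_sparse)
  have "w = (\<lambda>i. h i + (\<Sum>l<m. cnj (P l i) * (b l - lin n P x l)))"
    by (auto simp: w_def h_def upd_def)
  hence "ip n y w = ip n y h + ip m (lin n P y) (\<lambda>l. b l - lin n P x l)"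
    by (simp add: ip_add_right lin_adjoint)
  also have "\<dots> = ip m (lin n P y) e - (ip m (lin n P y) (lin n P h) - ip n y h)"
    by (simp add: residual_correlation h_def)
  finally have "cmod (ip n y w) \<le> \<eta> * nrm {..<n} y + \<delta> * nrm {..<n} y * nrm {..<n} h"
    using noise[OF y(1)] rip[OF y(1), of h] sp norm_triangle_ineq4 unfolding h_def
    by (smt (verit))
  moreover have "cmod (ip n y w) = (nrm I w)\<^sup>2"
    using I by (simp add: y_def restr_ip norm_power)
  ultimately have "(nrm I w)\<^sup>2 \<le> (\<delta> * dst x + \<eta>) * nrm I w"
    by (simp add: y(2) dst_def h_def algebra_simps)
  moreover have "0 \<le> \<delta> * dst x + \<eta>" using delta eta by (simp add: dst_def)
  ultimately show ?thesis using le_of_sq_le_mult[of "nrm I w"] by (simp add: w_def)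
qed

text \<open>Orthogonality of the residual bounds the error on \<open>J\<close> by the same test as
  for the update; off \<open>J\<close> the error is the missed part of \<open>xs\<close>. Solving
  for \<open>dst x\<close> costs 1 / (1 - \<delta>) <= 2.\<close>

lemma least_squares_error:
  assumes J: "J \<subseteq> {..<n}" "card J \<le> s" and x: "\<And>i. i < n \<Longrightarrow> i \<notin> J \<Longrightarrow> x i = 0"
    and orth: "\<And>y. (\<And>i. i < n \<Longrightarrow> i \<notin> J \<Longrightarrow> y i = 0) \<Longrightarrow> ip m (lin n P y) (\<lambda>l. b l - lin n P x l) = 0"
  shows "dst x \<le> 2 * nrm (S - J) xs + 2 * \<eta>"
proof -
  define h where "h = (\<lambda>i. x i - xs i)"
  define y where "y = restr J h"
  have finJ: "finite J" using J finite_subset by blast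
  have y: "sparse n (3 * s) y" "nrm {..<n} y = nrm J h"
    using J finJ by (auto simp: y_def restr_nrm intro!: restr_sparse)
  have h: "sparse n (3 * s) h"
    using card_Un_le[of J S] card_S J finJ finite_S x
    by (intro sparseI[of "J \<union> S"]) (auto simp: h_def S_def)
  have "ip m (lin n P y) (\<lambda>l. b l - lin n P x l) = 0"
    by (rule orth) (simp add: y_def restr_def)
  hence "ip m (lin n P y) e = ip m (lin n P y) (lin n P h)"
    by (simp add: residual_correlation h_def)
  hence "ip n y h = ip m (lin n P y) e - (ip m (lin n P y) (lin n P h) - ip n y h)" by simp
  hence "cmod (ip n y h) \<le> \<eta> * nrm {..<n} y + \<delta> * nrm {..<n} y * nrm {..<n} h"
    using noise[OF y(1)] rip[OF y(1) h] norm_triangle_ineq4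
    by (smt (verit))
  moreover have "cmod (ip n y h) = (nrm J h)\<^sup>2"
    using J by (simp add: y_def restr_ip norm_power)
  ultimately have "(nrm J h)\<^sup>2 \<le> (\<delta> * dst x + \<eta>) * nrm J h"
    by (simp add: y(2) dst_def h_def algebra_simps)
  moreover have "0 \<le> \<delta> * dst x + \<eta>" using delta eta by (simp add: dst_def)
  ultimately have J1: "nrm J h \<le> \<delta> * dst x + \<eta>" using le_of_sq_le_mult[of "nrm J h"] by simp
  have "dst x = nrm (J \<union> (S - J)) h"
    unfolding dst_def h_def[symmetric]
    using J S_sub x by (intro nrm_eq_of_zero) (auto simp: h_def S_def)
  also have "\<dots> \<le> nrm J h + nrm (S - J) h" using finJ finite_S by (intro nrm_Un) auto
  also have "nrm (S - J) h = nrm (S - J) xs"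
    using x S_sub unfolding nrm_def by (intro L2_set_cong) (auto simp: h_def subset_iff)
  finally have "dst x \<le> \<delta> * dst x + \<eta> + nrm (S - J) xs" using J1 by simp
  moreover have "\<delta> * dst x \<le> 1 / 16 * dst x" using delta by (intro mult_right_mono) (auto simp: dst_def)
  moreover have "0 \<le> nrm (S - J) xs" by simp
  ultimately show ?thesis using eta by linarith
qed

text \<open>The selection makes \<open>upd x\<close> on \<open>S - J\<close> no larger than on
  \<open>J - S\<close>, and there it is pure error because \<open>xs\<close> vanishes. So the missed
  part is at most two update errors, and \<delta> <= 1/16 gives the factor 1/8.\<close>

lemma selection_error:
  assumes J: "J \<subseteq> {..<n}" "card J = s" and sp: "sparse n (3 * s) (\<lambda>i. x i - xs i)"
    and top: "\<And>i j. i \<in> J \<Longrightarrow> j < n \<Longrightarrow> j \<notin> J \<Longrightarrow> cmod (upd x j) \<le> cmod (upd x i)"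
  shows "nrm (S - J) xs \<le> dst x / 8 + 2 * \<eta>"
proof -
  have finJ: "finite J" using J finite_subset by blast
  define w where "w = (\<lambda>i. upd x i - xs i)"
  have "nrm (S - J) (upd x) \<le> nrm (J - S) (upd x)"
    using finJ finite_S card_S J top S_sub by (intro top_difference_le) auto
  also have "\<dots> = nrm (J - S) w"
    using J by (intro nrm_cong) (auto simp: w_def S_def)
  finally have 1: "nrm (S - J) (upd x) \<le> nrm (J - S) w" .
  have "nrm (S - J) xs \<le> nrm (S - J) (upd x) + nrm (S - J) w"
    using nrm_diff[of "S - J" "upd x" w] by (simp add: w_def)
  moreover have "nrm (J - S) w \<le> \<delta> * dst x + \<eta>"
    unfolding w_def using J sp card_mono[OF finJ, of "J - S"] by (intro update_error) auto
  moreover have "nrm (S - J) w \<le> \<delta> * dst x + \<eta>"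
    unfolding w_def using S_sub sp card_S card_mono[OF finite_S, of "S - J"] by (intro update_error) auto
  moreover have "\<delta> * dst x \<le> 1 / 16 * dst x" using delta by (intro mult_right_mono) (auto simp: dst_def)
  ultimately show ?thesis using 1 by linarith
qed

lemma htp_sequence_error:
  fixes x :: "nat \<Rightarrow> nat \<Rightarrow> complex" and J :: "nat \<Rightarrow> nat set"
  assumes x0: "\<And>i. i < n \<Longrightarrow> x 0 i = 0" and k: "5 * s \<le> k"
    and J: "\<And>j. j < k \<Longrightarrow> J j \<subseteq> {..<n}" "\<And>j. j < k \<Longrightarrow> card (J j) = s"
    and top: "\<And>j i i'. j < k \<Longrightarrow> i \<in> J j \<Longrightarrow> i' < n \<Longrightarrow> i' \<notin> J j \<Longrightarrow>
        cmod (upd (x j) i') \<le> cmod (upd (x j) i)"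
    and supp: "\<And>j i. j < k \<Longrightarrow> i < n \<Longrightarrow> i \<notin> J j \<Longrightarrow> x (Suc j) i = 0"
    and orth: "\<And>j y. j < k \<Longrightarrow> (\<And>i. i < n \<Longrightarrow> i \<notin> J j \<Longrightarrow> y i = 0) \<Longrightarrow>
        ip m (lin n P y) (\<lambda>l. b l - lin n P (x (Suc j)) l) = 0"
  shows "dst (x k) \<le> 34 * \<eta>"
proof -
  \<comment> \<open>The run stops after \<open>k\<close> steps while the abstract sequence is
    infinite; it is continued by distance zero and full support. \<open>K 0\<close> is empty because
    nothing has been selected before the first step, and the shift by one reflects that
    \<open>J j\<close> leads to iterate \<open>Suc j\<close>.\<close>
  define K where "K j = (if j = 0 then {} else if j \<le> k then J (j - 1) else S)" for j
  define d where "d j = (if j \<le> k then dst (x j) else 0)" for j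
  have sp: "sparse n (3 * s) (\<lambda>i. x j i - xs i)" if "j \<le> k" for j
  proof (cases j)
    case 0
    thus ?thesis using x0 card_S finite_S by (intro sparseI[of S]) (auto simp: S_def)
  next
    case (Suc j')
    thus ?thesis using that J[of j'] supp[of j'] card_S finite_S card_Un_le[of "J j'" S] finite_subset[of "J j'"]
      by (intro sparseI[of "J j' \<union> S"]) (auto simp: S_def)
  qed
  have dpos: "0 \<le> dst y" for y by (simp add: dst_def)
  have miss: "d j \<le> 2 * L2_set (\<lambda>i. cmod (xs i)) (S - K j) + 2 * \<eta>" for j
  proof -
    consider "j = 0" | j' where "j = Suc j'" "j' < k" | "k < j" by (cases j) force+
    thus ?thesis
    proof cases
      case 1
      have "dst (x 0) = nrm {..<n} xs" using x0 by (auto simp: dst_def nrm_def intro!: L2_set_cong)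
      also have "\<dots> = nrm S xs" using S_sub by (intro nrm_eq_of_zero) (auto simp: S_def)
      finally show ?thesis using 1 eta by (simp add: d_def K_def nrm_def L2_set_nonneg)
    next
      case 2
      have "dst (x (Suc j')) \<le> 2 * nrm (S - J j') xs + 2 * \<eta>"
        using J(1,2)[OF 2(2)] supp[OF 2(2)] orth[OF 2(2)] by (intro least_squares_error) auto
      thus ?thesis using 2 by (simp add: d_def K_def nrm_def)
    qed (use eta in \<open>simp add: d_def L2_set_nonneg\<close>)
  qed
  have sel: "nrm (S - K (Suc j)) xs \<le> d j / 8 + 2 * \<eta>" for j
  proof (cases "j < k")
    case True
    thus ?thesis using J[of j] sp[of j] top[of j] selection_error[of "J j" "x j"] by (auto simp: d_def K_def)
  qed (use eta dpos in \<open>auto simp: d_def K_def\<close>)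
  interpret htp_error_sequence S s "\<lambda>i. cmod (xs i)" \<eta> d K
  proof
    \<comment> \<open>The selection error enters \<open>miss\<close> twice: 2 (d j / 8 + 2 \<eta>) +
      2 \<eta>.\<close>
    show "d (Suc j) \<le> d j / 4 + 6 * \<eta>" for j
      using miss[of "Suc j"] sel[of j] by (simp add: nrm_def)
    show "i \<in> K (Suc j)" if "i \<in> S" "d j / 8 + 2 * \<eta> < cmod (xs i)" for i j
      using that sel[of j] cmod_le_nrm[of "S - K (Suc j)" i xs] finite_S by force
  qed (use finite_S card_S eta miss in \<open>auto simp: S_def\<close>)
  show ?thesis using error_after_many_iterations[OF k] by (simp add: d_def)
qed

end

section \<open>Transfer of HTP runs to functions on indices\<close>

abbreviation fn :: "complex Matrix.vec \<Rightarrow> nat \<Rightarrow> complex" where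
  "fn x \<equiv> (\<lambda>i. x $ i)"

lemma vec_norm2_nrm: "x \<in> carrier_vec n \<Longrightarrow> vec_norm2 x = nrm {..<n} (fn x)"
  by (auto simp: vec_norm2_def nrm_def L2_set_def)

lemma mult_mat_vec_lin:
  assumes "\<Phi> \<in> carrier_mat m n" "x \<in> carrier_vec n" "l < m"
  shows "(\<Phi> *\<^sub>v x) $ l = lin n (\<lambda>l i. \<Phi> $$ (l, i)) (fn x) l"
  using assms by (auto simp: lin_def scalar_prod_def atLeast0LessThan)

lemma mat_adjoint_index:
  assumes "A \<in> carrier_mat m n" "i < n" "l < m"
  shows "mat_adjoint A $$ (i, l) = cnj (A $$ (l, i))"
  using assms by (auto simp: mat_adjoint_def mat_of_rows_def)

lemma mat_adjoint_carrier:
  assumes "A \<in> carrier_mat m n" shows "mat_adjoint A \<in> carrier_mat n m"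
  using assms by (auto simp: mat_adjoint_def)

lemma adjoint_mult_vec:
  assumes "\<Phi> \<in> carrier_mat m n" "r \<in> carrier_vec m" "i < n"
  shows "(mat_adjoint \<Phi> *\<^sub>v r) $ i = (\<Sum>l<m. cnj (\<Phi> $$ (l, i)) * r $ l)"
  using assms mat_adjoint_carrier[OF assms(1)] mat_adjoint_index[OF assms(1)]
  by (auto simp: scalar_prod_def atLeast0LessThan intro!: sum.cong)

text \<open>Subtracting the optimal multiple of \<open>g\<close>, with coefficient
  \<open>ip m g r\<close> / |g|^2, would lower the squared norm by |\<open>ip m g r\<close>|^2 /
  |g|^2.\<close>

lemma orthogonal_if_minimal:
  assumes "\<And>c. nrm {..<m} r \<le> nrm {..<m} (\<lambda>l. r l - c * g l)"
  shows "ip m g r = 0"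
proof (cases "nrm {..<m} g = 0")
  case True
  thus ?thesis using cauchy_schwarz[of m g r] by simp
next
  case False
  define N where "N = (nrm {..<m} g)\<^sup>2"
  define c where "c = ip m g r / of_real N"
  have N: "N > 0" using False by (simp add: N_def)
  have "of_real ((nrm {..<m} (\<lambda>l. r l - c * g l))\<^sup>2) = ip m (\<lambda>l. r l - c * g l) (\<lambda>l. r l - c * g l)"
    by (simp only: ip_self)
  also have "\<dots> = ip m r r - c * ip m r g - (cnj c * ip m g r - cnj c * c * ip m g g)"
    by (simp add: ip_diff_left ip_diff_right ip_scale_left ip_scale_right algebra_simps)
  also have "\<dots> = of_real ((nrm {..<m} r)\<^sup>2) - ip m g r * cnj (ip m g r) / of_real N"
    using N by (simp add: ip_self c_def N_def[symmetric] ip_cnj[of m g r, symmetric] field_simps)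
  also have "\<dots> = of_real ((nrm {..<m} r)\<^sup>2 - (cmod (ip m g r))\<^sup>2 / N)"
    by (simp only: of_real_diff of_real_divide complex_norm_square)
  finally have "(nrm {..<m} (\<lambda>l. r l - c * g l))\<^sup>2 = (nrm {..<m} r)\<^sup>2 - (cmod (ip m g r))\<^sup>2 / N"
    by (simp only: of_real_eq_iff)
  moreover have "(nrm {..<m} r)\<^sup>2 \<le> (nrm {..<m} (\<lambda>l. r l - c * g l))\<^sup>2"
    using assms by (intro power_mono) auto
  ultimately have "(cmod (ip m g r))\<^sup>2 / N \<le> 0" by simp
  thus ?thesis using N by (simp add: divide_le_0_iff)
qed

text \<open>The vectors supported in \<open>J\<close> form a subspace, so every multiple of
  \<open>y\<close> is an admissible variation of \<open>x\<close>.\<close>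

lemma argmin_orthogonal:
  assumes \<Phi>: "\<Phi> \<in> carrier_mat m n" and b: "b \<in> carrier_vec m" and x: "x \<in> carrier_vec n" "vec_supp x \<subseteq> J"
    and min: "\<And>y. y \<in> carrier_vec n \<Longrightarrow> vec_supp y \<subseteq> J \<Longrightarrow> vec_norm2 (b - \<Phi> *\<^sub>v x) \<le> vec_norm2 (b - \<Phi> *\<^sub>v y)"
    and y: "\<And>i. i < n \<Longrightarrow> i \<notin> J \<Longrightarrow> y i = 0"
  shows "ip m (lin n (\<lambda>l i. \<Phi> $$ (l, i)) y) (\<lambda>l. b $ l - lin n (\<lambda>l i. \<Phi> $$ (l, i)) (fn x) l) = 0"
proof (rule orthogonal_if_minimal)
  fix c
  define y' where "y' = Matrix.vec n (\<lambda>i. x $ i + c * y i)"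
  have y': "y' \<in> carrier_vec n" by (simp add: y'_def)
  have "vec_supp y' \<subseteq> J" using x y by (auto simp: vec_supp_def y'_def)
  from min[OF y' this] have le: "vec_norm2 (b - \<Phi> *\<^sub>v x) \<le> vec_norm2 (b - \<Phi> *\<^sub>v y')" .
  have carr: "b - \<Phi> *\<^sub>v x' \<in> carrier_vec m" for x' by (rule carrier_vecI) (use \<Phi> in auto)
  have nth: "(b - \<Phi> *\<^sub>v x') $ l = b $ l - lin n (\<lambda>l i. \<Phi> $$ (l, i)) (fn x') l"
    if "l < m" "x' \<in> carrier_vec n" for l x'
    using that \<Phi> b by (simp add: mult_mat_vec_lin[OF \<Phi>] del: index_mult_mat_vec)
  have lin_y': "lin n (\<lambda>l i. \<Phi> $$ (l, i)) (fn y') l =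
      lin n (\<lambda>l i. \<Phi> $$ (l, i)) (fn x) l + c * lin n (\<lambda>l i. \<Phi> $$ (l, i)) y l" for l
    by (simp add: lin_def y'_def algebra_simps sum.distrib sum_distrib_left)
  show "nrm {..<m} (\<lambda>l. b $ l - lin n (\<lambda>l i. \<Phi> $$ (l, i)) (fn x) l)
     \<le> nrm {..<m} (\<lambda>l. b $ l - lin n (\<lambda>l i. \<Phi> $$ (l, i)) (fn x) l - c * lin n (\<lambda>l i. \<Phi> $$ (l, i)) y l)"
  proof -
    have "vec_norm2 (b - \<Phi> *\<^sub>v x) = nrm {..<m} (\<lambda>l. b $ l - lin n (\<lambda>l i. \<Phi> $$ (l, i)) (fn x) l)"
      unfolding vec_norm2_nrm[OF carr] using nth x by (intro nrm_cong) auto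
    moreover have "vec_norm2 (b - \<Phi> *\<^sub>v y') =
        nrm {..<m} (\<lambda>l. b $ l - lin n (\<lambda>l i. \<Phi> $$ (l, i)) (fn x) l - c * lin n (\<lambda>l i. \<Phi> $$ (l, i)) y l)"
      unfolding vec_norm2_nrm[OF carr] using nth y' by (intro nrm_cong) (auto simp: lin_y')
    ultimately show ?thesis using le by simp
  qed
qed

text \<open>The inductive relation exposes only its last iterate; the error analysis needs the whole
  trajectory. \<open>J j\<close> is the support selected on the way from \<open>X j\<close> to
  \<open>X (Suc j)\<close>.\<close>

lemma HTP_sequence:
  assumes "HTP \<Phi> b s k x" "\<Phi> \<in> carrier_mat m n"
  shows "\<exists>X J. X 0 = 0\<^sub>v n \<and> X k = x \<and> (\<forall>j\<le>k. X j \<in> carrier_vec n) \<and> (\<forall>j<k.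
    top_indices n (\<lambda>i. cmod ((X j + mat_adjoint \<Phi> *\<^sub>v (b - \<Phi> *\<^sub>v X j)) $ i)) s (J j) \<and>
    is_arg_min (\<lambda>y. vec_norm2 (b - \<Phi> *\<^sub>v y)) (\<lambda>y. y \<in> carrier_vec n \<and> vec_supp y \<subseteq> J j) (X (Suc j)))"
  using assms(1)
proof induction
  case HTP_0
  thus ?case using assms(2) by (intro exI[of _ "\<lambda>_. 0\<^sub>v n"]) auto
next
  case (HTP_Suc k x J' x')
  then obtain X J where XJ: "X 0 = 0\<^sub>v n" "X k = x" "\<And>j. j \<le> k \<Longrightarrow> X j \<in> carrier_vec n"
    "\<And>j. j < k \<Longrightarrow> top_indices n (\<lambda>i. cmod ((X j + mat_adjoint \<Phi> *\<^sub>v (b - \<Phi> *\<^sub>v X j)) $ i)) s (J j)"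
    "\<And>j. j < k \<Longrightarrow> is_arg_min (\<lambda>y. vec_norm2 (b - \<Phi> *\<^sub>v y)) (\<lambda>y. y \<in> carrier_vec n \<and> vec_supp y \<subseteq> J j) (X (Suc j))"
    by blast
  have dim: "dim_col \<Phi> = n" using assms(2) by auto
  show ?case
    using XJ HTP_Suc.hyps(2,3)
    by (intro exI[of _ "X(Suc k := x')"] exI[of _ "J(k := J')"])
       (auto simp: less_Suc_eq le_Suc_eq dim is_arg_min_linorder)
qed

context sparse_recovery
begin

lemma half_step_error:
  assumes \<Phi>: "\<Phi> \<in> carrier_mat m n" "\<And>l i. l < m \<Longrightarrow> i < n \<Longrightarrow> \<Phi> $$ (l, i) = P l i"
    and b': "b' \<in> carrier_vec m" "\<And>l. l < m \<Longrightarrow> b' $ l = b l"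
    and s: "s \<le> n" "5 * s \<le> N s" and run: "SPF_half_step N \<Phi> b' s x"
  shows "x \<in> carrier_vec n \<and> sparse n s (fn x) \<and> dst (fn x) \<le> 34 * \<eta>"
proof -
  have lin_eq: "lin n (\<lambda>l i. \<Phi> $$ (l, i)) y l = lin n P y l" if "l < m" for y l
    using that \<Phi> by (simp add: lin_def)
  have residual: "ip m (lin n (\<lambda>l i. \<Phi> $$ (l, i)) y) (\<lambda>l. b' $ l - lin n (\<lambda>l i. \<Phi> $$ (l, i)) z l) =
    ip m (lin n P y) (\<lambda>l. b l - lin n P z l)" for y z
    using b' by (intro ip_cong) (auto simp: lin_eq)
  have dim: "dim_col \<Phi> = n" using \<Phi> by auto
  show ?thesis
  proof (cases "s < n")
    case False
    hence "is_arg_min (\<lambda>y. (vec_norm2 (b' - \<Phi> *\<^sub>v y))\<^sup>2) (\<lambda>y. y \<in> carrier_vec n) x"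
      using run by (simp add: SPF_half_step_def dim)
    hence x: "x \<in> carrier_vec n"
      and min: "\<And>y. y \<in> carrier_vec n \<Longrightarrow> (vec_norm2 (b' - \<Phi> *\<^sub>v x))\<^sup>2 \<le> (vec_norm2 (b' - \<Phi> *\<^sub>v y))\<^sup>2"
      by (auto simp: is_arg_min_linorder)
    have min': "vec_norm2 (b' - \<Phi> *\<^sub>v x) \<le> vec_norm2 (b' - \<Phi> *\<^sub>v y)" if "y \<in> carrier_vec n" for y
      using min[OF that] by (rule power2_le_imp_le) (simp add: vec_norm2_def sum_nonneg)
    \<comment> \<open>At full sparsity level the least squares solution is the case
      \<open>J = {..<n}\<close> of the bound for supported least squares, with no missed
      entries.\<close>
    have "dst (fn x) \<le> 2 * nrm (S - {..<n}) xs + 2 * \<eta>"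
    proof (rule least_squares_error)
      fix y :: "nat \<Rightarrow> complex"
      show "ip m (lin n P y) (\<lambda>l. b l - lin n P (fn x) l) = 0"
        using argmin_orthogonal[OF \<Phi>(1) b'(1) x, of "{..<n}" y] min' x
        by (auto simp: residual vec_supp_def)
    qed (use False s in auto)
    also have "S - {..<n} = {}" using S_sub by auto
    finally have "dst (fn x) \<le> 34 * \<eta>" using eta by simp
    moreover have "sparse n s (fn x)" using False s by (intro sparseI[of "{..<n}"]) auto
    ultimately show ?thesis using x by simp
  next
    case True
    then obtain k where k: "N s \<le> k" "HTP \<Phi> b' s k x" using run by (auto simp: SPF_half_step_def dim)
    from HTP_sequence[OF k(2) \<Phi>(1)] obtain X J where X0: "X 0 = 0\<^sub>v n" and Xk: "X k = x"
      and Xc: "\<And>j. j \<le> k \<Longrightarrow> X j \<in> carrier_vec n"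
      and J: "\<And>j. j < k \<Longrightarrow> top_indices n (\<lambda>i. cmod ((X j + mat_adjoint \<Phi> *\<^sub>v (b' - \<Phi> *\<^sub>v X j)) $ i)) s (J j)"
      and min: "\<And>j. j < k \<Longrightarrow> is_arg_min (\<lambda>y. vec_norm2 (b' - \<Phi> *\<^sub>v y)) (\<lambda>y. y \<in> carrier_vec n \<and> vec_supp y \<subseteq> J j) (X (Suc j))"
      by blast
    have upd: "(X j + mat_adjoint \<Phi> *\<^sub>v (b' - \<Phi> *\<^sub>v X j)) $ i = upd (fn (X j)) i" if "j < k" "i < n" for j i
    proof -
      have c: "b' - \<Phi> *\<^sub>v X j \<in> carrier_vec m" by (rule carrier_vecI) (use \<Phi> in auto)
      have "(mat_adjoint \<Phi> *\<^sub>v (b' - \<Phi> *\<^sub>v X j)) $ i = (\<Sum>l<m. cnj (\<Phi> $$ (l, i)) * (b' - \<Phi> *\<^sub>v X j) $ l)"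
        by (rule adjoint_mult_vec[OF \<Phi>(1) c that(2)])
      also have "\<dots> = (\<Sum>l<m. cnj (P l i) * (b l - lin n P (fn (X j)) l))"
        using that b' \<Phi> Xc[of j]
        by (intro sum.cong) (auto simp: mult_mat_vec_lin[OF \<Phi>(1)] lin_eq simp del: index_mult_mat_vec)
      finally show ?thesis using that mat_adjoint_carrier[OF \<Phi>(1)] Xc[of j]
        by (subst index_add_vec) (auto simp: upd_def simp del: index_mult_mat_vec)
    qed
    have Xs: "X (Suc j) $ i = 0" if "j < k" "i < n" "i \<notin> J j" for j i
      using min[OF that(1)] that by (auto simp: is_arg_min_linorder vec_supp_def)
    have "dst (fn (X k)) \<le> 34 * \<eta>"
    proof (rule htp_sequence_error[where J = J])
      fix j assume j: "j < k"
      show "J j \<subseteq> {..<n}" "card (J j) = s" using J[OF j] by (auto simp: top_indices_def)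
      show "cmod (upd (fn (X j)) i') \<le> cmod (upd (fn (X j)) i)" if "i \<in> J j" "i' < n" "i' \<notin> J j" for i i'
        using J[OF j] that upd[OF j] by (auto simp: top_indices_def subset_iff)
      show "X (Suc j) $ i = 0" if "i < n" "i \<notin> J j" for i using Xs j that by simp
      show "ip m (lin n P y) (\<lambda>l. b l - lin n P (fn (X (Suc j))) l) = 0"
        if "\<And>i. i < n \<Longrightarrow> i \<notin> J j \<Longrightarrow> y i = 0" for y
        using argmin_orthogonal[OF \<Phi>(1) b'(1), of "X (Suc j)" "J j" y] min[OF j] that
        by (auto simp: residual is_arg_min_linorder)
    qed (use X0 k s in auto)
    moreover have "sparse n s (fn x)"
    proof (cases k)
      case 0
      show ?thesis unfolding Xk[symmetric] 0 X0 by (intro sparseI[of "{}"]) auto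
    next
      case (Suc j)
      thus ?thesis using J[of j] Xs[of j] Xk finite_subset[of "J j" "{..<n}"]
        by (intro sparseI[of "J j"]) (auto simp: top_indices_def)
    qed
    ultimately show ?thesis using Xc[of k] Xk by simp
  qed
qed

end

section \<open>Alternating half-steps\<close>

text \<open>The measurements of the rank-one matrix with factors \<open>x\<close> and
  \<open>y\<close>, hence linear in \<open>x\<close> and conjugate linear in
  \<open>y\<close>.\<close>

definition bil ::
  "nat \<Rightarrow> nat \<Rightarrow> (nat \<Rightarrow> complex mat) \<Rightarrow> (nat \<Rightarrow> complex) \<Rightarrow> (nat \<Rightarrow> complex) \<Rightarrow> nat \<Rightarrow> complex" where
  "bil n1 n2 M x y l = (\<Sum>i<n1. \<Sum>j<n2. cnj (M l $$ (i, j)) * x i * cnj (y j))"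

text \<open>\<open>ip n1 x x' * ip n2 y' y\<close> is the trace inner product of the two rank-one
  matrices; the order in its second factor comes from the conjugated right factors. With four
  independent arguments, orthogonality of one pair already makes the measurements nearly
  orthogonal.\<close>

definition bilinear_rip :: "real \<Rightarrow> nat \<Rightarrow> nat \<Rightarrow> nat \<Rightarrow> nat \<Rightarrow> nat \<Rightarrow> (nat \<Rightarrow> complex mat) \<Rightarrow> bool" where
  "bilinear_rip \<delta> n1 n2 m k1 k2 M \<longleftrightarrow> (\<forall>x x' y y'.
     sparse n1 k1 x \<longrightarrow> sparse n1 k1 x' \<longrightarrow> sparse n2 k2 y \<longrightarrow> sparse n2 k2 y' \<longrightarrow>
     cmod (ip m (bil n1 n2 M x y) (bil n1 n2 M x' y') - ip n1 x x' * ip n2 y' y) \<le>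
       \<delta> * nrm {..<n1} x * nrm {..<n1} x' * nrm {..<n2} y * nrm {..<n2} y')"

lemma bilinear_ripD:
  assumes "bilinear_rip \<delta> n1 n2 m k1 k2 M"
    "sparse n1 k1 x" "sparse n1 k1 x'" "sparse n2 k2 y" "sparse n2 k2 y'"
  shows "cmod (ip m (bil n1 n2 M x y) (bil n1 n2 M x' y') - ip n1 x x' * ip n2 y' y) \<le>
       \<delta> * nrm {..<n1} x * nrm {..<n1} x' * nrm {..<n2} y * nrm {..<n2} y'"
  using assms by (simp add: bilinear_rip_def)

lemma bil_diff_right: "bil n1 n2 M x (\<lambda>j. y j - c * y' j) l = bil n1 n2 M x y l - cnj c * bil n1 n2 M x y' l"
  by (simp add: bil_def algebra_simps sum_subtractf sum_distrib_left)

lemma bil_scale_left: "bil n1 n2 M (\<lambda>i. c * x i) y l = c * bil n1 n2 M x y l"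
  by (simp add: bil_def algebra_simps sum_distrib_left)

lemma bil_norm_le:
  assumes rip: "bilinear_rip \<delta> n1 n2 m k1 k2 M" "\<delta> \<le> 3" and sp: "sparse n1 k1 x" "sparse n2 k2 y"
  shows "nrm {..<m} (bil n1 n2 M x y) \<le> 2 * (nrm {..<n1} x * nrm {..<n2} y)"
proof -
  let ?q = "nrm {..<n1} x * nrm {..<n2} y"
  have "cmod (of_real ((nrm {..<m} (bil n1 n2 M x y))\<^sup>2) - of_real (?q\<^sup>2)) \<le> \<delta> * ?q\<^sup>2"
    using bilinear_ripD[OF rip(1) sp(1) sp(1) sp(2) sp(2)]
    by (simp add: ip_self power_mult_distrib power2_eq_square mult_ac)
  hence "\<bar>(nrm {..<m} (bil n1 n2 M x y))\<^sup>2 - ?q\<^sup>2\<bar> \<le> \<delta> * ?q\<^sup>2"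
    by (metis norm_of_real of_real_diff)
  moreover have "\<delta> * ?q\<^sup>2 \<le> 3 * ?q\<^sup>2" using rip(2) by (intro mult_right_mono) auto
  ultimately have "(nrm {..<m} (bil n1 n2 M x y))\<^sup>2 \<le> (2 * ?q)\<^sup>2" by (simp add: power_mult_distrib)
  thus ?thesis by (rule power2_le_imp_le) simp
qed

lemma bil_adjoint:
  assumes "\<And>l. l < m \<Longrightarrow> M l \<in> carrier_mat n1 n2" "l < m"
  shows "bil n2 n1 (\<lambda>l. mat_adjoint (M l)) y x l = cnj (bil n1 n2 M x y l)"
proof -
  have "bil n2 n1 (\<lambda>l. mat_adjoint (M l)) y x l = (\<Sum>j<n2. \<Sum>i<n1. M l $$ (i, j) * y j * cnj (x i))"
    using assms by (auto simp: bil_def mat_adjoint_index[OF assms(1)[OF assms(2)]] intro!: sum.cong)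
  also have "\<dots> = cnj (bil n1 n2 M x y l)"
    by (subst sum.swap) (simp add: bil_def mult_ac)
  finally show ?thesis .
qed

text \<open>Adjoint matrices exchange the left and right factors and conjugate the measurements.
  Thus the right half-step of SPF becomes a left half-step for the adjoint family, and one analysis
  covers both.\<close>

lemma bilinear_rip_adjoint:
  assumes M: "\<And>l. l < m \<Longrightarrow> M l \<in> carrier_mat n1 n2" and rip: "bilinear_rip \<delta> n1 n2 m k1 k2 M"
  shows "bilinear_rip \<delta> n2 n1 m k2 k1 (\<lambda>l. mat_adjoint (M l))"
  unfolding bilinear_rip_def
proof (intro allI impI)
  fix y y' x x'
  assume sp: "sparse n2 k2 y" "sparse n2 k2 y'" "sparse n1 k1 x" "sparse n1 k1 x'"
  let ?A = "bil n2 n1 (\<lambda>l. mat_adjoint (M l))"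
  have "ip m (?A y x) (?A y' x') = cnj (ip m (bil n1 n2 M x y) (bil n1 n2 M x' y'))"
    by (simp add: ip_def bil_adjoint[OF M])
  hence "ip m (?A y x) (?A y' x') - ip n2 y y' * ip n1 x' x =
      cnj (ip m (bil n1 n2 M x y) (bil n1 n2 M x' y') - ip n1 x x' * ip n2 y' y)"
    by (simp add: ip_cnj)
  hence "cmod (ip m (?A y x) (?A y' x') - ip n2 y y' * ip n1 x' x) =
      cmod (ip m (bil n1 n2 M x y) (bil n1 n2 M x' y') - ip n1 x x' * ip n2 y' y)"
    by (simp only: complex_mod_cnj)
  also have "\<dots> \<le> \<delta> * nrm {..<n2} y * nrm {..<n2} y' * nrm {..<n1} x * nrm {..<n1} x'"
    using bilinear_ripD[OF rip sp(3,4,1,2)] by (simp add: mult_ac)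
  finally show "cmod (ip m (?A y x) (?A y' x') - ip n2 y y' * ip n1 x' x)
    \<le> \<delta> * nrm {..<n2} y * nrm {..<n2} y' * nrm {..<n1} x * nrm {..<n1} x'" .
qed

lemma F_mat_carrier: "F_mat n1 m M y \<in> carrier_mat m n1"
  by (simp add: F_mat_def mat_of_rows_def)

lemma F_mat_index:
  assumes "M l \<in> carrier_mat n1 n2" "y \<in> carrier_vec n2" "l < m" "i < n1"
  shows "F_mat n1 m M y $$ (l, i) = cnj (\<Sum>j<n2. M l $$ (i, j) * y $ j)"
  using assms by (auto simp: F_mat_def mat_of_rows_def scalar_prod_def atLeast0LessThan)

lemma G_mat_eq_F_mat:
  assumes M: "\<And>l. l < m \<Longrightarrow> M l \<in> carrier_mat n1 n2" and x: "x \<in> carrier_vec n1"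
  shows "G_mat n2 m M x = F_mat n2 m (\<lambda>l. mat_adjoint (M l)) x"
proof (rule eq_matI)
  fix l j assume "l < dim_row (F_mat n2 m (\<lambda>l. mat_adjoint (M l)) x)" "j < dim_col (F_mat n2 m (\<lambda>l. mat_adjoint (M l)) x)"
  hence lj: "l < m" "j < n2" by (simp_all add: F_mat_def)
  have "G_mat n2 m M x $$ (l, j) = (\<Sum>i<n1. M l $$ (i, j) * cnj (x $ i))"
    using M[OF lj(1)] x lj by (auto simp: G_mat_def mat_of_rows_def scalar_prod_def atLeast0LessThan)
  also have "\<dots> = F_mat n2 m (\<lambda>l. mat_adjoint (M l)) x $$ (l, j)"
    by (subst F_mat_index[where M = "\<lambda>l. mat_adjoint (M l)", OF mat_adjoint_carrier[OF M[OF lj(1)]] x lj])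
       (auto simp: mat_adjoint_index[OF M[OF lj(1)]] lj intro!: sum.cong)
  finally show "G_mat n2 m M x $$ (l, j) = F_mat n2 m (\<lambda>l. mat_adjoint (M l)) x $$ (l, j)" .
qed (simp_all add: G_mat_def F_mat_def)

lemma sparse_mono: "sparse n s x \<Longrightarrow> s \<le> s' \<Longrightarrow> sparse n s' x"
  by (simp add: sparse_def)

lemma sparse_scale: "sparse n s x \<Longrightarrow> sparse n s (\<lambda>i. c * x i)"
  unfolding sparse_def by (rule order_trans[OF card_mono]) auto

lemma sparse_diff: "sparse n s x \<Longrightarrow> sparse n s' y \<Longrightarrow> sparse n (s + s') (\<lambda>i. x i - y i)"
proof -
  assume a: "sparse n s x" "sparse n s' y"
  have "card {i. i < n \<and> x i - y i \<noteq> 0} \<le> card ({i. i < n \<and> x i \<noteq> 0} \<union> {i. i < n \<and> y i \<noteq> 0})"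
    by (intro card_mono) auto
  also have "\<dots> \<le> s + s'" using card_Un_le[of "{i. i < n \<and> x i \<noteq> 0}" "{i. i < n \<and> y i \<noteq> 0}"] a
    by (simp add: sparse_def)
  finally show ?thesis by (simp add: sparse_def)
qed

text \<open>
  Write \<open>v = \<alpha> y + w\<close> with \<open>w\<close> orthogonal to \<open>y\<close>. Then the contribution of \<open>u w\<^sup>*\<close> to the
  measurements acts as noise that is almost orthogonal to the range of \<open>F y\<close> on sparse vectors.
\<close>

lemma half_step_bilinear:
  fixes u v z :: "nat \<Rightarrow> complex" and y b x :: "complex Matrix.vec"
  assumes M: "\<And>l. l < m \<Longrightarrow> M l \<in> carrier_mat n1 n2"
    and rip: "bilinear_rip \<delta> n1 n2 m (3 * s1) (3 * s2) M" "0 \<le> \<delta>" "\<delta> \<le> 1 / 16"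
    and y: "y \<in> carrier_vec n2" "nrm {..<n2} (fn y) = 1" "sparse n2 s2 (fn y)"
    and u: "sparse n1 s1 u" "nrm {..<n1} u = 1" and v: "sparse n2 s2 v"
    and lam: "0 < lam"
    and meas: "b \<in> carrier_vec m" "\<And>l. l < m \<Longrightarrow> b $ l = of_real lam * bil n1 n2 M u v l + z l"
    and s: "s1 \<le> n1" "5 * s1 \<le> N s1" and run: "SPF_half_step N (F_mat n1 m M y) b s1 x"
  shows "x \<in> carrier_vec n1 \<and> sparse n1 s1 (fn x) \<and>
    nrm {..<n1} (\<lambda>i. x $ i - of_real lam * cnj (ip n2 (fn y) v) * u i) \<le>
      34 * (\<delta> * lam * nrm {..<n2} (\<lambda>j. v j - ip n2 (fn y) v * y $ j) + 2 * nrm {..<m} z)"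
proof -
  define \<alpha> where "\<alpha> = ip n2 (fn y) v"
  define w where "w = (\<lambda>j. v j - \<alpha> * y $ j)"
  define P where "P = (\<lambda>l i. cnj (\<Sum>j<n2. M l $$ (i, j) * y $ j))"
  define e where "e = (\<lambda>l. of_real lam * bil n1 n2 M u w l + z l)"
  define \<eta> where "\<eta> = \<delta> * lam * nrm {..<n2} w + 2 * nrm {..<m} z"
  have linP: "lin n1 P x' = bil n1 n2 M x' (fn y)" for x'
    by (auto simp: lin_def P_def bil_def sum_distrib_left sum_distrib_right mult_ac)
  have yy: "ip n2 (fn y) (fn y) = 1" using y by (simp add: ip_self)
  have wy: "ip n2 w (fn y) = 0"
    unfolding w_def using ip_cnj[of n2 "fn y" v] by (simp add: ip_diff_left ip_scale_left yy \<alpha>_def)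
  have y3: "sparse n2 (3 * s2) (fn y)" using sparse_mono[OF y(3)] by simp
  have w3: "sparse n2 (3 * s2) w"
    using sparse_mono[OF sparse_diff[OF v sparse_scale[OF y(3)]], of "3 * s2" \<alpha>] by (simp add: w_def)
  have u3: "sparse n1 (3 * s1) u" using sparse_mono[OF u(1)] by simp
  interpret sparse_recovery n1 m s1 P \<delta> \<eta> "\<lambda>i. of_real lam * cnj \<alpha> * u i" "fn b" e
  proof
    fix a c assume a: "sparse n1 (3 * s1) a" and c: "sparse n1 (3 * s1) c"
    show "cmod (ip m (lin n1 P a) (lin n1 P c) - ip n1 a c) \<le> \<delta> * nrm {..<n1} a * nrm {..<n1} c"
      using bilinear_ripD[OF rip(1) a c y3 y3] by (simp add: linP yy y(2))
  next
    fix a assume a: "sparse n1 (3 * s1) a"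
    let ?Fa = "bil n1 n2 M a (fn y)"
    have "ip m (lin n1 P a) e = of_real lam * ip m ?Fa (bil n1 n2 M u w) + ip m ?Fa z"
      by (simp add: e_def linP ip_add_right ip_scale_right)
    hence "cmod (ip m (lin n1 P a) e) \<le> lam * cmod (ip m ?Fa (bil n1 n2 M u w)) + cmod (ip m ?Fa z)"
      using lam by (simp add: norm_triangle_le norm_mult)
    \<comment> \<open>The main term \<open>ip n1 a u * ip n2 w (fn y)\<close> vanishes by
      \<open>wy\<close>, so only the deviation of size \<delta> remains.\<close>
    also have "cmod (ip m ?Fa (bil n1 n2 M u w)) \<le> \<delta> * nrm {..<n1} a * nrm {..<n2} w"
      using bilinear_ripD[OF rip(1) a u3 y3 w3] by (simp add: wy y(2) u(2))
    also have "cmod (ip m ?Fa z) \<le> (2 * nrm {..<n1} a) * nrm {..<m} z"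
      using bil_norm_le[OF rip(1) _ a y3] rip(3) y(2)
      by (intro order_trans[OF cauchy_schwarz] mult_right_mono) auto
    finally show "cmod (ip m (lin n1 P a) e) \<le> \<eta> * nrm {..<n1} a"
      using lam by (simp add: \<eta>_def algebra_simps)
  next
    fix l assume "l < m"
    \<comment> \<open>The component \<alpha> y of \<open>v\<close> produces the target of the
      recovery, with \<alpha> conjugated because \<open>bil\<close> is conjugate linear on the
      right.\<close>
    have "bil n1 n2 M u v l = bil n1 n2 M u w l + cnj \<alpha> * bil n1 n2 M u (fn y) l"
      by (simp add: w_def bil_diff_right)
    thus "b $ l = lin n1 P (\<lambda>i. complex_of_real lam * cnj \<alpha> * u i) l + e l"
      using meas(2)[OF \<open>l < m\<close>] by (simp add: linP e_def bil_scale_left algebra_simps)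
  qed (use rip lam u in \<open>auto simp: \<eta>_def intro!: sparse_scale\<close>)
  have "x \<in> carrier_vec n1 \<and> sparse n1 s1 (fn x) \<and> dst (fn x) \<le> 34 * \<eta>"
    using F_mat_carrier F_mat_index[OF M y(1)] meas(1) s run
    by (intro half_step_error[where \<Phi> = "F_mat n1 m M y" and N = N and b' = b]) (auto simp: P_def)
  thus ?thesis unfolding dst_def unfolding \<eta>_def w_def \<alpha>_def .
qed

section \<open>Misalignment of unit vectors under half-steps\<close>

lemma projection_minimal:
  assumes "nrm {..<n} y = 1"
  shows "nrm {..<n} (\<lambda>i. u i - ip n y u * y i) \<le> nrm {..<n} (\<lambda>i. u i - c * y i)"
    and "(nrm {..<n} (\<lambda>i. u i - ip n y u * y i))\<^sup>2 = (nrm {..<n} u)\<^sup>2 - (cmod (ip n y u))\<^sup>2"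
proof -
  define f where "f = (\<lambda>c. (nrm {..<n} (\<lambda>i. u i - c * y i))\<^sup>2)"
  define \<alpha> where "\<alpha> = ip n y u"
  have yu: "ip n u y = cnj \<alpha>" by (simp add: \<alpha>_def ip_cnj)
  \<comment> \<open>Completing the square in the coefficient \<open>c\<close> yields both claims:
    \<open>f c\<close> exceeds its minimum by |c - \<alpha>|^2.\<close>
  have "of_real (f c) = of_real ((nrm {..<n} u)\<^sup>2) - c * cnj \<alpha> - (cnj c * \<alpha> - cnj c * c)" for c
    unfolding f_def ip_self[symmetric] ip_diff_left ip_diff_right ip_scale_left ip_scale_right yu
    using assms ip_self[of n y] by (simp add: \<alpha>_def algebra_simps)
  also have "\<dots> c = of_real ((nrm {..<n} u)\<^sup>2 - (cmod \<alpha>)\<^sup>2 + (cmod (c - \<alpha>))\<^sup>2)" for c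
    unfolding of_real_diff of_real_add complex_norm_square by (simp add: algebra_simps)
  finally have f: "f c = (nrm {..<n} u)\<^sup>2 - (cmod \<alpha>)\<^sup>2 + (cmod (c - \<alpha>))\<^sup>2" for c
    by (simp only: of_real_eq_iff)
  show "(nrm {..<n} (\<lambda>i. u i - ip n y u * y i))\<^sup>2 = (nrm {..<n} u)\<^sup>2 - (cmod (ip n y u))\<^sup>2"
    using f[of \<alpha>] by (simp add: f_def \<alpha>_def)
  have "f \<alpha> \<le> f c" by (simp add: f)
  thus "nrm {..<n} (\<lambda>i. u i - ip n y u * y i) \<le> nrm {..<n} (\<lambda>i. u i - c * y i)"
    unfolding f_def \<alpha>_def by (rule power2_le_imp_le) simp
qed

text \<open>The distance of \<open>u\<close> from the line of the normalized vector is a minimum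
  over coefficients, so any coefficient bounds it. The choice \<open>of_real r / \<beta>\<close>
  undoes the normalization and leaves the error of \<open>x\<close> divided by
  \<open>cmod \<beta>\<close>.\<close>

lemma normalize_vec_near:
  assumes x: "x \<in> carrier_vec n" and near: "nrm {..<n} (\<lambda>i. x $ i - \<beta> * u i) \<le> \<epsilon>" "\<epsilon> < cmod \<beta>"
    and u: "nrm {..<n} u = 1"
  defines "x' \<equiv> normalize_vec x"
  shows "x' \<in> carrier_vec n" "nrm {..<n} (fn x') = 1"
    "nrm {..<n} (\<lambda>i. u i - ip n (fn x') u * x' $ i) \<le> \<epsilon> / cmod \<beta>"
    "sparse n s (fn x) \<Longrightarrow> sparse n s (fn x')"
proof -
  define r where "r = nrm {..<n} (fn x)"
  have x'i: "x' $ i = of_real (1 / r) * x $ i" if "i < n" for i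
    using that x by (simp add: x'_def normalize_vec_def vec_norm2_nrm[OF x] r_def)
  have "cmod \<beta> = nrm {..<n} (\<lambda>i. \<beta> * u i)" by (simp add: nrm_scale u)
  also have "\<dots> \<le> nrm {..<n} (\<lambda>i. \<beta> * u i - x $ i) + r"
    using nrm_add[of "{..<n}" "\<lambda>i. \<beta> * u i - x $ i" "fn x"] by (simp add: r_def)
  finally have "cmod \<beta> \<le> \<epsilon> + r" using near(1) by (simp add: nrm_minus_commute[of _ "\<lambda>i. \<beta> * u i"])
  hence r: "r > 0" using near by simp
  show "x' \<in> carrier_vec n" using x by (simp add: x'_def normalize_vec_def)
  have "nrm {..<n} (fn x') = nrm {..<n} (\<lambda>i. of_real (1 / r) * x $ i)" by (rule nrm_cong) (simp add: x'i)
  also have "\<dots> = 1" unfolding nrm_scale using r by (simp add: r_def[symmetric] norm_divide)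
  finally show one: "nrm {..<n} (fn x') = 1" .
  have \<beta>: "\<beta> \<noteq> 0" using near order_trans[OF nrm_nonneg near(1)] by auto
  have "nrm {..<n} (\<lambda>i. u i - ip n (fn x') u * x' $ i) \<le> nrm {..<n} (\<lambda>i. u i - of_real r / \<beta> * x' $ i)"
    by (rule projection_minimal(1)[OF one])
  also have "\<dots> = nrm {..<n} (\<lambda>i. (- 1 / \<beta>) * (x $ i - \<beta> * u i))"
    using r \<beta> by (intro nrm_cong) (auto simp: x'i field_simps)
  also have "\<dots> \<le> \<epsilon> / cmod \<beta>" unfolding nrm_scale using near(1) by (simp add: norm_divide divide_right_mono)
  finally show "nrm {..<n} (\<lambda>i. u i - ip n (fn x') u * x' $ i) \<le> \<epsilon> / cmod \<beta>" .
  show "sparse n s (fn x')" if "sparse n s (fn x)"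
    using that unfolding sparse_def by (elim order_trans[rotated], intro card_mono) (auto simp: x'i)
qed

lemma normalize_vec_unit: "vec_norm2 x = 1 \<Longrightarrow> normalize_vec x = x"
  by (simp add: normalize_vec_def)

text \<open>For unit vectors this is the sine of the angle between the complex lines they span. It
  ignores phases, which the factors of a rank-one matrix leave undetermined.\<close>

abbreviation misalignment :: "nat \<Rightarrow> (nat \<Rightarrow> complex) \<Rightarrow> (nat \<Rightarrow> complex) \<Rightarrow> real" where
  "misalignment n y v \<equiv> nrm {..<n} (\<lambda>j. v j - ip n y v * y j)"

text \<open>Alignment at least 1/2 gives \<open>lam / 2 \<le> cmod \<beta>\<close>, so normalizing
  at most doubles the relative error: 34 \<delta> becomes 68/1000 <= 1/4, and 68 \<nu> becomes 136
  \<nu>. The new misalignment is then at most 1/2, so the new alignment is again at least 1/2 and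
  the step can be repeated.\<close>

lemma half_step_contraction:
  fixes u v z :: "nat \<Rightarrow> complex" and y b x :: "complex Matrix.vec"
  assumes M: "\<And>l. l < m \<Longrightarrow> M l \<in> carrier_mat n1 n2"
    and rip: "bilinear_rip \<delta> n1 n2 m (3 * s1) (3 * s2) M" "0 \<le> \<delta>" "\<delta> \<le> 1 / 1000"
    and y: "y \<in> carrier_vec n2" "nrm {..<n2} (fn y) = 1" "sparse n2 s2 (fn y)"
    and u: "sparse n1 s1 u" "nrm {..<n1} u = 1" and v: "sparse n2 s2 v" "nrm {..<n2} v = 1"
    and lam: "0 < lam" and z: "nrm {..<m} z \<le> lam * \<nu>" "\<nu> \<le> 1 / 1000"
    and meas: "b \<in> carrier_vec m" "\<And>l. l < m \<Longrightarrow> b $ l = of_real lam * bil n1 n2 M u v l + z l"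
    and s: "s1 \<le> n1" "5 * s1 \<le> N s1" and run: "SPF_half_step N (F_mat n1 m M y) b s1 x"
    and align: "1 / 2 \<le> cmod (ip n2 (fn y) v)"
  defines "x' \<equiv> normalize_vec x"
  shows "x \<in> carrier_vec n1" "x' \<in> carrier_vec n1" "nrm {..<n1} (fn x') = 1" "sparse n1 s1 (fn x')"
    "nrm {..<n1} (\<lambda>i. x $ i - of_real lam * cnj (ip n2 (fn y) v) * u i) \<le> lam * (misalignment n2 (fn y) v / 8 + 68 * \<nu>)"
    "misalignment n1 (fn x') u \<le> misalignment n2 (fn y) v / 4 + 136 * \<nu>"
    "1 / 2 \<le> cmod (ip n1 (fn x') u)"
proof -
  define \<alpha> where "\<alpha> = ip n2 (fn y) v"
  define \<kappa> where "\<kappa> = misalignment n2 (fn y) v"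
  have \<nu>0: "0 \<le> \<nu>" using z lam order_trans[OF nrm_nonneg z(1)] by (simp add: zero_le_mult_iff)
  have \<kappa>0: "0 \<le> \<kappa>" by (simp add: \<kappa>_def)
  have "\<kappa>\<^sup>2 = 1 - (cmod \<alpha>)\<^sup>2"
    using projection_minimal(2)[OF y(2), of v] v by (simp add: \<kappa>_def \<alpha>_def)
  hence "\<kappa>\<^sup>2 \<le> 1\<^sup>2" by simp
  hence \<kappa>1: "\<kappa> \<le> 1" by (rule power2_le_imp_le) simp
  define \<epsilon> where "\<epsilon> = 34 * (\<delta> * lam * \<kappa> + 2 * nrm {..<m} z)"
  have step: "x \<in> carrier_vec n1" "sparse n1 s1 (fn x)"
    "nrm {..<n1} (\<lambda>i. x $ i - of_real lam * cnj \<alpha> * u i) \<le> \<epsilon>"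
    using half_step_bilinear[where N = N and u = u and v = v and z = z and lam = lam and b = b and x = x,
        OF M rip(1,2) _ y u v(1) lam meas s run] rip(3)
    by (auto simp: \<alpha>_def \<kappa>_def \<epsilon>_def)
  have "\<delta> * (lam * \<kappa>) \<le> 1 / 1000 * (lam * \<kappa>)" using rip lam \<kappa>0 by (intro mult_right_mono) auto
  hence \<epsilon>: "\<epsilon> \<le> lam * (34 / 1000 * \<kappa> + 68 * \<nu>)" using z by (simp add: \<epsilon>_def algebra_simps)
  show "x \<in> carrier_vec n1" by (rule step)
  have "\<epsilon> \<le> lam * (\<kappa> / 8 + 68 * \<nu>)" using lam \<kappa>0 by (intro order_trans[OF \<epsilon>] mult_left_mono) auto
  thus "nrm {..<n1} (\<lambda>i. x $ i - of_real lam * cnj (ip n2 (fn y) v) * u i) \<le> lam * (misalignment n2 (fn y) v / 8 + 68 * \<nu>)"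
    using step(3) by (simp add: \<alpha>_def \<kappa>_def)
  define \<beta> where "\<beta> = of_real lam * cnj \<alpha>"
  have \<beta>: "lam / 2 \<le> cmod \<beta>" using align lam by (simp add: \<beta>_def \<alpha>_def norm_mult)
  have "34 / 1000 * \<kappa> + 68 * \<nu> < 1 / 2" using \<kappa>1 z by simp
  hence "lam * (34 / 1000 * \<kappa> + 68 * \<nu>) < lam * (1 / 2)" using lam by (rule mult_strict_left_mono)
  hence \<epsilon>\<beta>: "\<epsilon> < cmod \<beta>" using \<epsilon> \<beta> by simp
  have near: "nrm {..<n1} (\<lambda>i. x $ i - \<beta> * u i) \<le> \<epsilon>" using step(3) by (simp add: \<beta>_def)
  note norm = normalize_vec_near[OF step(1) near \<epsilon>\<beta> u(2), folded x'_def]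
  show "x' \<in> carrier_vec n1" "nrm {..<n1} (fn x') = 1" "sparse n1 s1 (fn x')"
    using norm step(2) by auto
  have "\<epsilon> / cmod \<beta> \<le> lam * (34 / 1000 * \<kappa> + 68 * \<nu>) / (lam / 2)"
    using \<epsilon> \<beta> lam \<kappa>0 \<nu>0 by (intro frac_le) auto
  also have "\<dots> = 68 / 1000 * \<kappa> + 136 * \<nu>" using lam by (simp add: field_simps)
  finally have mis: "misalignment n1 (fn x') u \<le> 68 / 1000 * \<kappa> + 136 * \<nu>" using norm(3) by simp
  thus "misalignment n1 (fn x') u \<le> misalignment n2 (fn y) v / 4 + 136 * \<nu>" using \<kappa>0 unfolding \<kappa>_def[symmetric] by linarith
  have "misalignment n1 (fn x') u \<le> 1 / 2" using mis \<kappa>1 z by simp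
  hence "(misalignment n1 (fn x') u)\<^sup>2 \<le> (1 / 2)\<^sup>2" by (intro power_mono) auto
  hence "(1 / 2)\<^sup>2 \<le> (cmod (ip n1 (fn x') u))\<^sup>2"
    using projection_minimal(2)[OF norm(2), of u] u by (simp add: power_divide)
  thus "1 / 2 \<le> cmod (ip n1 (fn x') u)" by (rule power2_le_imp_le) simp
qed

lemma frob_norm_nrm: "A \<in> carrier_mat n1 n2 \<Longrightarrow> frob_norm A = nrm ({..<n1} \<times> {..<n2}) (\<lambda>ij. A $$ ij)"
  by (auto simp: frob_norm_def nrm_def L2_set_def sum.cartesian_product intro!: sum.cong)

lemma nrm_outer: "nrm (I \<times> K) (\<lambda>(i, j). x i * cnj (y j)) = nrm I x * nrm K y"
  unfolding nrm_def L2_set_def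
  by (simp add: split_beta norm_mult power_mult_distrib real_sqrt_mult[symmetric]
      sum_product sum.cartesian_product)

text \<open>With \<open>\<alpha> = ip n1 (fn u') (fn u)\<close>, the error is the outer product of
  \<open>u'\<close> and v' - lam conj(\<alpha>) v, minus lam times the outer product of u - \<alpha>
  u' and \<open>v\<close>. Both have a unit factor.\<close>

lemma outer_prod_error:
  assumes u: "nrm {..<n1} (fn u') = 1" "u \<in> carrier_vec n1" "u' \<in> carrier_vec n1"
    and v: "nrm {..<n2} (fn v) = 1" "v \<in> carrier_vec n2" "v' \<in> carrier_vec n2"
    and lam: "0 < lam"
  shows "frob_norm (outer_prod u' v' - of_real lam \<cdot>\<^sub>m outer_prod u v) \<le>
    nrm {..<n2} (\<lambda>j. v' $ j - of_real lam * cnj (ip n1 (fn u') (fn u)) * v $ j) + lam * misalignment n1 (fn u') (fn u)"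
proof -
  define \<alpha> where "\<alpha> = ip n1 (fn u') (fn u)"
  have "frob_norm (outer_prod u' v' - of_real lam \<cdot>\<^sub>m outer_prod u v) =
    nrm ({..<n1} \<times> {..<n2}) (\<lambda>ij. (outer_prod u' v' - of_real lam \<cdot>\<^sub>m outer_prod u v) $$ ij)"
    using u v by (intro frob_norm_nrm) (auto simp: outer_prod_def)
  also have "\<dots> = nrm ({..<n1} \<times> {..<n2}) (\<lambda>ij.
      (case ij of (i, j) \<Rightarrow> u' $ i * cnj (v' $ j - of_real lam * cnj \<alpha> * v $ j)) -
      of_real lam * (case ij of (i, j) \<Rightarrow> (u $ i - \<alpha> * u' $ i) * cnj (v $ j)))"
    using u v by (intro nrm_cong) (auto simp: outer_prod_def algebra_simps)
  also have "\<dots> \<le> nrm {..<n2} (\<lambda>j. v' $ j - of_real lam * cnj \<alpha> * v $ j) + lam * misalignment n1 (fn u') (fn u)"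
    by (rule order_trans[OF nrm_diff], unfold nrm_scale nrm_outer) (use u v lam in \<open>simp add: \<alpha>_def\<close>)
  finally show ?thesis by (simp add: \<alpha>_def)
qed

text \<open>An iteration applies \<kappa> -> \<kappa> / 4 + 136 \<nu> twice to the misalignment, and
  the floor 240 \<nu> survives this. The error of \<open>X t\<close> combines the error of the right
  factor before its normalization with the misalignment of the left factor.\<close>

theorem SPF_error_bound:
  assumes M: "\<And>l. l < m \<Longrightarrow> M l \<in> carrier_mat n1 n2"
    and rip: "bilinear_rip \<delta> n1 n2 m (3 * s1) (3 * s2) M" "0 \<le> \<delta>" "\<delta> \<le> 1 / 1000"
    and u: "u \<in> carrier_vec n1" "sparse n1 s1 (fn u)" "nrm {..<n1} (fn u) = 1"
    and v: "v \<in> carrier_vec n2" "sparse n2 s2 (fn v)" "nrm {..<n2} (fn v) = 1"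
    and lam: "0 < lam" and z: "nrm {..<m} z \<le> lam * \<nu>" "\<nu> \<le> 1 / 1000"
    and meas: "b \<in> carrier_vec m" "\<And>l. l < m \<Longrightarrow> b $ l = of_real lam * bil n1 n2 M (fn u) (fn v) l + z l"
    and s: "s1 \<le> n1" "5 * s1 \<le> N s1" "s2 \<le> n2" "5 * s2 \<le> N s2"
    and v0: "v0 \<in> carrier_vec n2" "nrm {..<n2} (fn v0) = 1" "sparse n2 s2 (fn v0)"
      "1 / 2 \<le> cmod (ip n2 (fn v0) (fn v))"
    and run: "SPF_run N n1 n2 m M b s1 s2 v0 X" and t: "1 \<le> t"
  shows "X t \<in> carrier_mat n1 n2"
    "frob_norm (X t - of_real lam \<cdot>\<^sub>m outer_prod u v) \<le> lam * (2 * (1 / 4) ^ t + 460 * \<nu>)"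
proof -
  from run obtain U V where V0: "V 0 = v0"
    and U: "\<And>t. t \<ge> 1 \<Longrightarrow> \<exists>u'. SPF_half_step N (F_mat n1 m M (normalize_vec (V (t - 1)))) b s1 u' \<and> U t = normalize_vec u'"
    and V: "\<And>t. t \<ge> 1 \<Longrightarrow> SPF_half_step N (G_mat n2 m M (U t)) (conjugate b) s2 (V t)"
    and X: "\<And>t. t \<ge> 1 \<Longrightarrow> X t = outer_prod (U t) (V t)"
    unfolding SPF_run_def by blast
  have \<nu>0: "0 \<le> \<nu>" using z lam order_trans[OF nrm_nonneg z(1)] by (simp add: zero_le_mult_iff)
  let ?M' = "\<lambda>l. mat_adjoint (M l)"
  \<comment> \<open>The invariant of the normalized right factor; the alignment bound in it is what
    makes the next half-step contract.\<close>
  define good where "good y \<longleftrightarrow> y \<in> carrier_vec n2 \<and> nrm {..<n2} (fn y) = 1 \<and> sparse n2 s2 (fn y) \<and>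
    1 / 2 \<le> cmod (ip n2 (fn y) (fn v))" for y
  have step: "U t \<in> carrier_vec n1 \<and> nrm {..<n1} (fn (U t)) = 1 \<and> V t \<in> carrier_vec n2 \<and>
      misalignment n1 (fn (U t)) (fn u) \<le> misalignment n2 (fn y) (fn v) / 4 + 136 * \<nu> \<and>
      nrm {..<n2} (\<lambda>j. V t $ j - of_real lam * cnj (ip n1 (fn (U t)) (fn u)) * v $ j) \<le>
        lam * (misalignment n1 (fn (U t)) (fn u) / 8 + 68 * \<nu>) \<and>
      good (normalize_vec (V t)) \<and>
      misalignment n2 (fn (normalize_vec (V t))) (fn v) \<le> misalignment n1 (fn (U t)) (fn u) / 4 + 136 * \<nu>"
    if t: "t \<ge> 1" and y: "y = normalize_vec (V (t - 1))" "good y" for t y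
  proof -
    obtain u' where u': "SPF_half_step N (F_mat n1 m M y) b s1 u'" "U t = normalize_vec u'"
      using U[OF t] y by blast
    have A: "U t \<in> carrier_vec n1" "nrm {..<n1} (fn (U t)) = 1" "sparse n1 s1 (fn (U t))"
      "misalignment n1 (fn (U t)) (fn u) \<le> misalignment n2 (fn y) (fn v) / 4 + 136 * \<nu>"
      "1 / 2 \<le> cmod (ip n1 (fn (U t)) (fn u))"
      using half_step_contraction(2,3,4,6,7)[where N = N and u = "fn u" and v = "fn v" and z = z and lam = lam and b = b and x = u' and y = y,
          OF M rip _ _ _ u(2,3) v(2,3) lam z meas s(1,2) u'(1)] y(2)
      unfolding u'(2) good_def by blast+
    \<comment> \<open>The second half-step is the same contraction for the adjoint family with
      conjugated data and noise, the roles of \<open>u\<close> and \<open>v\<close> being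
      exchanged.\<close>
    have M': "\<And>l. l < m \<Longrightarrow> ?M' l \<in> carrier_mat n2 n1" using M mat_adjoint_carrier by blast
    have z': "nrm {..<m} (\<lambda>l. cnj (z l)) \<le> lam * \<nu>" using z by (simp add: nrm_def)
    have meas': "conjugate b \<in> carrier_vec m"
      "conjugate b $ l = of_real lam * bil n2 n1 ?M' (fn v) (fn u) l + cnj (z l)" if "l < m" for l
      using meas that by (auto simp: bil_adjoint[OF M])
    have meas'': "conjugate b \<in> carrier_vec m" using meas(1) by simp
    have V': "SPF_half_step N (F_mat n2 m ?M' (U t)) (conjugate b) s2 (V t)"
      using V[OF t] G_mat_eq_F_mat[of m M, OF M A(1)] by simp
    note B = half_step_contraction[where N = N and u = "fn v" and v = "fn u" and z = "\<lambda>l. cnj (z l)" and lam = lam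
        and b = "conjugate b" and x = "V t" and y = "U t",
        OF M' bilinear_rip_adjoint[OF M rip(1)] rip(2,3) A(1,2,3) v(2,3) u(2,3) lam z' z(2) meas'' meas'(2) s(3,4) V' A(5)]
    show ?thesis using A B unfolding good_def by blast
  qed
  have iter: "good (normalize_vec (V t)) \<and> misalignment n2 (fn (normalize_vec (V t))) (fn v) \<le> (1 / 4) ^ t + 240 * \<nu>" for t
  proof (induction t)
    case 0
    have "vec_norm2 v0 = 1" using v0 by (simp add: vec_norm2_nrm)
    hence eq: "normalize_vec (V 0) = v0" by (simp add: V0 normalize_vec_unit)
    have "(misalignment n2 (fn v0) (fn v))\<^sup>2 \<le> 1\<^sup>2"
      using projection_minimal(2)[OF v0(2), of "fn v"] v by simp
    hence "misalignment n2 (fn v0) (fn v) \<le> 1" by (rule power2_le_imp_le) simp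
    thus ?case using v0 \<nu>0 by (simp add: eq good_def)
  next
    case (Suc t)
    have "misalignment n1 (fn (U (Suc t))) (fn u) \<le> misalignment n2 (fn (normalize_vec (V t))) (fn v) / 4 + 136 * \<nu>"
      "misalignment n2 (fn (normalize_vec (V (Suc t)))) (fn v) \<le> misalignment n1 (fn (U (Suc t))) (fn u) / 4 + 136 * \<nu>"
      "good (normalize_vec (V (Suc t)))"
      using step[of "Suc t" "normalize_vec (V t)"] Suc by auto
    moreover have "0 \<le> (1 / 4 :: real) ^ t" by simp
    ultimately show ?case using conjunct2[OF Suc] \<nu>0 unfolding power_Suc by (intro conjI) linarith+
  qed
  define \<kappa> where "\<kappa> = misalignment n1 (fn (U t)) (fn u)"
  note S = step[OF t refl, folded \<kappa>_def]
  have good: "good (normalize_vec (V (t - 1)))" using iter by blast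
  define \<kappa>' where "\<kappa>' = misalignment n2 (fn (normalize_vec (V (t - 1)))) (fn v)"
  have "\<kappa> \<le> \<kappa>' / 4 + 136 * \<nu>" using S[OF good] unfolding \<kappa>'_def by blast
  moreover have "\<kappa>' \<le> (1 / 4) ^ (t - 1) + 240 * \<nu>" using iter[of "t - 1"] unfolding \<kappa>'_def by blast
  ultimately have "\<kappa> \<le> ((1 / 4) ^ (t - 1) + 240 * \<nu>) / 4 + 136 * \<nu>" by argo
  also have "\<dots> = (1 / 4) ^ t + 196 * \<nu>" using t by (cases t) auto
  finally have \<kappa>: "\<kappa> \<le> (1 / 4) ^ t + 196 * \<nu>" .
  show "X t \<in> carrier_mat n1 n2" using X[OF t] S[OF good] by (auto simp: outer_prod_def)
  have "frob_norm (X t - of_real lam \<cdot>\<^sub>m outer_prod u v) \<le> lam * (\<kappa> / 8 + 68 * \<nu>) + lam * \<kappa>"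
    using outer_prod_error[of n1 "U t" u n2 v "V t" lam] S[OF good] u v lam X[OF t] unfolding \<kappa>_def by force
  also have "\<dots> = lam * (\<kappa> * (9 / 8) + 68 * \<nu>)" by (simp add: algebra_simps)
  also have "\<dots> \<le> lam * (2 * (1 / 4) ^ t + 460 * \<nu>)"
  proof -
    have "0 \<le> (1 / 4 :: real) ^ t" by simp
    thus ?thesis using \<kappa> \<nu>0 lam by (intro mult_left_mono) linarith+
  qed
  finally show "frob_norm (X t - of_real lam \<cdot>\<^sub>m outer_prod u v) \<le> lam * (2 * (1 / 4) ^ t + 460 * \<nu>)" .
qed

section \<open>Initialization by thresholding\<close>

text \<open>Prescribing zeros from \<open>n\<close> on makes the sphere a closed subset of a product
  of compact sets. It is the domain on which a matrix norm is maximized.\<close>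

lemma compact_unit_sphere_fn: "compact {f :: nat \<Rightarrow> complex. nrm {..<n} f = 1 \<and> (\<forall>i\<ge>n. f i = 0)}"
proof -
  let ?B = "\<lambda>i. if i < n then cball 0 1 else {0 :: complex}"
  have "compactin (product_topology (\<lambda>_. euclidean) UNIV) (PiE UNIV ?B)"
    by (subst compactin_PiE) auto
  hence c: "compact (PiE UNIV ?B)" by (simp add: euclidean_product_topology)
  have cont: "continuous_on UNIV (\<lambda>f :: nat \<Rightarrow> complex. \<Sum>i<n. (cmod (f i))\<^sup>2)"
    by (intro continuous_intros continuous_on_product_coordinates)
  have cl: "closed ((\<lambda>f :: nat \<Rightarrow> complex. \<Sum>i<n. (cmod (f i))\<^sup>2) -` {1})"
    using continuous_closed_vimage[OF closed_singleton, of "\<lambda>f :: nat \<Rightarrow> complex. \<Sum>i<n. (cmod (f i))\<^sup>2" 1] cont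
    by (auto simp: continuous_on_eq_continuous_within)
  have "{f :: nat \<Rightarrow> complex. nrm {..<n} f = 1 \<and> (\<forall>i\<ge>n. f i = 0)} =
      PiE UNIV ?B \<inter> (\<lambda>f :: nat \<Rightarrow> complex. \<Sum>i<n. (cmod (f i))\<^sup>2) -` {1}" (is "?L = ?R")
  proof (intro equalityI subsetI)
    fix f assume f: "f \<in> ?L"
    have "cmod (f i) \<le> 1" if "i < n" for i using cmod_le_nrm[of "{..<n}" i f] that f by simp
    thus "f \<in> ?R" using f by (auto simp: PiE_def Pi_def nrm_sq[symmetric])
  next
    fix f assume f: "f \<in> ?R"
    have "(nrm {..<n} f)\<^sup>2 = 1" using f by (simp add: nrm_sq)
    hence "nrm {..<n} f = 1" using nrm_nonneg[of "{..<n}" f] by (simp add: power2_eq_1_iff)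
    moreover have "f i = 0" if "i \<ge> n" for i using f that by (auto simp: PiE_def Pi_def dest!: spec[of _ i])
    ultimately show "f \<in> ?L" by simp
  qed
  thus ?thesis using compact_Int_closed[OF c cl] by simp
qed

text \<open>A leading singular vector is known only by comparison with other triples, so a lower
  bound on its singular value needs an actual triple. A maximizer \<open>f\<close> of |A f| over
  unit vectors provides one; positivity of the maximum allows A f / \<sigma> as left vector.\<close>

lemma exists_singular_triple_ge:
  assumes A: "A \<in> carrier_mat r c" and w: "w \<in> carrier_vec c" "vec_norm2 w = 1" "0 < vec_norm2 (A *\<^sub>v w)"
  shows "\<exists>\<sigma> u v. singular_triple A \<sigma> u v \<and> vec_norm2 (A *\<^sub>v w) \<le> \<sigma>"
proof -
  define P where "P = (\<lambda>l i. A $$ (l, i))"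
  define K where "K = {f :: nat \<Rightarrow> complex. nrm {..<c} f = 1 \<and> (\<forall>i\<ge>c. f i = 0)}"
  define g where "g = (\<lambda>f. nrm {..<r} (lin c P f))"
  have Av: "(A *\<^sub>v x) $ l = lin c P (fn x) l" if "x \<in> carrier_vec c" "l < r" for x l
    using mult_mat_vec_lin[OF A that] by (simp add: P_def)
  have Ac: "A *\<^sub>v x \<in> carrier_vec r" for x using A by (auto intro: carrier_vecI)
  have normA: "vec_norm2 (A *\<^sub>v x) = g (fn x)" if "x \<in> carrier_vec c" for x
    unfolding vec_norm2_nrm[OF Ac] g_def by (rule nrm_cong) (use Av[OF that] in auto)
  have "(\<lambda>i. if i < c then w $ i else 0) \<in> K" (is "?w \<in> K")
    using w nrm_cong[of "{..<c}" ?w "fn w"] by (simp add: K_def vec_norm2_nrm)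
  moreover have gw: "g ?w = vec_norm2 (A *\<^sub>v w)"
    unfolding normA[OF w(1)] g_def by (rule nrm_cong) (simp add: lin_def)
  moreover have "continuous_on K g"
    unfolding g_def nrm_def L2_set_def lin_def
    by (intro continuous_intros continuous_on_subset[OF continuous_on_product_coordinates]) auto
  moreover have "compact K" unfolding K_def by (rule compact_unit_sphere_fn)
  ultimately obtain f where f: "f \<in> K" "\<And>f'. f' \<in> K \<Longrightarrow> g f' \<le> g f" "vec_norm2 (A *\<^sub>v w) \<le> g f"
    using continuous_attains_sup[of K g] by fastforce
  define \<sigma> where "\<sigma> = g f"
  have \<sigma>: "\<sigma> > 0" using f(3) w(3) by (simp add: \<sigma>_def)
  have f1: "nrm {..<c} f = 1" using f by (simp add: K_def)
  have bound: "g y \<le> \<sigma> * nrm {..<c} y" for y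
  proof (cases "nrm {..<c} y = 0")
    case True
    hence "y i = 0" if "i < c" for i using cmod_le_nrm[of "{..<c}" i y] that by simp
    hence "lin c P y l = 0" for l by (simp add: lin_def)
    thus ?thesis using True by (simp add: g_def nrm_def L2_set_def)
  next
    case False
    define t where "t = nrm {..<c} y"
    have t: "t > 0" using False nrm_nonneg[of "{..<c}" y] unfolding t_def by linarith
    define y' where "y' = (\<lambda>i. if i < c then of_real (1 / t) * y i else 0)"
    have "nrm {..<c} y' = nrm {..<c} (\<lambda>i. of_real (1 / t) * y i)" by (rule nrm_cong) (simp add: y'_def)
    also have "\<dots> = 1" unfolding nrm_scale using t by (simp add: t_def[symmetric] norm_divide)
    finally have "y' \<in> K" by (simp add: K_def y'_def)
    hence "g y' \<le> \<sigma>" using f(2) by (simp add: \<sigma>_def)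
    moreover have "lin c P y' = (\<lambda>l. of_real (1 / t) * lin c P y l)"
      by (auto simp: lin_def y'_def sum_divide_distrib)
    hence "g y' = 1 / t * g y" using t by (simp only: g_def nrm_scale) (simp add: norm_divide)
    ultimately show ?thesis using t by (simp add: t_def[symmetric] field_simps)
  qed
  have stationary: "\<sigma>\<^sup>2 * ip c y f = ip r (lin c P y) (lin c P f)" for y
  proof -
    \<comment> \<open>The form \<sigma>^2 |h|^2 - |A h|^2 is nonnegative and vanishes at
      \<open>f\<close>. \<open>Ly\<close> is its mixed value at \<open>f\<close> and
      \<open>y\<close>, and \<open>N\<close> its value at \<open>y\<close>; moving from
      \<open>f\<close> along - t conj(Ly) y shows that \<open>Ly\<close> must vanish.\<close>
    define Ly where "Ly = of_real (\<sigma>\<^sup>2) * ip c f y - ip r (lin c P f) (lin c P y)"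
    define N where "N = \<sigma>\<^sup>2 * (nrm {..<c} y)\<^sup>2 - (nrm {..<r} (lin c P y))\<^sup>2"
    have lin_cy: "lin c P (\<lambda>i. a * y i) = (\<lambda>l. a * lin c P y l)" for a
      by (auto simp: lin_def sum_distrib_left mult_ac)
    have lin_d: "lin c P (\<lambda>i. f i - a * y i) = (\<lambda>l. lin c P f l - a * lin c P y l)" for a
      by (auto simp: lin_diff lin_cy)
    have ineq: "0 \<le> - 2 * t * (cmod Ly)\<^sup>2 + t\<^sup>2 * (cmod Ly)\<^sup>2 * N" for t :: real
    proof -
      define a where "a = of_real t * cnj Ly"
      let ?h = "\<lambda>i. f i - a * y i"
      have cL: "cnj Ly = of_real (\<sigma>\<^sup>2) * ip c y f - ip r (lin c P y) (lin c P f)"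
        by (simp add: Ly_def ip_cnj)
      have sq: "complex_of_real ((cmod Ly)\<^sup>2) = Ly * cnj Ly" by (rule complex_norm_square)
      have "complex_of_real (\<sigma>\<^sup>2 * (nrm {..<c} ?h)\<^sup>2 - (nrm {..<r} (lin c P ?h))\<^sup>2) =
        of_real (\<sigma>\<^sup>2) * ip c ?h ?h - ip r (lin c P ?h) (lin c P ?h)"
        by (simp add: ip_self)
      also have "\<dots> = of_real (\<sigma>\<^sup>2) * ip c f f - ip r (lin c P f) (lin c P f) - a * Ly - cnj a * cnj Ly + a * cnj a * of_real N"
        unfolding cL lin_d ip_diff_left ip_diff_right ip_scale_left ip_scale_right
        by (simp add: Ly_def N_def ip_self algebra_simps)
      also have "of_real (\<sigma>\<^sup>2) * ip c f f - ip r (lin c P f) (lin c P f) = 0"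
        unfolding ip_self by (simp add: f1 \<sigma>_def g_def)
      also have "0 - a * Ly - cnj a * cnj Ly + a * cnj a * of_real N = of_real (- 2 * t * (cmod Ly)\<^sup>2 + t\<^sup>2 * (cmod Ly)\<^sup>2 * N)"
        unfolding of_real_add of_real_mult of_real_minus of_real_power[of t] sq
        by (simp add: a_def algebra_simps power2_eq_square)
      finally have "\<sigma>\<^sup>2 * (nrm {..<c} ?h)\<^sup>2 - (nrm {..<r} (lin c P ?h))\<^sup>2 = - 2 * t * (cmod Ly)\<^sup>2 + t\<^sup>2 * (cmod Ly)\<^sup>2 * N"
        by (simp only: of_real_eq_iff)
      moreover have "(nrm {..<r} (lin c P ?h))\<^sup>2 \<le> (\<sigma> * nrm {..<c} ?h)\<^sup>2"
        using bound[of ?h] unfolding g_def by (intro power_mono) auto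
      ultimately show ?thesis by (simp add: power_mult_distrib)
    qed
    \<comment> \<open>Small enough for the linear term to win: \<open>t * N - 2\<close> is
      negative.\<close>
    define t where "t = 1 / (1 + \<bar>N\<bar>)"
    have t: "t > 0" "t * N \<le> 1" unfolding t_def by (auto simp: field_simps)
    have "0 \<le> t * (cmod Ly)\<^sup>2 * (t * N - 2)" using ineq[of t] by (simp add: algebra_simps power2_eq_square)
    hence "(cmod Ly)\<^sup>2 \<le> 0" using t by (simp add: zero_le_mult_iff mult_le_0_iff)
    hence "Ly = 0" by simp
    hence "cnj Ly = 0" by simp
    thus ?thesis by (simp add: Ly_def ip_cnj)
  qed
  define v where "v = Matrix.vec c f"
  define u where "u = Matrix.vec r (\<lambda>l. of_real (1 / \<sigma>) * lin c P f l)"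
  have vf: "lin c P (fn v) l = lin c P f l" for l by (simp add: lin_def v_def)
  have vc: "v \<in> carrier_vec c" "u \<in> carrier_vec r" by (auto simp: v_def u_def)
  have "singular_triple A \<sigma> u v"
    unfolding singular_triple_def
  proof (intro conjI)
    show "vec_norm2 v = 1"
      unfolding vec_norm2_nrm[OF vc(1)] f1[symmetric] by (rule nrm_cong) (simp add: v_def)
    have "vec_norm2 u = nrm {..<r} (\<lambda>l. of_real (1 / \<sigma>) * lin c P f l)"
      unfolding vec_norm2_nrm[OF vc(2)] by (rule nrm_cong) (simp add: u_def)
    also have "\<dots> = 1" unfolding nrm_scale using \<sigma> by (simp add: g_def \<sigma>_def norm_divide)
    finally show "vec_norm2 u = 1" .
    show "A *\<^sub>v v = complex_of_real \<sigma> \<cdot>\<^sub>v u"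
      using Ac[of v] \<sigma> A by (intro eq_vecI) (auto simp: Av[OF vc(1)] vf u_def simp del: index_mult_mat_vec)
    show "mat_adjoint A *\<^sub>v u = complex_of_real \<sigma> \<cdot>\<^sub>v v"
    proof (rule eq_vecI)
      fix i assume "i < dim_vec (complex_of_real \<sigma> \<cdot>\<^sub>v v)"
      hence i: "i < c" by (simp add: v_def)
      let ?e = "\<lambda>j. if j = i then 1 else 0 :: complex"
      have "(mat_adjoint A *\<^sub>v u) $ i = of_real (1 / \<sigma>) * (\<Sum>l<r. cnj (P l i) * lin c P f l)"
        unfolding adjoint_mult_vec[OF A vc(2) i] by (simp add: u_def P_def sum_divide_distrib)
      also have "(\<Sum>l<r. cnj (P l i) * lin c P f l) = ip r (lin c P ?e) (lin c P f)"
      proof -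
        have "lin c P ?e l = (\<Sum>k<c. if k = i then P l k else 0)" for l
          unfolding lin_def by (rule sum.cong) auto
        thus ?thesis using i by (simp add: ip_def)
      qed
      also have "\<dots> = of_real (\<sigma>\<^sup>2) * ip c ?e f" by (simp only: stationary)
      also have "ip c ?e f = (\<Sum>k<c. if k = i then f k else 0)"
        unfolding ip_def by (rule sum.cong) auto
      also have "\<dots> = f i" using i by simp
      finally show "(mat_adjoint A *\<^sub>v u) $ i = (complex_of_real \<sigma> \<cdot>\<^sub>v v) $ i"
        using i \<sigma> by (simp add: v_def power2_eq_square)
    qed (use mat_adjoint_carrier[OF A] vc in auto)
  qed (use vc \<sigma> A in auto)
  thus ?thesis using f(3) \<sigma>_def by blast
qed

lemma sparse_unit: "1 \<le> s \<Longrightarrow> sparse n s (\<lambda>i. if i = k then 1 else 0)"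
  by (rule sparseI[of "{k}"]) auto

lemma nrm_unit: "k < (n :: nat) \<Longrightarrow> nrm {..<n} (\<lambda>i. if i = k then 1 else 0) = 1"
  by (subst nrm_eq_of_zero[of _ "{k}"]) (auto simp: nrm_def L2_set_def)

text \<open>Adjointness: testing the back-projected matrix with \<open>x\<close> and
  \<open>y\<close> correlates \<open>b\<close> with the measurements of their rank-one matrix. This
  lets the restricted isometry show that the back-projection is close to rank one on sparse
  tests.\<close>

lemma meas_adj_form:
  "(\<Sum>j<n2. (\<Sum>k<n1. cnj (x k) * meas_adj n1 n2 m M b $$ (k, j)) * y j) = ip m (bil n1 n2 M x y) (fn b)"
proof -
  have "(\<Sum>j<n2. (\<Sum>k<n1. cnj (x k) * meas_adj n1 n2 m M b $$ (k, j)) * y j) =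
     (\<Sum>k<n1. \<Sum>j<n2. \<Sum>l<m. cnj (x k) * (b $ l * M l $$ (k, j)) * y j)"
    by (subst sum.swap) (simp add: meas_adj_def sum_distrib_left sum_distrib_right)
  also have "\<dots> = (\<Sum>k<n1. \<Sum>l<m. \<Sum>j<n2. cnj (x k) * (b $ l * M l $$ (k, j)) * y j)"
    by (rule sum.cong[OF refl sum.swap])
  also have "\<dots> = (\<Sum>l<m. \<Sum>k<n1. \<Sum>j<n2. cnj (x k) * (b $ l * M l $$ (k, j)) * y j)"
    by (rule sum.swap)
  also have "\<dots> = ip m (bil n1 n2 M x y) (fn b)"
    by (simp add: ip_def bil_def sum_distrib_left sum_distrib_right mult_ac)
  finally show ?thesis .
qed

section \<open>Thresholding of a matrix close to rank one\<close>

lemma index_mult_mat_sum: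
  assumes "A \<in> carrier_mat m n" "B \<in> carrier_mat n p" "i < m" "j < p"
  shows "(A * B) $$ (i, j) = (\<Sum>k<n. A $$ (i, k) * B $$ (k, j))"
  using assms by (auto simp: scalar_prod_def atLeast0LessThan)

lemma coord_proj_carrier: "coord_proj n J \<in> carrier_mat n n"
  by (simp add: coord_proj_def)

lemma coord_proj_mult_index:
  assumes "A \<in> carrier_mat m n" "i < m" "j < n"
  shows "(coord_proj m J * A) $$ (i, j) = (if i \<in> J then A $$ (i, j) else 0)"
proof -
  have "(coord_proj m J * A) $$ (i, j) = (\<Sum>k<m. if k = i then if i \<in> J then A $$ (i, j) else 0 else 0)"
    unfolding index_mult_mat_sum[OF coord_proj_carrier assms]
    using assms by (intro sum.cong) (auto simp: coord_proj_def)
  thus ?thesis using assms by simp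
qed

lemma mult_coord_proj_index:
  assumes "A \<in> carrier_mat m n" "i < m" "j < n"
  shows "(A * coord_proj n J) $$ (i, j) = (if j \<in> J then A $$ (i, j) else 0)"
proof -
  have "(A * coord_proj n J) $$ (i, j) = (\<Sum>k<n. if k = j then if j \<in> J then A $$ (i, j) else 0 else 0)"
    unfolding index_mult_mat_sum[OF assms(1) coord_proj_carrier assms(2,3)]
    using assms by (intro sum.cong) (auto simp: coord_proj_def)
  thus ?thesis using assms by simp
qed

text \<open>
  \<open>A\<close> is close to \<open>\<lambda> u v\<^sup>*\<close> when tested against sparse rank-one matrices; testing against the error
  itself turns this into norm bounds for pieces of rows and columns.
\<close>

locale near_rank_one =
  fixes n1 n2 s1 s2 :: nat and A :: "complex mat" and lam \<epsilon> :: real and u v :: "nat \<Rightarrow> complex"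
  assumes A: "A \<in> carrier_mat n1 n2" and lam: "0 < lam" and eps: "0 \<le> \<epsilon>" "\<epsilon> \<le> lam / 100"
    and s: "1 \<le> s1" "s1 \<le> n1" "1 \<le> s2" "s2 \<le> n2"
    and u: "sparse n1 s1 u" "nrm {..<n1} u = 1" and v: "sparse n2 s2 v" "nrm {..<n2} v = 1"
    and near: "\<And>x y. sparse n1 s1 x \<Longrightarrow> sparse n2 s2 y \<Longrightarrow>
      cmod ((\<Sum>j<n2. (\<Sum>k<n1. cnj (x k) * A $$ (k, j)) * y j) - of_real lam * ip n1 x u * ip n2 v y) \<le>
        \<epsilon> * nrm {..<n1} x * nrm {..<n2} y"
begin

definition E where "E k j = A $$ (k, j) - of_real lam * u k * cnj (v j)"

lemma E_form: "(\<Sum>j<n2. (\<Sum>k<n1. cnj (x k) * E k j) * y j) =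
    (\<Sum>j<n2. (\<Sum>k<n1. cnj (x k) * A $$ (k, j)) * y j) - of_real lam * ip n1 x u * ip n2 v y"
proof -
  have "(\<Sum>j<n2. (\<Sum>k<n1. cnj (x k) * E k j) * y j) =
     (\<Sum>j<n2. (\<Sum>k<n1. cnj (x k) * A $$ (k, j)) * y j - of_real lam * ip n1 x u * (cnj (v j) * y j))"
    by (rule sum.cong) (auto simp: E_def ip_def algebra_simps sum_subtractf sum_distrib_left sum_distrib_right)
  thus ?thesis by (simp add: sum_subtractf sum_distrib_left ip_def)
qed

lemma E_columns_le:
  assumes x: "sparse n1 s1 x" and J: "J \<subseteq> {..<n2}" "card J \<le> s2"
  shows "nrm J (\<lambda>j. \<Sum>k<n1. cnj (x k) * E k j) \<le> \<epsilon> * nrm {..<n1} x"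
proof -
  define h where "h = (\<lambda>j. \<Sum>k<n1. cnj (x k) * E k j)"
  have finJ: "finite J" using J finite_subset by blast
  let ?y = "restr J (\<lambda>j. cnj (h j))"
  have y: "sparse n2 s2 ?y" "nrm {..<n2} ?y = nrm J h"
    using restr_sparse[OF finJ J(2)] restr_nrm[OF J(1)] by (auto simp: nrm_def)
  have "(\<Sum>j<n2. h j * ?y j) = of_real ((nrm J h)\<^sup>2)"
  proof -
    have "(\<Sum>j<n2. h j * ?y j) = ip n2 ?y (\<lambda>j. cnj (h j))"
      unfolding ip_def by (rule sum.cong) (auto simp: restr_def)
    thus ?thesis by (simp add: restr_ip[OF J(1)] nrm_def)
  qed
  hence "cmod (\<Sum>j<n2. h j * ?y j) = (nrm J h)\<^sup>2" by (metis norm_of_real abs_power2)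
  hence "(nrm J h)\<^sup>2 \<le> \<epsilon> * nrm {..<n1} x * nrm J h"
    using near[OF x y(1)] unfolding E_form[symmetric] y(2) by (simp add: h_def)
  moreover have "0 \<le> \<epsilon> * nrm {..<n1} x" using eps by simp
  ultimately show ?thesis using le_of_sq_le_mult[of "nrm J h"] by (simp add: h_def)
qed

lemma E_rows_le:
  assumes y: "sparse n2 s2 y" and J: "J \<subseteq> {..<n1}" "card J \<le> s1"
  shows "nrm J (\<lambda>k. \<Sum>j<n2. E k j * y j) \<le> \<epsilon> * nrm {..<n2} y"
proof -
  define h where "h = (\<lambda>k. \<Sum>j<n2. E k j * y j)"
  have finJ: "finite J" using J finite_subset by blast
  let ?x = "restr J h"
  have x: "sparse n1 s1 ?x" "nrm {..<n1} ?x = nrm J h"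
    using restr_sparse[OF finJ J(2)] restr_nrm[OF J(1)] by (auto simp: nrm_def)
  have "(\<Sum>j<n2. (\<Sum>k<n1. cnj (?x k) * E k j) * y j) = ip n1 ?x h"
    unfolding ip_def h_def sum_distrib_left sum_distrib_right by (subst sum.swap) (simp add: mult_ac)
  also have "\<dots> = of_real ((nrm J h)\<^sup>2)" by (rule restr_ip[OF J(1)])
  finally have "cmod (\<Sum>j<n2. (\<Sum>k<n1. cnj (?x k) * E k j) * y j) = (nrm J h)\<^sup>2"
    by (metis norm_of_real abs_power2)
  hence "(nrm J h)\<^sup>2 \<le> \<epsilon> * nrm {..<n2} y * nrm J h"
    using near[OF x(1) y] unfolding E_form[symmetric] x(2) by (simp add: mult_ac)
  moreover have "0 \<le> \<epsilon> * nrm {..<n2} y" using eps by simp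
  ultimately show ?thesis using le_of_sq_le_mult[of "nrm J h"] by (simp add: h_def)
qed

text \<open>Row \<open>k\<close> of the error arises by testing with the unit vector at
  \<open>k\<close>, so its norm on \<open>J\<close> is at most \<epsilon>.\<close>

lemma row_bounds:
  assumes k: "k < n1" and J: "J \<subseteq> {..<n2}" "card J \<le> s2"
  shows "\<bar>nrm J (\<lambda>j. A $$ (k, j)) - lam * cmod (u k) * nrm J v\<bar> \<le> \<epsilon>"
proof -
  have "(\<lambda>j. \<Sum>i<n1. cnj (if i = k then 1 else 0) * E i j) = E k"
    using k by (auto simp: if_distrib[of cnj] if_distrib[of "\<lambda>x. x * _"] cong: if_cong)
  hence E: "nrm J (E k) \<le> \<epsilon>"
    using E_columns_le[OF sparse_unit[OF s(1), of n1 k] J] nrm_unit[OF k] by simp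
  have r1: "nrm J (\<lambda>j. of_real lam * u k * cnj (v j)) = lam * cmod (u k) * nrm J v"
    unfolding nrm_scale using lam by (simp add: norm_mult nrm_def)
  have "(\<lambda>j. A $$ (k, j)) = (\<lambda>j. of_real lam * u k * cnj (v j) + E k j)" by (simp add: E_def)
  moreover have "(\<lambda>j. of_real lam * u k * cnj (v j)) = (\<lambda>j. A $$ (k, j) - E k j)" by (simp add: E_def)
  ultimately show ?thesis
    using nrm_add[of J "\<lambda>j. of_real lam * u k * cnj (v j)" "E k"] nrm_diff[of J "\<lambda>j. A $$ (k, j)" "E k"] E r1
    by (simp add: abs_le_iff)
qed

lemma column_bounds:
  assumes j: "j < n2" and J: "J \<subseteq> {..<n1}" "card J \<le> s1"
  shows "\<bar>nrm J (\<lambda>k. A $$ (k, j)) - lam * cmod (v j) * nrm J u\<bar> \<le> \<epsilon>"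
proof -
  have "(\<lambda>k. \<Sum>i<n2. E k i * (if i = j then 1 else 0)) = (\<lambda>k. E k j)"
    using j by (auto simp: if_distrib[of "\<lambda>x. _ * x"] cong: if_cong)
  hence E: "nrm J (\<lambda>k. E k j) \<le> \<epsilon>"
    using E_rows_le[OF sparse_unit[OF s(3), of n2 j] J] nrm_unit[OF j] by simp
  have r1: "nrm J (\<lambda>k. of_real lam * cnj (v j) * u k) = lam * cmod (v j) * nrm J u"
    unfolding nrm_scale using lam by (simp add: norm_mult)
  have "(\<lambda>k. A $$ (k, j)) = (\<lambda>k. of_real lam * cnj (v j) * u k + E k j)" by (auto simp: E_def)
  moreover have "(\<lambda>k. of_real lam * cnj (v j) * u k) = (\<lambda>k. A $$ (k, j) - E k j)" by (auto simp: E_def)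
  ultimately show ?thesis
    using nrm_add[of J "\<lambda>k. of_real lam * cnj (v j) * u k" "\<lambda>k. E k j"] nrm_diff[of J "\<lambda>k. A $$ (k, j)" "\<lambda>k. E k j"] E r1
    by (simp add: abs_le_iff)
qed

lemma other_entries_small:
  fixes n :: nat
  assumes "nrm {..<n} x = 1" "i < n" "99 / 100 \<le> cmod (x i)" "k < n" "k \<noteq> i"
  shows "cmod (x k) \<le> 1 / 5"
proof -
  have "(cmod (x i))\<^sup>2 + (cmod (x k))\<^sup>2 = (\<Sum>j\<in>{i, k}. (cmod (x j))\<^sup>2)" using assms by simp
  also have "\<dots> \<le> (\<Sum>j<n. (cmod (x j))\<^sup>2)" using assms by (intro sum_mono2) auto
  also have "\<dots> = 1" using assms(1) by (simp add: nrm_sq[symmetric])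
  finally have "(cmod (x k))\<^sup>2 \<le> 1 - (99 / 100)\<^sup>2"
    using power_mono[OF assms(3), of 2] by linarith
  also have "\<dots> \<le> (1 / 5)\<^sup>2" by (simp add: power2_eq_square)
  finally show ?thesis by (rule power2_le_imp_le) simp
qed

text \<open>If the dominant row were missed, some selected row \<open>k\<close> would have
  \<open>\<zeta> i \<le> \<zeta> k\<close>. But \<open>\<zeta> i\<close> is at least 99/100 lam -
  \<epsilon>, as \<open>S i\<close> does no worse than the support of \<open>v\<close>, whereas
  \<open>\<zeta> k\<close> is at most lam / 5 + \<epsilon>.\<close>

lemma row_selection:
  assumes S: "\<And>k. k < n1 \<Longrightarrow> top_indices n2 (\<lambda>j. cmod (A $$ (k, j))) s2 (S k) \<and>
      \<zeta> k = sqrt (\<Sum>j\<in>S k. (cmod (A $$ (k, j)))\<^sup>2)"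
    and J: "top_indices n1 \<zeta> s1 J" and i: "i < n1" "99 / 100 \<le> cmod (u i)"
  shows "i \<in> J"
proof (rule ccontr)
  assume "i \<notin> J"
  note J' = J[unfolded top_indices_def]
  have "J \<noteq> {}" using conjunct1[OF conjunct2[OF J']] s(1) by force
  then obtain k where k: "k \<in> J" by blast
  have kn: "k < n1" "k \<noteq> i" using conjunct1[OF J'] k \<open>i \<notin> J\<close> by blast+
  have \<zeta>: "\<zeta> k' = nrm (S k') (\<lambda>j. A $$ (k', j))" if "k' < n1" for k'
    using S[OF that] by (simp add: nrm_def L2_set_def)
  have Sk: "S k' \<subseteq> {..<n2}" "card (S k') = s2" "finite (S k')" if "k' < n1" for k'
    using S[OF that] finite_subset[of "S k'" "{..<n2}"] by (auto simp: top_indices_def)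
  define T where "T = {j. j < n2 \<and> v j \<noteq> 0}"
  have T: "T \<subseteq> {..<n2}" "card T \<le> s2" "finite T" using v by (auto simp: T_def sparse_def)
  have "nrm {..<n2} v = nrm T v" by (rule nrm_eq_of_zero) (auto simp: T_def)
  hence "nrm T v = 1" using v(2) by simp
  hence "lam * cmod (u i) - \<epsilon> \<le> nrm T (\<lambda>j. A $$ (i, j))" using row_bounds[OF i(1) T(1,2)] by simp
  also have "\<dots> \<le> \<zeta> i"
    unfolding \<zeta>[OF i(1)]
  proof (rule top_nrm_le)
    show "cmod (A $$ (i, j)) \<le> cmod (A $$ (i, j'))" if "j' \<in> S i" "j \<in> T - S i" for j j'
      using S[OF i(1)] that T(1) unfolding top_indices_def by blast
  qed (use Sk[OF i(1)] T in simp_all)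
  also have "\<zeta> i \<le> \<zeta> k" using J' k i(1) \<open>i \<notin> J\<close> by blast
  also have "\<zeta> k \<le> lam * cmod (u k) * nrm (S k) v + \<epsilon>"
    unfolding \<zeta>[OF kn(1)] using row_bounds[OF kn(1), of "S k"] Sk[OF kn(1)] by simp
  also have "lam * cmod (u k) * nrm (S k) v \<le> lam * (1 / 5) * 1"
  proof (intro mult_mono)
    show "cmod (u k) \<le> 1 / 5" by (rule other_entries_small[OF u(2) i kn])
    show "nrm (S k) v \<le> 1" using nrm_mono[of "{..<n2}" "S k" v] Sk[OF kn(1)] v(2) by simp
  qed (use lam in auto)
  finally have "lam * cmod (u i) \<le> lam * (1 / 5) + 2 * \<epsilon>" by simp
  moreover have "lam * (99 / 100) \<le> lam * cmod (u i)" using i lam by (intro mult_left_mono) auto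
  ultimately show False using eps lam by simp
qed

text \<open>As for rows, except that the column norms see only the selected rows. The factor
  \<open>nrm J u\<close> costs a second 99/100, and (99/100)^2 still exceeds 1/5 + 2/100.\<close>

lemma column_selection:
  assumes J: "J \<subseteq> {..<n1}" "card J \<le> s1" "99 / 100 \<le> nrm J u"
    and J2: "top_indices n2 (\<lambda>j. vec_norm2 (col (coord_proj n1 J * A) j)) s2 J2"
    and i: "i < n2" "99 / 100 \<le> cmod (v i)"
  shows "i \<in> J2"
proof (rule ccontr)
  assume "i \<notin> J2"
  note J' = J2[unfolded top_indices_def]
  have "J2 \<noteq> {}" using conjunct1[OF conjunct2[OF J']] s(3) by force
  then obtain k where k: "k \<in> J2" by blast
  have kn: "k < n2" "k \<noteq> i" using conjunct1[OF J'] k \<open>i \<notin> J2\<close> by blast+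
  have col: "vec_norm2 (col (coord_proj n1 J * A) j) = nrm J (\<lambda>k. A $$ (k, j))" if j: "j < n2" for j
  proof -
    have c: "col (coord_proj n1 J * A) j \<in> carrier_vec n1" by (rule carrier_vecI) (simp add: coord_proj_def)
    show ?thesis
      unfolding vec_norm2_nrm[OF c] restr_nrm[OF J(1), symmetric]
      using coord_proj_mult_index[OF A _ j] j A
      by (intro nrm_cong) (simp add: coord_proj_def restr_def del: index_mult_mat(1))
  qed
  have u1: "nrm J u \<le> 1" using nrm_mono[of "{..<n1}" J u] J u(2) by simp
  have "lam * cmod (v i) * nrm J u - \<epsilon> \<le> nrm J (\<lambda>k. A $$ (k, i))" using column_bounds[OF i(1) J(1,2)] by simp
  also have "\<dots> \<le> nrm J (\<lambda>k'. A $$ (k', k))"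
    unfolding col[OF i(1), symmetric] col[OF kn(1), symmetric] using J' k i(1) \<open>i \<notin> J2\<close> by blast
  also have "\<dots> \<le> lam * cmod (v k) * nrm J u + \<epsilon>" using column_bounds[OF kn(1) J(1,2)] by simp
  also have "lam * cmod (v k) * nrm J u \<le> lam * (1 / 5) * 1"
    using other_entries_small[OF v(2) i kn] u1 lam by (intro mult_mono) auto
  finally have "lam * cmod (v i) * nrm J u \<le> lam * (1 / 5) + 2 * \<epsilon>" by simp
  moreover have "lam * (99 / 100) * (99 / 100) \<le> lam * cmod (v i) * nrm J u"
    using i J(3) lam by (intro mult_mono) auto
  ultimately show False using eps lam by simp
qed

text \<open>Evaluating \<open>B\<close> at the normalized restriction of \<open>v\<close> shows that
  \<sigma> is at least 9/10 lam. The singular vector equation for the adjoint shows that \<sigma> v0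
  is lam \<beta> v on \<open>J2\<close> up to an error of norm \<epsilon>; so lam |\<beta>| is at
  least \<sigma> - \<epsilon>, and \<open>v0\<close> inherits the direction of
  \<open>v\<close>.\<close>

lemma leading_vector_aligned:
  assumes J1: "J1 \<subseteq> {..<n1}" "card J1 \<le> s1" "99 / 100 \<le> nrm J1 u"
    and J2: "J2 \<subseteq> {..<n2}" "card J2 \<le> s2" "99 / 100 \<le> nrm J2 v"
    and lead: "leading_right_singular_vector (coord_proj n1 J1 * A * coord_proj n2 J2) v0"
  shows "v0 \<in> carrier_vec n2" "nrm {..<n2} (fn v0) = 1" "sparse n2 s2 (fn v0)"
    "1 / 2 \<le> cmod (ip n2 (fn v0) v)"
proof -
  define B where "B = coord_proj n1 J1 * A * coord_proj n2 J2"
  have fin: "finite J1" "finite J2" using J1 J2 finite_subset by blast+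
  have B: "B \<in> carrier_mat n1 n2" by (auto simp: B_def coord_proj_def)
  have Bij: "B $$ (k, j) = (if k \<in> J1 \<and> j \<in> J2 then A $$ (k, j) else 0)" if "k < n1" "j < n2" for k j
  proof -
    have "coord_proj n1 J1 * A \<in> carrier_mat n1 n2" using A coord_proj_carrier by (rule mult_carrier_mat[rotated])
    from mult_coord_proj_index[OF this that, of J2] show ?thesis
      unfolding B_def coord_proj_mult_index[OF A that] by simp
  qed
  obtain \<sigma> u0 where tr: "singular_triple B \<sigma> u0 v0"
    and max: "\<And>\<sigma>' u' v'. singular_triple B \<sigma>' u' v' \<Longrightarrow> \<sigma>' \<le> \<sigma>"
    using lead unfolding B_def leading_right_singular_vector_def by blast
  have u0: "u0 \<in> carrier_vec n1" "nrm {..<n1} (fn u0) = 1" and v0: "v0 \<in> carrier_vec n2" "nrm {..<n2} (fn v0) = 1"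
    and Bu0: "mat_adjoint B *\<^sub>v u0 = complex_of_real \<sigma> \<cdot>\<^sub>v v0" and \<sigma>0: "0 \<le> \<sigma>"
    using tr B vec_norm2_nrm[of u0 n1] vec_norm2_nrm[of v0 n2] by (auto simp: singular_triple_def)
  define q where "q = nrm J2 v"
  have q: "99 / 100 \<le> q" "q \<le> 1" using J2 nrm_mono[of "{..<n2}" J2 v] v(2) by (auto simp: q_def)
  have p: "99 / 100 \<le> nrm J1 u" "nrm J1 u \<le> 1" using J1 nrm_mono[of "{..<n1}" J1 u] u(2) by auto
  have \<sigma>: "9 / 10 * lam \<le> \<sigma>"
  proof -
    define w where "w = Matrix.vec n2 (\<lambda>j. of_real (1 / q) * restr J2 v j)"
    have w: "w \<in> carrier_vec n2" by (simp add: w_def)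
    have wn: "nrm {..<n2} (fn w) = 1"
    proof -
      have "nrm {..<n2} (fn w) = nrm {..<n2} (\<lambda>j. of_real (1 / q) * restr J2 v j)"
        by (rule nrm_cong) (simp add: w_def)
      also have "\<dots> = 1" unfolding nrm_scale restr_nrm[OF J2(1)] using q by (simp add: q_def[symmetric] norm_divide)
      finally show ?thesis .
    qed
    have ws: "sparse n2 s2 (fn w)"
      using fin J2 by (intro sparseI[of J2]) (auto simp: w_def restr_def)
    have wv: "ip n2 v (fn w) = of_real q"
    proof -
      have "ip n2 v (fn w) = of_real (1 / q) * ip n2 v (restr J2 v)"
        unfolding ip_scale_right[symmetric] by (rule ip_cong) (auto simp: w_def)
      also have "ip n2 v (restr J2 v) = cnj (ip n2 (restr J2 v) v)" by (simp add: ip_cnj)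
      also have "\<dots> = of_real (q\<^sup>2)" unfolding restr_ip[OF J2(1)] by (simp add: q_def)
      finally show ?thesis using q by (simp add: power2_eq_square)
    qed
    have Bw: "(B *\<^sub>v w) $ k = restr J1 (\<lambda>k. of_real (lam * q) * u k + (\<Sum>j<n2. E k j * w $ j)) k" if "k < n1" for k
    proof -
      have "(B *\<^sub>v w) $ k = (\<Sum>j<n2. B $$ (k, j) * w $ j)"
        using mult_mat_vec_lin[OF B w that] by (simp add: lin_def)
      also have "\<dots> = (\<Sum>j<n2. if k \<in> J1 then of_real lam * u k * (cnj (v j) * w $ j) + E k j * w $ j else 0)"
        using that by (intro sum.cong) (auto simp: Bij E_def w_def restr_def algebra_simps)
      also have "\<dots> = restr J1 (\<lambda>k. of_real lam * u k * ip n2 v (fn w) + (\<Sum>j<n2. E k j * w $ j)) k"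
        by (simp add: restr_def sum.distrib sum_distrib_left ip_def)
      finally show ?thesis by (simp add: wv restr_def mult_ac)
    qed
    have Bwc: "B *\<^sub>v w \<in> carrier_vec n1" using B by (auto intro: carrier_vecI)
    have "vec_norm2 (B *\<^sub>v w) = nrm J1 (\<lambda>k. of_real (lam * q) * u k + (\<Sum>j<n2. E k j * w $ j))"
      unfolding vec_norm2_nrm[OF Bwc] restr_nrm[OF J1(1), symmetric]
      by (rule nrm_cong) (simp add: Bw del: index_mult_mat_vec)
    moreover have "nrm J1 (\<lambda>k. of_real (lam * q) * u k) \<le>
        nrm J1 (\<lambda>k. of_real (lam * q) * u k + (\<Sum>j<n2. E k j * w $ j)) + nrm J1 (\<lambda>k. \<Sum>j<n2. E k j * w $ j)"
      using nrm_diff[of J1 "\<lambda>k. of_real (lam * q) * u k + (\<Sum>j<n2. E k j * w $ j)" "\<lambda>k. \<Sum>j<n2. E k j * w $ j"] by simp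
    moreover have "nrm J1 (\<lambda>k. \<Sum>j<n2. E k j * w $ j) \<le> \<epsilon>" using E_rows_le[OF ws J1(1,2)] wn by simp
    moreover have "lam * (99 / 100) * (99 / 100) \<le> nrm J1 (\<lambda>k. of_real (lam * q) * u k)"
      unfolding nrm_scale norm_of_real using lam q p by (intro mult_mono) (auto simp: abs_mult)
    ultimately have big: "9 / 10 * lam \<le> vec_norm2 (B *\<^sub>v w)" using eps lam by simp
    hence "0 < vec_norm2 (B *\<^sub>v w)" using lam by simp
    then obtain \<sigma>' u' v' where "singular_triple B \<sigma>' u' v'" "vec_norm2 (B *\<^sub>v w) \<le> \<sigma>'"
      using exists_singular_triple_ge[OF B w] wn by (auto simp: vec_norm2_nrm[OF w])
    thus ?thesis using max big by force
  qed
  have \<sigma>pos: "\<sigma> > 0" using \<sigma> lam by simp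
  let ?x = "restr J1 (fn u0)"
  define \<beta> where "\<beta> = ip n1 u ?x"
  define h where "h = (\<lambda>j. cnj (\<Sum>k<n1. cnj (?x k) * E k j))"
  have x: "sparse n1 s1 ?x" "nrm {..<n1} ?x \<le> 1"
    using restr_sparse[OF fin(1) J1(2)] restr_nrm[OF J1(1)] nrm_mono[of "{..<n1}" J1 "fn u0"] J1 u0(2) by auto
  have h: "nrm J2 h \<le> \<epsilon>"
  proof -
    have "nrm J2 h \<le> \<epsilon> * nrm {..<n1} ?x" using E_columns_le[OF x(1) J2(1,2)]
      by (simp only: h_def nrm_def complex_mod_cnj)
    also have "\<dots> \<le> \<epsilon> * 1" using x(2) eps by (intro mult_left_mono) auto
    finally show ?thesis by simp
  qed
  have \<sigma>v0: "of_real \<sigma> * v0 $ j = restr J2 (\<lambda>j. of_real lam * \<beta> * v j + h j) j" if "j < n2" for j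
  proof -
    have "of_real \<sigma> * v0 $ j = (mat_adjoint B *\<^sub>v u0) $ j" using Bu0 v0 that by simp
    also have "\<dots> = (\<Sum>k<n1. cnj (B $$ (k, j)) * u0 $ k)" by (rule adjoint_mult_vec[OF B u0(1) that])
    also have "\<dots> = (\<Sum>k<n1. if j \<in> J2 then of_real lam * v j * (cnj (u k) * ?x k) + ?x k * cnj (E k j) else 0)"
      using that by (intro sum.cong) (auto simp: Bij E_def restr_def algebra_simps)
    finally show ?thesis
      by (simp add: restr_def[of J2] sum.distrib sum_distrib_left[symmetric] \<beta>_def ip_def h_def mult_ac)
  qed
  have \<beta>1: "cmod \<beta> \<le> 1" using cauchy_schwarz[of n1 u ?x] u(2) x(2) by (simp add: \<beta>_def)
  have \<sigma>_nrm: "\<sigma> = nrm J2 (\<lambda>j. of_real lam * \<beta> * v j + h j)"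
  proof -
    have "\<sigma> = nrm {..<n2} (\<lambda>j. of_real \<sigma> * v0 $ j)" unfolding nrm_scale using v0 \<sigma>0 by simp
    also have "\<dots> = nrm {..<n2} (restr J2 (\<lambda>j. of_real lam * \<beta> * v j + h j))"
      by (rule nrm_cong) (simp add: \<sigma>v0)
    finally show ?thesis by (simp add: restr_nrm[OF J2(1)])
  qed
  have "\<sigma> \<le> lam * cmod \<beta> * q + nrm J2 h"
    unfolding \<sigma>_nrm using nrm_add[of J2 "\<lambda>j. of_real lam * \<beta> * v j" h] lam unfolding nrm_scale
    by (simp add: norm_mult q_def)
  also have "lam * cmod \<beta> * q \<le> lam * cmod \<beta> * 1" using q lam by (intro mult_left_mono) auto
  finally have \<sigma>_le: "\<sigma> \<le> lam * cmod \<beta> + \<epsilon>" using h by simp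
  have ip_v: "of_real \<sigma> * ip n2 v (fn v0) = of_real (lam * q\<^sup>2) * \<beta> + ip n2 (restr J2 v) (restr J2 h)"
  proof -
    have "of_real \<sigma> * ip n2 v (fn v0) = ip n2 v (restr J2 (\<lambda>j. of_real lam * \<beta> * v j + h j))"
      unfolding ip_scale_right[symmetric] by (rule ip_cong) (simp_all add: \<sigma>v0)
    also have "\<dots> = of_real lam * \<beta> * ip n2 (restr J2 v) v + ip n2 (restr J2 v) (restr J2 h)"
      unfolding ip_scale_right[symmetric] ip_add_right[symmetric]
      unfolding ip_def by (rule sum.cong) (auto simp: restr_def)
    also have "ip n2 (restr J2 v) v = of_real (q\<^sup>2)" unfolding q_def by (rule restr_ip[OF J2(1)])
    finally show ?thesis by (simp add: mult_ac)
  qed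
  have "cmod (ip n2 (restr J2 v) (restr J2 h)) \<le> q * nrm J2 h"
    using cauchy_schwarz[of n2 "restr J2 v" "restr J2 h"] by (simp add: restr_nrm[OF J2(1)] q_def)
  also have "\<dots> \<le> 1 * \<epsilon>" using q h by (intro mult_mono) auto
  finally have "lam * q\<^sup>2 * cmod \<beta> \<le> \<sigma> * cmod (ip n2 v (fn v0)) + \<epsilon>"
    using arg_cong[OF ip_v, of cmod] norm_diff_ineq[of "of_real (lam * q\<^sup>2) * \<beta>" "ip n2 (restr J2 v) (restr J2 h)"] lam \<sigma>0
    by (simp add: norm_mult norm_power abs_mult)
  moreover have "(9 / 10) * (lam * cmod \<beta>) \<le> lam * q\<^sup>2 * cmod \<beta>"
  proof -
    have "(99 / 100)\<^sup>2 \<le> q\<^sup>2" using q by (intro power_mono) auto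
    hence "9 / 10 \<le> q\<^sup>2" by (simp add: power2_eq_square)
    hence "9 / 10 * (lam * cmod \<beta>) \<le> q\<^sup>2 * (lam * cmod \<beta>)" using lam by (intro mult_right_mono) auto
    thus ?thesis by (simp add: mult_ac)
  qed
  \<comment> \<open>9/10 (\<sigma> - \<epsilon>) - \<epsilon> is at least \<sigma> / 2, because
    \<epsilon> <= lam / 100 <= \<sigma> / 90.\<close>
  ultimately have "\<sigma> * (1 / 2) \<le> \<sigma> * cmod (ip n2 v (fn v0))" using \<sigma>_le \<sigma> eps lam by linarith
  hence "1 / 2 \<le> cmod (ip n2 v (fn v0))" using \<sigma>pos by (simp only: mult_le_cancel_left_pos)
  thus "1 / 2 \<le> cmod (ip n2 (fn v0) v)" by (metis ip_cnj complex_mod_cnj)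
  show "v0 \<in> carrier_vec n2" "nrm {..<n2} (fn v0) = 1" by (fact v0)+
  show "sparse n2 s2 (fn v0)"
  proof (rule sparseI[OF fin(2) J2(2)])
    fix j assume "j < n2" "j \<notin> J2"
    thus "v0 $ j = 0" using \<sigma>v0[of j] \<sigma>pos by (simp add: restr_def)
  qed
qed

theorem thresholding_init_aligned:
  assumes init: "thresholding_init n1 n2 s1 s2 A v0"
    and big_u: "\<exists>i<n1. 99 / 100 \<le> cmod (u i)" and big_v: "s2 = n2 \<or> (\<exists>j<n2. 99 / 100 \<le> cmod (v j))"
  shows "v0 \<in> carrier_vec n2" "nrm {..<n2} (fn v0) = 1" "sparse n2 s2 (fn v0)"
    "1 / 2 \<le> cmod (ip n2 (fn v0) v)"
proof -
  from init obtain S \<zeta> J1 J2 where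
    S: "\<And>k. k < n1 \<Longrightarrow> top_indices n2 (\<lambda>j. cmod (A $$ (k, j))) s2 (S k) \<and> \<zeta> k = sqrt (\<Sum>j\<in>S k. (cmod (A $$ (k, j)))\<^sup>2)"
    and J1: "top_indices n1 \<zeta> s1 J1"
    and J2: "top_indices n2 (\<lambda>j. vec_norm2 (col (coord_proj n1 J1 * A) j)) s2 J2"
    and lead: "leading_right_singular_vector (coord_proj n1 J1 * A * coord_proj n2 J2) v0"
    unfolding thresholding_init_def by metis
  have c: "J1 \<subseteq> {..<n1}" "card J1 = s1" "J2 \<subseteq> {..<n2}" "card J2 = s2"
    using J1 J2 by (auto simp: top_indices_def)
  have fin: "finite J1" "finite J2" using c finite_subset by blast+
  obtain i where i: "i < n1" "99 / 100 \<le> cmod (u i)" using big_u by blast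
  have "i \<in> J1" by (rule row_selection[OF S J1 i])
  hence u1: "99 / 100 \<le> nrm J1 u" using i cmod_le_nrm[OF fin(1), of i u] by simp
  have v1: "99 / 100 \<le> nrm J2 v"
  proof (cases "s2 = n2")
    \<comment> \<open>Every column is selected, so \<open>v\<close> keeps its full norm whatever its
      largest entry.\<close>
    case True
    hence "J2 = {..<n2}" using c by (intro card_subset_eq) auto
    thus ?thesis using v(2) by simp
  next
    case False
    then obtain j where j: "j < n2" "99 / 100 \<le> cmod (v j)" using big_v by blast
    have "j \<in> J2" using c u1 by (intro column_selection[OF _ _ _ J2 j]) auto
    thus ?thesis using j cmod_le_nrm[OF fin(2), of j v] by simp
  qed
  show "v0 \<in> carrier_vec n2" "nrm {..<n2} (fn v0) = 1" "sparse n2 s2 (fn v0)" "1 / 2 \<le> cmod (ip n2 (fn v0) v)"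
    using leading_vector_aligned[OF _ _ u1 _ _ v1 lead] c by auto
qed

end

section \<open>Nets of sparse vectors\<close>

text \<open>One term of the binomial expansion of (1 + x)^n at x = s / n, where the whole sum is at
  most exp (n x) = exp s.\<close>

lemma binomial_le_exp:
  assumes "1 \<le> s" "s \<le> n"
  shows "real (n choose s) \<le> exp (s * ln (exp 1 * n / s))"
proof -
  define x where "x = real s / n"
  have x: "x > 0" using assms by (simp add: x_def)
  have "real (n choose s) * x ^ s \<le> (\<Sum>k\<le>n. real (n choose k) * x ^ k)"
    using assms x by (intro member_le_sum[of s "{..n}" "\<lambda>k. real (n choose k) * x ^ k"]) auto
  also have "\<dots> = (x + 1) ^ n" by (simp add: binomial_ring)
  also have "\<dots> \<le> exp x ^ n" using exp_ge_add_one_self[of x] x by (intro power_mono) (simp_all add: add.commute)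
  also have "\<dots> = exp s" using assms by (simp add: exp_of_nat_mult[symmetric] x_def)
  finally have "real (n choose s) \<le> exp s / x ^ s" using x by (simp add: field_simps)
  also have "\<dots> = (exp 1 * n / s) ^ s"
    using assms by (simp add: x_def power_divide power_mult_distrib exp_of_nat_mult[symmetric])
  also have "\<dots> = exp (s * ln (exp 1 * n / s))"
    using assms by (subst exp_of_nat_mult) simp
  finally show ?thesis .
qed

text \<open>Lattice points of spacing 1 / sqrt (8 s) on \<open>J\<close> whose integer coordinates
  have total absolute value at most 8 s. Limiting the sum, and not only each coordinate, keeps their
  number exponential in \<open>s\<close>.\<close>

definition grid :: "nat set \<Rightarrow> nat \<Rightarrow> (nat \<Rightarrow> complex) set" where
  "grid J s = (\<lambda>k i. if i \<in> J then of_real (1 / sqrt (8 * s)) * Complex (of_int (fst (k i))) (of_int (snd (k i))) else 0) `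
     {k \<in> PiE J (\<lambda>_. {- int (8 * s)..int (8 * s)} \<times> {- int (8 * s)..int (8 * s)}).
       (\<Sum>i\<in>J. \<bar>fst (k i)\<bar> + \<bar>snd (k i)\<bar>) \<le> int (8 * s)}"

definition net :: "nat \<Rightarrow> nat \<Rightarrow> (nat \<Rightarrow> complex) set" where
  "net n s = {p \<in> (\<Union>J\<in>{J. J \<subseteq> {..<n} \<and> card J = s}. grid J s). nrm {..<n} p \<le> 1}"

lemma sum_half_powers_le: "(\<Sum>a\<in>{- int N..int N}. (1 / 2 :: real) ^ nat \<bar>a\<bar>) \<le> 3 - 2 * (1 / 2) ^ N"
proof (induction N)
  case (Suc N)
  have "{- int (Suc N)..int (Suc N)} = insert (int (Suc N)) (insert (- int (Suc N)) {- int N..int N})"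
    by auto
  thus ?case using Suc by (simp add: nat_add_distrib)
qed simp

text \<open>Weighting a point \<open>k\<close> by \<open>2 ^ (8 s - |k|)\<close>, which is at least \<open>1\<close>, turns the count into a product.\<close>

lemma finite_card_grid:
  assumes "finite J" "card J = s"
  shows "finite (grid J s)" "card (grid J s) \<le> 2304 ^ s"
proof -
  let ?I = "{- int (8 * s)..int (8 * s)}"
  let ?K = "PiE J (\<lambda>_. ?I \<times> ?I)"
  let ?S = "{k \<in> ?K. (\<Sum>i\<in>J. \<bar>fst (k i)\<bar> + \<bar>snd (k i)\<bar>) \<le> int (8 * s)}"
  have finK: "finite ?K" using assms by (intro finite_PiE) auto
  show "finite (grid J s)" unfolding grid_def using finK by simp
  have "card (grid J s) \<le> card ?S" unfolding grid_def using finK by (intro card_image_le) simp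
  hence "real (card (grid J s)) \<le> (\<Sum>k\<in>?S. 1)" by simp
  also have "\<dots> \<le> (\<Sum>k\<in>?S. 2 ^ (8 * s) * (\<Prod>i\<in>J. (1 / 2) ^ nat \<bar>fst (k i)\<bar> * (1 / 2) ^ nat \<bar>snd (k i)\<bar>))"
  proof (rule sum_mono)
    fix k assume k: "k \<in> ?S"
    define N where "N = (\<Sum>i\<in>J. nat \<bar>fst (k i)\<bar> + nat \<bar>snd (k i)\<bar>)"
    have "int N \<le> int (8 * s)" using k by (simp add: N_def)
    hence "N \<le> 8 * s" by simp
    have "(1::real) = 2 ^ (8 * s) * (1 / 2) ^ (8 * s)" by (simp add: power_mult_distrib[symmetric])
    also have "\<dots> \<le> 2 ^ (8 * s) * (1 / 2) ^ N"
      using \<open>N \<le> 8 * s\<close> by (intro mult_left_mono power_decreasing) auto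
    also have "(1 / 2 :: real) ^ N = (\<Prod>i\<in>J. (1 / 2) ^ nat \<bar>fst (k i)\<bar> * (1 / 2) ^ nat \<bar>snd (k i)\<bar>)"
      by (simp only: N_def power_sum power_add)
    finally show "(1::real) \<le> 2 ^ (8 * s) * (\<Prod>i\<in>J. (1 / 2) ^ nat \<bar>fst (k i)\<bar> * (1 / 2) ^ nat \<bar>snd (k i)\<bar>)" .
  qed
  also have "\<dots> \<le> (\<Sum>k\<in>?K. 2 ^ (8 * s) * (\<Prod>i\<in>J. (1 / 2) ^ nat \<bar>fst (k i)\<bar> * (1 / 2) ^ nat \<bar>snd (k i)\<bar>))"
    using finK by (intro sum_mono2 mult_nonneg_nonneg prod_nonneg ballI) auto
  also have "\<dots> = 2 ^ (8 * s) * (\<Prod>i\<in>J. \<Sum>k\<in>?I \<times> ?I. (1 / 2) ^ nat \<bar>fst k\<bar> * (1 / 2) ^ nat \<bar>snd k\<bar>)"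
    unfolding sum_distrib_left[symmetric] using assms by (subst prod_sum_PiE) auto
  also have "(\<Sum>k\<in>?I \<times> ?I. (1 / 2 :: real) ^ nat \<bar>fst k\<bar> * (1 / 2) ^ nat \<bar>snd k\<bar>) =
      (\<Sum>a\<in>?I. (1 / 2) ^ nat \<bar>a\<bar>) * (\<Sum>a\<in>?I. (1 / 2) ^ nat \<bar>a\<bar>)"
    by (simp add: sum_product sum.cartesian_product split_beta)
  also have "2 ^ (8 * s) * (\<Prod>i\<in>J. (\<Sum>a\<in>?I. (1 / 2 :: real) ^ nat \<bar>a\<bar>) * (\<Sum>a\<in>?I. (1 / 2) ^ nat \<bar>a\<bar>)) \<le>
      2 ^ (8 * s) * (\<Prod>i\<in>J. 3 * 3)"
  proof (intro mult_left_mono prod_mono conjI)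
    have "(\<Sum>a\<in>?I. (1 / 2 :: real) ^ nat \<bar>a\<bar>) \<le> 3"
      by (rule order_trans[OF sum_half_powers_le]) simp
    thus "(\<Sum>a\<in>?I. (1 / 2 :: real) ^ nat \<bar>a\<bar>) * (\<Sum>a\<in>?I. (1 / 2) ^ nat \<bar>a\<bar>) \<le> 3 * 3"
      by (intro mult_mono sum_nonneg) auto
  qed (auto intro!: mult_nonneg_nonneg sum_nonneg)
  \<comment> \<open>2304 = 2^8 * 9: the weight per element of \<open>J\<close> times two geometric
    sums of at most 3.\<close>
  also have "\<dots> = real (2304 ^ s)" using assms by (simp add: power_mult power_mult_distrib[symmetric])
  finally show "card (grid J s) \<le> 2304 ^ s" by (simp only: of_nat_le_iff)
qed

lemma finite_net: "finite (net n s)"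
  using finite_card_grid finite_subset[of _ "{..<n}"] by (auto simp: net_def)

text \<open>The 2304^s <= exp (12 s) lattice points on a support are absorbed in the count of
  supports because the logarithm is at least 1; hence 13 = 1 + 12.\<close>

lemma card_net_le:
  assumes "1 \<le> s" "s \<le> n"
  shows "real (card (net n s)) \<le> exp (13 * real s * ln (exp 1 * n / s))"
proof -
  let ?\<J> = "{J. J \<subseteq> {..<n} \<and> card J = s}"
  have "card (net n s) \<le> card (\<Union>J\<in>?\<J>. grid J s)"
    unfolding net_def using finite_card_grid finite_subset[of _ "{..<n}"] by (intro card_mono) auto
  also have "\<dots> \<le> (\<Sum>J\<in>?\<J>. card (grid J s))" by (rule card_UN_le) simp
  also have "\<dots> \<le> (\<Sum>J\<in>?\<J>. 2304 ^ s)"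
    using finite_card_grid finite_subset[of _ "{..<n}"] by (intro sum_mono) auto
  also have "\<dots> = (n choose s) * 2304 ^ s" using n_subsets[of "{..<n}" s] by simp
  finally have "real (card (net n s)) \<le> real ((n choose s) * 2304 ^ s)" by (simp only: of_nat_le_iff)
  also have "\<dots> = real (n choose s) * 2304 ^ s" by simp
  also have "\<dots> \<le> exp (s * ln (exp 1 * n / s)) * exp (12 * s)"
  proof (intro mult_mono binomial_le_exp assms)
    have "(2::real) ^ 12 \<le> exp 1 ^ 12" using exp_ge_add_one_self[of 1] by (intro power_mono) auto
    hence "(2304::real) \<le> exp 12" by (simp flip: exp_of_nat_mult)
    hence "(2304::real) ^ s \<le> exp 12 ^ s" by (intro power_mono) auto
    thus "(2304::real) ^ s \<le> exp (12 * s)" by (simp add: exp_of_nat_mult[symmetric] mult.commute)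
  qed auto
  also have "\<dots> \<le> exp (13 * real s * ln (exp 1 * n / s))"
  proof -
    have "exp 1 * 1 \<le> exp 1 * (real n / s)" using assms by (intro mult_left_mono) auto
    hence "1 \<le> ln (exp 1 * real n / s)" using assms by (subst ln_ge_iff) auto
    hence "12 * real s * 1 \<le> 12 * real s * ln (exp 1 * real n / s)" by (intro mult_left_mono) auto
    thus ?thesis unfolding exp_add[symmetric] by simp
  qed
  finally show ?thesis .
qed

text \<open>Coordinates are scaled by R = sqrt (8 s) and truncated towards zero. Truncation does not
  increase magnitudes, so \<open>p\<close> stays in the unit ball; an integer is bounded in
  magnitude by its square, so the total is at most R^2 = 8 s; and each of the 2 s real coordinates
  moves by at most 1 / R, giving squared error at most 2 s / (8 s) = 1/4.\<close>

lemma grid_approximates: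
  assumes J: "J \<subseteq> {..<n}" "card J = s" "1 \<le> s" and x: "nrm J x = 1"
  shows "\<exists>p\<in>net n s. (\<forall>i. i \<notin> J \<longrightarrow> p i = 0) \<and> nrm J (\<lambda>i. x i - p i) \<le> 1 / 2"
proof -
  have finJ: "finite J" using J finite_subset by blast
  define R where "R = sqrt (8 * real s)"
  have R: "R > 0" "R\<^sup>2 = 8 * s" using J by (auto simp: R_def)
  define tr where "tr t = (if 0 \<le> t then \<lfloor>t\<rfloor> else \<lceil>t\<rceil>)" for t :: real
  have tr_le: "\<bar>of_int (tr t)\<bar> \<le> \<bar>t\<bar>" for t by (auto simp: tr_def)
  have tr_near: "\<bar>t - of_int (tr t)\<bar> \<le> 1" for t by (auto simp: tr_def) linarith+
  define k where "k = (\<lambda>i\<in>J. (tr (R * Re (x i)), tr (R * Im (x i))))"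
  define p where "p = (\<lambda>i. if i \<in> J then of_real (1 / sqrt (8 * s)) * Complex (of_int (fst (k i))) (of_int (snd (k i))) else 0)"
  have p: "p i = Complex (of_int (tr (R * Re (x i))) / R) (of_int (tr (R * Im (x i))) / R)" if "i \<in> J" for i
    using that by (simp add: p_def k_def R_def[symmetric] complex_eq_iff)
  have ent: "\<bar>fst (k i)\<bar> + \<bar>snd (k i)\<bar> \<le> (fst (k i))\<^sup>2 + (snd (k i))\<^sup>2" for i
  proof -
    have "\<bar>a\<bar> \<le> a\<^sup>2" for a :: int
      using mult_left_mono[of 1 "\<bar>a\<bar>" "\<bar>a\<bar>"] by (cases "a = 0") (auto simp: power2_eq_square)
    thus ?thesis by (intro add_mono)
  qed
  have sq_le: "of_int ((fst (k i))\<^sup>2 + (snd (k i))\<^sup>2) \<le> R\<^sup>2 * (cmod (x i))\<^sup>2" if "i \<in> J" for i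
  proof -
    have "(of_int (tr (R * Re (x i))))\<^sup>2 \<le> (R * Re (x i))\<^sup>2" "(of_int (tr (R * Im (x i))))\<^sup>2 \<le> (R * Im (x i))\<^sup>2"
      using tr_le by (simp_all add: abs_le_square_iff)
    thus ?thesis using that by (simp add: k_def cmod_power2 power_mult_distrib algebra_simps)
  qed
  have sum_le: "(\<Sum>i\<in>J. \<bar>fst (k i)\<bar> + \<bar>snd (k i)\<bar>) \<le> int (8 * s)"
  proof -
    have "real_of_int (\<Sum>i\<in>J. \<bar>fst (k i)\<bar> + \<bar>snd (k i)\<bar>) \<le> of_int (\<Sum>i\<in>J. (fst (k i))\<^sup>2 + (snd (k i))\<^sup>2)"
      unfolding of_int_le_iff by (rule sum_mono[OF ent])
    also have "\<dots> \<le> (\<Sum>i\<in>J. R\<^sup>2 * (cmod (x i))\<^sup>2)" unfolding of_int_sum by (rule sum_mono[OF sq_le])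
    also have "\<dots> = R\<^sup>2" using x by (simp add: sum_distrib_left[symmetric] nrm_sq[symmetric])
    also have "\<dots> = of_int (int (8 * s))" by (simp add: R)
    finally show ?thesis by (simp only: of_int_le_iff)
  qed
  have kK: "k \<in> PiE J (\<lambda>_. {- int (8 * s)..int (8 * s)} \<times> {- int (8 * s)..int (8 * s)})"
  proof (rule PiE_I)
    fix i assume i: "i \<in> J"
    have "\<bar>fst (k i)\<bar> + \<bar>snd (k i)\<bar> \<le> int (8 * s)"
      using member_le_sum[of i J "\<lambda>i. \<bar>fst (k i)\<bar> + \<bar>snd (k i)\<bar>"] i finJ sum_le by auto
    thus "k i \<in> {- int (8 * s)..int (8 * s)} \<times> {- int (8 * s)..int (8 * s)}"
      unfolding mem_Times_iff atLeastAtMost_iff by linarith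
  qed (simp add: k_def)
  have "p \<in> grid J s" unfolding grid_def p_def using kK sum_le by (intro image_eqI[of _ _ k]) auto
  moreover have "nrm {..<n} p \<le> 1"
  proof -
    have "nrm {..<n} p = nrm J p" using J by (intro nrm_eq_of_zero) (auto simp: p_def)
    also have "\<dots> \<le> nrm J x"
      unfolding nrm_def
    proof (rule L2_set_mono)
      fix i assume i: "i \<in> J"
      have "(cmod (p i))\<^sup>2 = of_int ((fst (k i))\<^sup>2 + (snd (k i))\<^sup>2) / R\<^sup>2"
        using i by (simp add: p k_def cmod_power2 power_divide add_divide_distrib)
      also have "\<dots> \<le> (cmod (x i))\<^sup>2" using sq_le[OF i] R(1) by (simp add: divide_le_eq mult.commute)
      finally show "cmod (p i) \<le> cmod (x i)" by (rule power2_le_imp_le) simp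
    qed auto
    finally show ?thesis using x by simp
  qed
  ultimately have "p \<in> net n s" using J by (auto simp: net_def)
  moreover have "nrm J (\<lambda>i. x i - p i) \<le> 1 / 2"
  proof -
    have "(nrm J (\<lambda>i. x i - p i))\<^sup>2 \<le> real (card J) * (2 / R\<^sup>2)"
      unfolding nrm_sq
    proof (rule sum_bounded_above)
      fix i assume i: "i \<in> J"
      have sq: "(a - of_int (tr (R * a)) / R)\<^sup>2 \<le> 1 / R\<^sup>2" for a
      proof -
        have "a - of_int (tr (R * a)) / R = (R * a - of_int (tr (R * a))) / R"
          using R(1) by (simp add: diff_divide_distrib)
        hence "(a - of_int (tr (R * a)) / R)\<^sup>2 = (R * a - of_int (tr (R * a)))\<^sup>2 / R\<^sup>2"
          by (simp only: power_divide)
        also have "\<dots> \<le> 1\<^sup>2 / R\<^sup>2"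
          using tr_near[of "R * a"] by (intro divide_right_mono) (simp_all add: abs_square_le_1)
        finally show ?thesis by simp
      qed
      show "(cmod (x i - p i))\<^sup>2 \<le> 2 / R\<^sup>2"
        using sq[of "Re (x i)"] sq[of "Im (x i)"] by (simp add: cmod_power2 p[OF i])
    qed
    also have "\<dots> = (1 / 2)\<^sup>2" using J R by (simp add: power2_eq_square)
    finally show ?thesis by (rule power2_le_imp_le) simp
  qed
  ultimately show ?thesis by (intro bexI[of _ p]) (auto simp: p_def)
qed

section \<open>From the net to all sparse vectors\<close>

lemma net_norm_le: "p \<in> net n s \<Longrightarrow> nrm {..<n} p \<le> 1"
  by (simp add: net_def)

text \<open>
  A linear functional attains its norm on the vectors supported in \<open>J\<close> at the conjugate of its
  coefficient vector, so approximating that single vector suffices.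
\<close>

lemma functional_bound_on_support:
  assumes J: "J \<subseteq> {..<n}" "card J = s" "1 \<le> s" and B: "0 \<le> B"
    and bound: "\<And>p. p \<in> net n s \<Longrightarrow> cmod (\<Sum>i<n. a i * p i) \<le> B"
  shows "nrm J a \<le> 2 * B"
proof (cases "nrm J a = 0")
  case False
  define t where "t = nrm J a"
  have t: "t > 0" using False nrm_nonneg[of J a] unfolding t_def by linarith
  define x where "x = (\<lambda>i. of_real (1 / t) * cnj (a i))"
  have x1: "nrm J x = 1"
  proof -
    have "nrm J (\<lambda>i. cnj (a i)) = t" by (simp add: t_def nrm_def)
    thus ?thesis unfolding x_def nrm_scale using t by (simp add: norm_divide)
  qed
  obtain p where p: "p \<in> net n s" "\<And>i. i \<notin> J \<Longrightarrow> p i = 0" "nrm J (\<lambda>i. x i - p i) \<le> 1 / 2"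
    using grid_approximates[OF J x1] by blast
  have finJ: "finite J" using J finite_subset by blast
  have "(\<Sum>i<n. a i * p i) = (\<Sum>i\<in>J. a i * p i)"
    using J p(2) by (intro sum.mono_neutral_right) auto
  also have "\<dots> = (\<Sum>i\<in>J. a i * x i) - (\<Sum>i\<in>J. a i * (x i - p i))"
    by (simp add: sum_subtractf algebra_simps)
  also have "(\<Sum>i\<in>J. a i * x i) = of_real (t\<^sup>2) / of_real t"
    unfolding t_def nrm_sq of_real_sum complex_norm_square sum_divide_distrib
    by (simp add: x_def t_def[symmetric] field_simps)
  also have "\<dots> = of_real t" using t by (simp add: power2_eq_square)
  finally have "cmod (of_real t - (\<Sum>i\<in>J. a i * (x i - p i))) \<le> B" using bound[OF p(1)] by simp
  moreover have "t - cmod (\<Sum>i\<in>J. a i * (x i - p i)) \<le> cmod (of_real t - (\<Sum>i\<in>J. a i * (x i - p i)))"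
    using norm_triangle_ineq2[of "of_real t" "\<Sum>i\<in>J. a i * (x i - p i)"] t by simp
  moreover have "cmod (\<Sum>i\<in>J. a i * (x i - p i)) \<le> t * (1 / 2)"
  proof -
    have "cmod (\<Sum>i\<in>J. a i * (x i - p i)) \<le> (\<Sum>i\<in>J. \<bar>cmod (a i)\<bar> * \<bar>cmod (x i - p i)\<bar>)"
      by (rule order_trans[OF norm_sum]) (simp add: norm_mult)
    also have "\<dots> \<le> nrm J a * nrm J (\<lambda>i. x i - p i)" unfolding nrm_def by (rule L2_set_mult_ineq)
    also have "\<dots> \<le> t * (1 / 2)" using p(3) t by (intro mult_mono) (auto simp: t_def)
    finally show ?thesis .
  qed
  ultimately show ?thesis by (simp add: t_def)
qed (use B in simp)

text \<open>The isometry is wanted at level 3 s, whereas net points live on supports of size exactly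
  \<open>s\<close>: hence three pieces, each padded to that size.\<close>

lemma split_support:
  assumes "S \<subseteq> {..<n}" "card S \<le> 3 * s" "s \<le> n"
  shows "\<exists>J1 J2 J3. S \<subseteq> J1 \<union> J2 \<union> J3 \<and> (\<forall>J\<in>{J1, J2, J3}. J \<subseteq> {..<n} \<and> card J = s)"
proof -
  have fin: "finite S" using assms finite_subset by blast
  have part: "\<exists>T\<subseteq>S'. card T \<le> s \<and> card (S' - T) \<le> card S' - s" if "S' \<subseteq> S" for S'
  proof (cases "card S' \<le> s")
    case False
    then obtain T where T: "T \<subseteq> S'" "card T = s" using obtain_subset_with_card_n[of s S'] by auto
    have finS': "finite S'" using that fin finite_subset by blast
    have "card (S' - T) = card S' - s" using T finite_subset[OF T(1) finS'] by (simp add: card_Diff_subset)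
    thus ?thesis using T by auto
  qed (intro exI[of _ S'], simp)
  have extend: "\<exists>J. T \<subseteq> J \<and> J \<subseteq> {..<n} \<and> card J = s" if "T \<subseteq> S" "card T \<le> s" for T
  proof -
    have "T \<subseteq> {..<n}" using that(1) assms(1) by (rule subset_trans)
    thus ?thesis using exists_subset_between[of T s "{..<n}"] that(2) assms(3) by force
  qed
  obtain T1 where T1: "T1 \<subseteq> S" "card T1 \<le> s" "card (S - T1) \<le> card S - s" using part[of S] by blast
  obtain T2 where T2: "T2 \<subseteq> S - T1" "card T2 \<le> s" "card (S - T1 - T2) \<le> card (S - T1) - s"
    using part[of "S - T1"] by blast
  have T3: "card (S - T1 - T2) \<le> s" using T1(3) T2(3) assms(2) by linarith
  obtain J1 where J1: "T1 \<subseteq> J1" "J1 \<subseteq> {..<n}" "card J1 = s" using extend[OF T1(1,2)] by blast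
  have "T2 \<subseteq> S" using T2(1) by blast
  then obtain J2 where J2: "T2 \<subseteq> J2" "J2 \<subseteq> {..<n}" "card J2 = s" using extend[OF _ T2(2)] by blast
  have "S - T1 - T2 \<subseteq> S" by blast
  then obtain J3 where J3: "S - T1 - T2 \<subseteq> J3" "J3 \<subseteq> {..<n}" "card J3 = s" using extend[OF _ T3] by blast
  have "S \<subseteq> J1 \<union> J2 \<union> J3" using J1(1) J2(1) J3(1) by blast
  thus ?thesis using J1 J2 J3 by (intro exI[of _ J1] exI[of _ J2] exI[of _ J3]) simp
qed

text \<open>Each of three pieces covering the support of \<open>x\<close> contributes 2 B to the
  norm of the coefficient vector.\<close>

lemma functional_bound:
  assumes s: "1 \<le> s" "s \<le> n" and B: "0 \<le> B"
    and f: "\<And>x. f x = (\<Sum>i<n. a i * x i)"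
    and bound: "\<And>p. p \<in> net n s \<Longrightarrow> cmod (f p) \<le> B" and x: "sparse n (3 * s) x"
  shows "cmod (f x) \<le> 6 * B * nrm {..<n} x"
proof -
  define S where "S = {i. i < n \<and> x i \<noteq> 0}"
  have S: "S \<subseteq> {..<n}" "card S \<le> 3 * s" using x by (auto simp: S_def sparse_def)
  then obtain J1 J2 J3 where J: "S \<subseteq> J1 \<union> J2 \<union> J3"
    "\<And>J. J \<in> {J1, J2, J3} \<Longrightarrow> J \<subseteq> {..<n} \<and> card J = s"
    using split_support[OF S s(2)] by metis
  have nJ: "nrm J a \<le> 2 * B" "finite J" if "J \<in> {J1, J2, J3}" for J
    using functional_bound_on_support[of J n s B a] J(2)[OF that] s(1) B bound finite_subset[of J "{..<n}"]
    by (auto simp: f)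
  have "nrm S a \<le> nrm (J1 \<union> J2 \<union> J3) a" using J nJ(2) by (intro nrm_mono) auto
  also have "\<dots> \<le> nrm J1 a + nrm J2 a + nrm J3 a"
    using nrm_Un[of "J1 \<union> J2" J3 a] nrm_Un[of J1 J2 a] nJ(2) by simp
  also have "\<dots> \<le> 6 * B" using nJ(1)[of J1] nJ(1)[of J2] nJ(1)[of J3] by simp
  finally have aS: "nrm S a \<le> 6 * B" .
  have "f x = (\<Sum>i\<in>S. a i * x i)"
    unfolding f by (intro sum.mono_neutral_right) (auto simp: S_def)
  hence "cmod (f x) \<le> (\<Sum>i\<in>S. \<bar>cmod (a i)\<bar> * \<bar>cmod (x i)\<bar>)"
    by (simp add: order_trans[OF norm_sum] norm_mult)
  also have "\<dots> \<le> nrm S a * nrm S x" unfolding nrm_def by (rule L2_set_mult_ineq)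
  also have "\<dots> \<le> 6 * B * nrm {..<n} x"
    using aS B S(1) by (intro mult_mono nrm_mono) auto
  finally show ?thesis .
qed

text \<open>The deviation \<open>T\<close> is linear in \<open>x'\<close> and \<open>y\<close> and
  conjugate linear in \<open>x\<close> and \<open>y'\<close>. Each argument is freed from the net at
  the price of a factor 6, in total 6^4 = 1296; the conjugate linear arguments are reached through
  \<open>T_sym\<close>.\<close>

lemma bilinear_rip_from_net:
  assumes s: "1 \<le> s1" "s1 \<le> n1" "1 \<le> s2" "s2 \<le> n2" and B: "0 \<le> B"
    and bound: "\<And>p p' q q'. p \<in> net n1 s1 \<Longrightarrow> p' \<in> net n1 s1 \<Longrightarrow> q \<in> net n2 s2 \<Longrightarrow> q' \<in> net n2 s2 \<Longrightarrow>
      cmod (ip m (bil n1 n2 M p q) (bil n1 n2 M p' q') - ip n1 p p' * ip n2 q' q) \<le> B"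
  shows "bilinear_rip (1296 * B) n1 n2 m (3 * s1) (3 * s2) M"
proof -
  define T where "T x x' y y' = ip m (bil n1 n2 M x y) (bil n1 n2 M x' y') - ip n1 x x' * ip n2 y' y" for x x' y y'
  have T_sym: "cmod (T x x' y y') = cmod (T x' x y' y)" for x x' y y'
  proof -
    have "T x x' y y' = cnj (T x' x y' y)" by (simp add: T_def ip_cnj)
    thus ?thesis by simp
  qed
  have lin_x: "T x x' y y' = (\<Sum>i<n1. ((\<Sum>l<m. cnj (bil n1 n2 M x y l) * (\<Sum>j<n2. cnj (M l $$ (i, j)) * cnj (y' j))) -
      cnj (x i) * ip n2 y' y) * x' i)" for x x' y y'
  proof -
    have "bil n1 n2 M x' y' l = (\<Sum>i<n1. (\<Sum>j<n2. cnj (M l $$ (i, j)) * cnj (y' j)) * x' i)" for l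
      by (simp add: bil_def sum_distrib_left sum_distrib_right mult_ac)
    hence e1: "ip m (bil n1 n2 M x y) (bil n1 n2 M x' y') =
        (\<Sum>i<n1. (\<Sum>l<m. cnj (bil n1 n2 M x y l) * (\<Sum>j<n2. cnj (M l $$ (i, j)) * cnj (y' j))) * x' i)"
      unfolding ip_def by (simp only: sum_distrib_left sum_distrib_right mult.assoc) (rule sum.swap)
    have e2: "ip n1 x x' * ip n2 y' y = (\<Sum>i<n1. cnj (x i) * ip n2 y' y * x' i)"
      by (simp add: ip_def[of n1] sum_distrib_left sum_distrib_right mult_ac)
    show ?thesis unfolding T_def e1 e2 by (simp only: left_diff_distrib sum_subtractf)
  qed
  have lin_y: "T x x' y y' = (\<Sum>j<n2. ((\<Sum>l<m. (\<Sum>i<n1. M l $$ (i, j) * cnj (x i)) * bil n1 n2 M x' y' l) -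
      ip n1 x x' * cnj (y' j)) * y j)" for x x' y y'
  proof -
    have "cnj (bil n1 n2 M x y l) = (\<Sum>j<n2. (\<Sum>i<n1. M l $$ (i, j) * cnj (x i)) * y j)" for l
      unfolding bil_def by (subst sum.swap) (simp add: sum_distrib_left sum_distrib_right mult_ac)
    hence "ip m (bil n1 n2 M x y) (bil n1 n2 M x' y') =
        (\<Sum>l<m. \<Sum>j<n2. (\<Sum>i<n1. M l $$ (i, j) * cnj (x i)) * bil n1 n2 M x' y' l * y j)"
      unfolding ip_def by (simp add: sum_distrib_right sum_distrib_left mult_ac)
    also have "\<dots> = (\<Sum>j<n2. (\<Sum>l<m. (\<Sum>i<n1. M l $$ (i, j) * cnj (x i)) * bil n1 n2 M x' y' l) * y j)"
      by (subst sum.swap) (simp only: sum_distrib_right)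
    finally have e1: "ip m (bil n1 n2 M x y) (bil n1 n2 M x' y') = \<dots>" .
    have e2: "ip n1 x x' * ip n2 y' y = (\<Sum>j<n2. ip n1 x x' * cnj (y' j) * y j)"
      by (simp add: ip_def[of n2] sum_distrib_left mult_ac)
    show ?thesis unfolding T_def e1 e2 by (simp only: left_diff_distrib sum_subtractf)
  qed
  note fb1 = functional_bound[OF s(1,2) _ lin_x] and fb2 = functional_bound[OF s(3,4) _ lin_y]
  have 1: "cmod (T p x' q q') \<le> 6 * B * nrm {..<n1} x'"
    if "p \<in> net n1 s1" "q \<in> net n2 s2" "q' \<in> net n2 s2" "sparse n1 (3 * s1) x'" for p x' q q'
    using bound that by (intro fb1 B) (auto simp: T_def)
  have 2: "cmod (T x x' q q') \<le> 6 * (6 * B * nrm {..<n1} x') * nrm {..<n1} x"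
    if "q \<in> net n2 s2" "q' \<in> net n2 s2" "sparse n1 (3 * s1) x'" "sparse n1 (3 * s1) x" for x x' q q'
    unfolding T_sym[of x] using 1[of _ q q'] that B by (intro fb1) (auto simp: T_sym[of x'])
  have 3: "cmod (T x x' y q') \<le> 6 * (6 * (6 * B * nrm {..<n1} x') * nrm {..<n1} x) * nrm {..<n2} y"
    if "q' \<in> net n2 s2" "sparse n1 (3 * s1) x'" "sparse n1 (3 * s1) x" "sparse n2 (3 * s2) y" for x x' y q'
    using 2[of _ q'] that B by (intro fb2) auto
  have 4: "cmod (T x x' y y') \<le> 6 * (6 * (6 * (6 * B * nrm {..<n1} x') * nrm {..<n1} x) * nrm {..<n2} y) * nrm {..<n2} y'"
    if "sparse n1 (3 * s1) x'" "sparse n1 (3 * s1) x" "sparse n2 (3 * s2) y" "sparse n2 (3 * s2) y'" for x x' y y'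
    unfolding T_sym[of x] using 3[of _ x' x y] that B by (intro fb2) (auto simp: T_sym[of x'])
  show ?thesis
    unfolding bilinear_rip_def
  proof (intro allI impI)
    fix x x' y y'
    assume "sparse n1 (3 * s1) x" "sparse n1 (3 * s1) x'" "sparse n2 (3 * s2) y" "sparse n2 (3 * s2) y'"
    from 4[OF this(2,1,3,4)] show "cmod (ip m (bil n1 n2 M x y) (bil n1 n2 M x' y') - ip n1 x x' * ip n2 y' y) \<le>
        1296 * B * nrm {..<n1} x * nrm {..<n1} x' * nrm {..<n2} y * nrm {..<n2} y'"
      by (simp add: T_def mult_ac)
  qed
qed

lemma polarization:
  fixes x y :: "'a \<Rightarrow> complex"
  shows "4 * (\<Sum>i\<in>I. cnj (x i) * y i) = (\<Sum>c\<in>{1, -1, \<i>, -\<i>}. cnj c * of_real ((nrm I (\<lambda>i. x i + c * y i))\<^sup>2))"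
proof -
  have "4 * (cnj a * b) = (\<Sum>c\<in>{1, -1, \<i>, -\<i>}. cnj c * of_real ((cmod (a + c * b))\<^sup>2))" for a b :: complex
    unfolding complex_norm_square by (simp add: complex_eq_iff algebra_simps)
  thus ?thesis
    unfolding nrm_sq of_real_sum sum_distrib_left by (subst sum.swap) (simp only:)
qed

section \<open>Gaussian concentration\<close>

text \<open>The weight exp (\<theta> x^2) turns the normal density into 1 / r times the normal
  density with standard deviation \<sigma> / r.\<close>

lemma normal_square_mgf:
  assumes X: "distributed M lborel X (normal_density 0 \<sigma>)" and \<sigma>: "0 < \<sigma>" and \<theta>: "2 * \<theta> * \<sigma>\<^sup>2 < 1"
  shows "(\<integral>\<^sup>+\<omega>. ennreal (exp (\<theta> * (X \<omega>)\<^sup>2)) \<partial>M) = ennreal (1 / sqrt (1 - 2 * \<theta> * \<sigma>\<^sup>2))"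
proof -
  define r where "r = sqrt (1 - 2 * \<theta> * \<sigma>\<^sup>2)"
  define \<tau> where "\<tau> = \<sigma> / r"
  have r: "r > 0" "r\<^sup>2 = 1 - 2 * \<theta> * \<sigma>\<^sup>2" using \<theta> by (simp_all add: r_def)
  have \<tau>: "\<tau> > 0" using \<sigma> r by (simp add: \<tau>_def)
  interpret N: prob_space "density lborel (normal_density 0 \<tau>)" by (rule prob_space_normal_density[OF \<tau>])
  have total: "(\<integral>\<^sup>+x. ennreal (normal_density 0 \<tau> x) \<partial>lborel) = 1"
    using N.emeasure_space_1 by (simp add: emeasure_density)
  have eq: "normal_density 0 \<sigma> x * exp (\<theta> * x\<^sup>2) = 1 / r * normal_density 0 \<tau> x" for x
  proof -
    have "- x\<^sup>2 / (2 * \<sigma>\<^sup>2) + \<theta> * x\<^sup>2 = - x\<^sup>2 / (2 * \<tau>\<^sup>2)"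
    proof -
      have "- x\<^sup>2 / (2 * \<tau>\<^sup>2) = - x\<^sup>2 * r\<^sup>2 / (2 * \<sigma>\<^sup>2)" by (simp add: \<tau>_def power_divide)
      also have "\<dots> = - x\<^sup>2 / (2 * \<sigma>\<^sup>2) + \<theta> * x\<^sup>2" unfolding r(2) using \<sigma> by (simp add: field_simps)
      finally show ?thesis by simp
    qed
    moreover have "sqrt (2 * pi * \<tau>\<^sup>2) = sqrt (2 * pi * \<sigma>\<^sup>2) / r"
    proof -
      have "2 * pi * \<tau>\<^sup>2 = 2 * pi * \<sigma>\<^sup>2 / r\<^sup>2" by (simp add: \<tau>_def power_divide)
      moreover have "sqrt (r\<^sup>2) = r" using r(1) by (simp only: real_sqrt_abs abs_of_pos)
      ultimately show ?thesis by (simp only: real_sqrt_divide)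
    qed
    ultimately show ?thesis using r by (simp add: normal_density_def exp_add[symmetric])
  qed
  have "(\<integral>\<^sup>+\<omega>. ennreal (exp (\<theta> * (X \<omega>)\<^sup>2)) \<partial>M) =
      (\<integral>\<^sup>+x. ennreal (normal_density 0 \<sigma> x) * ennreal (exp (\<theta> * x\<^sup>2)) \<partial>lborel)"
    by (rule distributed_nn_integral[OF X, symmetric]) simp
  also have "\<dots> = (\<integral>\<^sup>+x. ennreal (1 / r) * ennreal (normal_density 0 \<tau> x) \<partial>lborel)"
    using r by (intro nn_integral_cong) (simp add: ennreal_mult'[symmetric] eq)
  also have "\<dots> = ennreal (1 / r)" by (subst nn_integral_cmult) (simp_all add: total)
  finally show ?thesis by (simp add: r_def)
qed

context prob_space
begin

text \<open>Markov's inequality for the exponential of \<theta> times the sum of squares. The sign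
  of \<theta> is free, so negative values give the lower tail.\<close>

lemma chi_square_chernoff:
  fixes X :: "nat \<Rightarrow> 'a \<Rightarrow> real"
  assumes ind: "indep_vars (\<lambda>_. borel) X {..<m}"
    and X: "\<And>l. l < m \<Longrightarrow> distributed M lborel (X l) (normal_density 0 \<sigma>)"
    and \<sigma>: "0 < \<sigma>" and \<theta>: "2 * \<theta> * \<sigma>\<^sup>2 < 1"
  shows "prob {\<omega> \<in> space M. c \<le> \<theta> * (\<Sum>l<m. (X l \<omega>)\<^sup>2)} \<le> exp (- c) * (1 / sqrt (1 - 2 * \<theta> * \<sigma>\<^sup>2)) ^ m"
proof -
  have rv: "X l \<in> borel_measurable M" if "l < m" for l using ind that by (auto simp: indep_vars_def)
  define Y where "Y = (\<lambda>l \<omega>. ennreal (exp (\<theta> * (X l \<omega>)\<^sup>2)))"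
  have indY: "indep_vars (\<lambda>_. borel) Y {..<m}"
    unfolding Y_def by (rule indep_vars_compose2[OF ind, where Y = "\<lambda>_ x. ennreal (exp (\<theta> * x\<^sup>2))"]) simp
  have prod: "ennreal (exp (\<theta> * (\<Sum>l<m. (X l \<omega>)\<^sup>2))) = (\<Prod>l<m. Y l \<omega>)" for \<omega>
    unfolding Y_def by (simp add: sum_distrib_left exp_sum prod_ennreal)
  have "(\<integral>\<^sup>+\<omega>. ennreal (exp (\<theta> * (\<Sum>l<m. (X l \<omega>)\<^sup>2))) \<partial>M) = (\<Prod>l<m. \<integral>\<^sup>+\<omega>. Y l \<omega> \<partial>M)"
    unfolding prod by (rule indep_vars_nn_integral[OF _ indY]) auto
  also have "\<dots> = (\<Prod>l<m. ennreal (1 / sqrt (1 - 2 * \<theta> * \<sigma>\<^sup>2)))"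
    unfolding Y_def by (intro prod.cong refl normal_square_mgf X \<sigma> \<theta>) auto
  also have "\<dots> = ennreal ((1 / sqrt (1 - 2 * \<theta> * \<sigma>\<^sup>2)) ^ m)"
    using \<theta> by (simp add: ennreal_power)
  finally have E: "(\<integral>\<^sup>+\<omega>. ennreal (exp (\<theta> * (\<Sum>l<m. (X l \<omega>)\<^sup>2))) \<partial>M) = ennreal ((1 / sqrt (1 - 2 * \<theta> * \<sigma>\<^sup>2)) ^ m)" .
  have [measurable]: "(\<lambda>\<omega>. \<Sum>l<m. (X l \<omega>)\<^sup>2) \<in> borel_measurable M" using rv by (intro borel_measurable_sum borel_measurable_power) auto
  let ?u = "\<lambda>\<omega>. ennreal (exp (\<theta> * (\<Sum>l<m. (X l \<omega>)\<^sup>2)))"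
  have sets: "{\<omega> \<in> space M. c \<le> \<theta> * (\<Sum>l<m. (X l \<omega>)\<^sup>2)} =
      {\<omega> \<in> space M. 1 \<le> ennreal (exp (- c)) * ?u \<omega>}"
    by (auto simp: ennreal_mult'[symmetric] exp_add[symmetric])
  have "emeasure M {\<omega> \<in> space M. 1 \<le> ennreal (exp (- c)) * ?u \<omega>} \<le>
      ennreal (exp (- c)) * (\<integral>\<^sup>+\<omega>. ?u \<omega> * indicator (space M) \<omega> \<partial>M)"
    by (rule nn_integral_Markov_inequality) auto
  also have "(\<integral>\<^sup>+\<omega>. ?u \<omega> * indicator (space M) \<omega> \<partial>M) = (\<integral>\<^sup>+\<omega>. ?u \<omega> \<partial>M)"
    by (intro nn_integral_cong) simp
  finally have "emeasure M {\<omega> \<in> space M. c \<le> \<theta> * (\<Sum>l<m. (X l \<omega>)\<^sup>2)} \<le>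
      ennreal (exp (- c) * (1 / sqrt (1 - 2 * \<theta> * \<sigma>\<^sup>2)) ^ m)"
    using \<theta> unfolding sets E by (simp add: ennreal_mult')
  thus ?thesis using \<theta> by (simp add: emeasure_eq_measure)
qed

text \<open>The choice \<theta> = t / (8 \<sigma>^2), with either sign, makes 2 \<theta> \<sigma>^2
  equal to t / 4 up to that sign. First-order terms in the exponent cancel; the second-order terms
  leave - t^2 m / 16 for the upper tail and - 3 t^2 m / 32 for the lower one.\<close>

lemma chi_square_concentration:
  fixes X :: "nat \<Rightarrow> 'a \<Rightarrow> real"
  assumes ind: "indep_vars (\<lambda>_. borel) X {..<m}"
    and X: "\<And>l. l < m \<Longrightarrow> distributed M lborel (X l) (normal_density 0 \<sigma>)"
    and \<sigma>: "0 < \<sigma>" and t: "0 < t" "t \<le> 1"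
  shows "prob {\<omega> \<in> space M. t * (m * \<sigma>\<^sup>2) < \<bar>(\<Sum>l<m. (X l \<omega>)\<^sup>2) - m * \<sigma>\<^sup>2\<bar>} \<le> 2 * exp (- (t\<^sup>2 * m / 16))"
proof -
  have rv: "X l \<in> borel_measurable M" if "l < m" for l using ind that by (auto simp: indep_vars_def)
  have [measurable]: "(\<lambda>\<omega>. \<Sum>l<m. (X l \<omega>)\<^sup>2) \<in> borel_measurable M" using rv by (intro borel_measurable_sum borel_measurable_power) auto
  define \<theta> where "\<theta> = t / (8 * \<sigma>\<^sup>2)"
  have \<theta>: "2 * \<theta> * \<sigma>\<^sup>2 = t / 4" "\<theta> > 0" using \<sigma> t by (simp_all add: \<theta>_def)
  let ?S = "\<lambda>\<omega>. \<Sum>l<m. (X l \<omega>)\<^sup>2"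
  let ?U = "{\<omega> \<in> space M. \<theta> * ((1 + t) * (m * \<sigma>\<^sup>2)) \<le> \<theta> * ?S \<omega>}"
  let ?L = "{\<omega> \<in> space M. - \<theta> * ((1 - t) * (m * \<sigma>\<^sup>2)) \<le> - \<theta> * ?S \<omega>}"
  have "{\<omega> \<in> space M. t * (m * \<sigma>\<^sup>2) < \<bar>?S \<omega> - m * \<sigma>\<^sup>2\<bar>} \<subseteq> ?U \<union> ?L"
  proof
    fix \<omega> assume "\<omega> \<in> {\<omega> \<in> space M. t * (m * \<sigma>\<^sup>2) < \<bar>?S \<omega> - m * \<sigma>\<^sup>2\<bar>}"
    hence \<omega>: "\<omega> \<in> space M" "t * (m * \<sigma>\<^sup>2) < \<bar>?S \<omega> - m * \<sigma>\<^sup>2\<bar>" by auto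
    hence "(1 + t) * (m * \<sigma>\<^sup>2) \<le> ?S \<omega> \<or> ?S \<omega> \<le> (1 - t) * (m * \<sigma>\<^sup>2)"
      by (simp only: distrib_right left_diff_distrib) linarith
    thus "\<omega> \<in> ?U \<union> ?L" using \<theta>(2) \<omega>(1) by auto
  qed
  hence "prob {\<omega> \<in> space M. t * (m * \<sigma>\<^sup>2) < \<bar>?S \<omega> - m * \<sigma>\<^sup>2\<bar>} \<le> prob (?U \<union> ?L)"
    by (rule finite_measure_mono) measurable
  also have "\<dots> \<le> prob ?U + prob ?L" by (rule measure_Un_le) measurable
  also have "prob ?U \<le> exp (- (t\<^sup>2 * m / 16))"
  proof -
    have s: "0 < sqrt (1 - t / 4)" using t by simp
    have "prob ?U \<le> exp (- (\<theta> * ((1 + t) * (m * \<sigma>\<^sup>2)))) * (1 / sqrt (1 - t / 4)) ^ m"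
      using chi_square_chernoff[OF ind X \<sigma>, of \<theta> "\<theta> * ((1 + t) * (m * \<sigma>\<^sup>2))"] t unfolding \<theta>(1) by simp
    also have "\<dots> \<le> exp (- (\<theta> * ((1 + t) * (m * \<sigma>\<^sup>2)))) * exp (t / 8 + t\<^sup>2 / 16) ^ m"
    proof -
      have "- (t / 4) - 2 * (t / 4)\<^sup>2 \<le> ln (1 - t / 4)" using t by (intro ln_one_minus_pos_lower_bound) auto
      hence "- (t / 8 + t\<^sup>2 / 16) \<le> ln (sqrt (1 - t / 4))"
        using t by (simp add: ln_sqrt power_divide)
      hence "exp (- (t / 8 + t\<^sup>2 / 16)) \<le> exp (ln (sqrt (1 - t / 4)))" by (simp only: exp_le_cancel_iff)
      hence "exp (- (t / 8 + t\<^sup>2 / 16)) \<le> sqrt (1 - t / 4)" by (simp only: exp_ln[OF s])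
      hence "1 / sqrt (1 - t / 4) \<le> exp (t / 8 + t\<^sup>2 / 16)" using s by (simp only: exp_minus) (simp add: field_simps)
      thus ?thesis using s by (intro mult_left_mono power_mono) auto
    qed
    also have "exp (- (\<theta> * ((1 + t) * (m * \<sigma>\<^sup>2)))) * exp (t / 8 + t\<^sup>2 / 16) ^ m = exp (- (t\<^sup>2 * m / 16))"
    proof -
      have "- (\<theta> * ((1 + t) * (m * \<sigma>\<^sup>2))) + m * (t / 8 + t\<^sup>2 / 16) = - (t\<^sup>2 * m / 16)"
        using \<sigma> by (simp add: \<theta>_def power2_eq_square field_simps)
      thus ?thesis by (simp add: exp_of_nat_mult[symmetric] exp_add[symmetric])
    qed
    finally show ?thesis .
  qed
  also have "prob ?L \<le> exp (- (t\<^sup>2 * m / 16))"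
  proof -
    have s: "0 < sqrt (1 + t / 4)" using t by simp
    have "prob ?L \<le> exp (- (- \<theta> * ((1 - t) * (m * \<sigma>\<^sup>2)))) * (1 / sqrt (1 + t / 4)) ^ m"
    proof -
      have \<theta>': "2 * (- \<theta>) * \<sigma>\<^sup>2 = - (t / 4)" using \<theta>(1) by simp
      show ?thesis
        using chi_square_chernoff[OF ind X \<sigma>, of "- \<theta>" "- \<theta> * ((1 - t) * (m * \<sigma>\<^sup>2))"] t unfolding \<theta>' by simp
    qed
    also have "\<dots> \<le> exp (- (- \<theta> * ((1 - t) * (m * \<sigma>\<^sup>2)))) * exp (- t / 8 + t\<^sup>2 / 32) ^ m"
    proof -
      have "t / 4 - (t / 4)\<^sup>2 \<le> ln (1 + t / 4)" using t by (intro ln_one_plus_pos_lower_bound) auto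
      hence "t / 8 - t\<^sup>2 / 32 \<le> ln (sqrt (1 + t / 4))"
        using t by (simp add: ln_sqrt power_divide)
      hence "exp (t / 8 - t\<^sup>2 / 32) \<le> exp (ln (sqrt (1 + t / 4)))" by (simp only: exp_le_cancel_iff)
      hence "exp (t / 8 - t\<^sup>2 / 32) \<le> sqrt (1 + t / 4)" by (simp only: exp_ln[OF s])
      hence "inverse (sqrt (1 + t / 4)) \<le> inverse (exp (t / 8 - t\<^sup>2 / 32))" by (intro le_imp_inverse_le) auto
      moreover have "exp (- t / 8 + t\<^sup>2 / 32) = inverse (exp (t / 8 - t\<^sup>2 / 32))" by (simp add: exp_minus[symmetric])
      ultimately have "1 / sqrt (1 + t / 4) \<le> exp (- t / 8 + t\<^sup>2 / 32)" by (simp only: inverse_eq_divide)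
      thus ?thesis using s by (intro mult_left_mono power_mono) auto
    qed
    also have "exp (- (- \<theta> * ((1 - t) * (m * \<sigma>\<^sup>2)))) * exp (- t / 8 + t\<^sup>2 / 32) ^ m \<le> exp (- (t\<^sup>2 * m / 16))"
    proof -
      have "- (- \<theta> * ((1 - t) * (m * \<sigma>\<^sup>2))) + m * (- t / 8 + t\<^sup>2 / 32) = - (3 * t\<^sup>2 * m / 32)"
        using \<sigma> by (simp add: \<theta>_def power2_eq_square field_simps)
      also have "\<dots> \<le> - (t\<^sup>2 * m / 16)" by (simp add: field_simps)
      finally show ?thesis unfolding exp_of_nat_mult[symmetric] exp_add[symmetric] exp_le_cancel_iff .
    qed
    finally show ?thesis .
  qed
  finally show ?thesis by simp
qed

end

section \<open>Gaussian linear forms in the matrix entries\<close>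

lemma borel_measurable_real_form: "(\<lambda>w. Re (cnj w * z)) \<in> borel_measurable borel"
  by (intro borel_measurable_continuous_onI continuous_intros)

lemma sum_singleton_times: "(\<Sum>e\<in>{l} \<times> B. f e) = (\<Sum>b\<in>B. f (l, b))"
proof -
  have "{l} \<times> B = Pair l ` B" by auto
  thus ?thesis by (simp add: sum.reindex inj_on_def)
qed

text \<open>In the real and imaginary parts a and b of \<open>w\<close> the form is a Re z + b Im z,
  a combination of independent normals; a nonzero \<open>z\<close> gives it a density.\<close>

lemma complex_gaussian_real_form:
  assumes q: "0 < q" and z: "z \<noteq> 0"
  shows "distributed (complex_gaussian q) lborel (\<lambda>w. Re (cnj w * z)) (normal_density 0 (cmod z * sqrt (q / 2)))"
proof -
  define \<sigma> where "\<sigma> = sqrt (q / 2)"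
  have \<sigma>: "\<sigma> > 0" using q by (simp add: \<sigma>_def)
  define N where "N = density lborel (normal_density 0 \<sigma>)"
  interpret N: prob_space N unfolding N_def by (rule prob_space_normal_density[OF \<sigma>])
  interpret P: pair_prob_space N N ..
  define P where "P = N \<Otimes>\<^sub>M N"
  have setsN: "sets N = sets borel" by (simp add: N_def)
  have sp: "space N = UNIV" by (simp add: N_def)
  have [measurable]: "fst \<in> borel_measurable P" "snd \<in> borel_measurable P"
    unfolding P_def using measurable_fst[of N N] measurable_snd[of N N]
    unfolding measurable_cong_sets[OF refl setsN] .
  have dfst: "distr P borel fst = N"
  proof -
    have "distr P borel fst = distr P N fst" by (rule distr_cong) (simp_all add: setsN)
    thus ?thesis using N.distr_pair_fst[of N] by (simp add: P_def)
  qed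
  have dsnd: "distr P borel snd = N"
  proof (rule measure_eqI)
    fix A assume "A \<in> sets (distr P borel snd)"
    hence A: "A \<in> sets N" "A \<in> sets borel" by (simp_all add: setsN)
    have "emeasure (distr P borel snd) A = emeasure P (snd -` A \<inter> space P)" using A by (simp add: emeasure_distr)
    also have "snd -` A \<inter> space P = space N \<times> A" by (auto simp: P_def space_pair_measure sp)
    also have "emeasure P (space N \<times> A) = emeasure N A"
      unfolding P_def using A by (subst N.emeasure_pair_measure_Times) (auto simp: N.emeasure_space_1)
    finally show "emeasure (distr P borel snd) A = emeasure N A" .
  qed (simp add: setsN)
  have ind: "P.indep_var borel fst borel snd"
    unfolding P.indep_var_distribution_eq unfolding P_def[symmetric]
  proof (intro conjI)
    have "sets P = sets (borel \<Otimes>\<^sub>M borel)" unfolding P_def by (intro sets_pair_measure_cong setsN)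
    hence "distr P (borel \<Otimes>\<^sub>M borel) (\<lambda>x. x) = P" by (intro distr_id2) simp
    thus "distr P borel fst \<Otimes>\<^sub>M distr P borel snd = distr P (borel \<Otimes>\<^sub>M borel) (\<lambda>x. (fst x, snd x))"
      unfolding dfst dsnd prod.collapse by (simp only: P_def)
  qed simp_all
  have df: "distributed P lborel fst (normal_density 0 \<sigma>)" "distributed P lborel snd (normal_density 0 \<sigma>)"
    unfolding distributed_def using dfst dsnd by (auto simp: N_def cong: distr_cong)
  have lin: "distributed P lborel (\<lambda>x. fst x * Re z + snd x * Im z) (normal_density 0 (cmod z * \<sigma>))"
  proof -
    have a: "distributed P lborel (\<lambda>x. fst x * Re z) (normal_density 0 (\<bar>Re z\<bar> * \<sigma>))" if "Re z \<noteq> 0"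
      using P.normal_density_affine[of fst 0 \<sigma> "Re z" 0] df(1) \<sigma> that by (simp add: P_def mult.commute)
    have b: "distributed P lborel (\<lambda>x. snd x * Im z) (normal_density 0 (\<bar>Im z\<bar> * \<sigma>))" if "Im z \<noteq> 0"
      using P.normal_density_affine[of snd 0 \<sigma> "Im z" 0] df(2) \<sigma> that by (simp add: P_def mult.commute)
    \<comment> \<open>A vanishing coefficient leaves a constant summand without a density, so the
      degenerate cases are separated from the sum of two normals.\<close>
    consider "Re z = 0" "Im z \<noteq> 0" | "Im z = 0" "Re z \<noteq> 0" | "Re z \<noteq> 0" "Im z \<noteq> 0"
      using z complex_eq_iff[of z 0] by auto
    thus ?thesis
    proof cases
      case 1
      thus ?thesis using b by (simp add: cmod_def)
    next
      case 2
      thus ?thesis using a by (simp add: cmod_def)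
    next
      case 3
      have i: "P.indep_var borel (\<lambda>x. fst x * Re z) borel (\<lambda>x. snd x * Im z)"
        using P.indep_var_compose[OF ind, of "\<lambda>x. x * Re z" borel "\<lambda>x. x * Im z" borel] by (simp add: comp_def)
      have "sqrt ((\<bar>Re z\<bar> * \<sigma>)\<^sup>2 + (\<bar>Im z\<bar> * \<sigma>)\<^sup>2) = cmod z * \<sigma>"
        using \<sigma> by (simp add: cmod_def power_mult_distrib distrib_right[symmetric] real_sqrt_mult)
      thus ?thesis
        using P.add_indep_normal[OF i, of "\<bar>Re z\<bar> * \<sigma>" "\<bar>Im z\<bar> * \<sigma>" 0 0] a b 3 \<sigma> by (simp add: P_def)
    qed
  qed
  have cg: "complex_gaussian q = distr P borel (\<lambda>(a, b). Complex a b)"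
    by (simp add: complex_gaussian_def P_def N_def \<sigma>_def)
  have Cm [measurable]: "(\<lambda>(a, b). Complex a b) \<in> borel_measurable P"
    unfolding Complex_eq split_beta by measurable
  have "distr (complex_gaussian q) lborel (\<lambda>w. Re (cnj w * z)) =
      distr P lborel ((\<lambda>w. Re (cnj w * z)) \<circ> (\<lambda>(a, b). Complex a b))"
    unfolding cg by (rule distr_distr[OF _ Cm]) (simp add: borel_measurable_real_form del: times_complex.sel)
  also have "(\<lambda>w. Re (cnj w * z)) \<circ> (\<lambda>(a, b). Complex a b) = (\<lambda>x. fst x * Re z + snd x * Im z)"
    by auto
  also have "distr P lborel (\<lambda>x. fst x * Re z + snd x * Im z) = density lborel (normal_density 0 (cmod z * \<sigma>))"
    using lin by (simp add: distributed_def)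
  finally show ?thesis
    using borel_measurable_real_form[of z] by (simp add: distributed_def \<sigma>_def cg del: times_complex.sel)
qed

lemma gaussian_entries_prob_space: "0 < m \<Longrightarrow> prob_space (gaussian_entries n1 n2 m)"
  unfolding gaussian_entries_def by (intro prob_space_PiM prob_space_complex_gaussian) simp

lemma sets_complex_gaussian: "sets (complex_gaussian q) = sets borel"
  by (simp add: complex_gaussian_def)

lemma gaussian_entry_measurable:
  "e \<in> {..<m} \<times> {..<n1} \<times> {..<n2} \<Longrightarrow> (\<lambda>\<omega>. \<omega> e) \<in> borel_measurable (gaussian_entries n1 n2 m)"
  unfolding gaussian_entries_def
  using measurable_component_singleton[of e "{..<m} \<times> {..<n1} \<times> {..<n2}" "\<lambda>_. complex_gaussian (1 / real m)"]
  unfolding measurable_cong_sets[OF refl sets_complex_gaussian] .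

lemma gaussian_entries_indep:
  assumes "0 < m"
  shows "prob_space.indep_vars (gaussian_entries n1 n2 m) (\<lambda>_. complex_gaussian (1 / m)) (\<lambda>e \<omega>. \<omega> e)
    ({..<m} \<times> {..<n1} \<times> {..<n2})"
proof -
  let ?I = "{..<m} \<times> {..<n1} \<times> {..<n2}" and ?M = "gaussian_entries n1 n2 m"
  interpret prob_space ?M by (rule gaussian_entries_prob_space[OF assms])
  have pc: "prob_space (complex_gaussian (1 / m))" using assms by (intro prob_space_complex_gaussian) simp
  show ?thesis
  proof (cases "?I = {}")
    case True
    show ?thesis unfolding True by (simp add: indep_vars_def indep_sets_def)
  next
    case False
    have "distr ?M (PiM ?I (\<lambda>_. complex_gaussian (1 / m))) (\<lambda>\<omega>. \<lambda>e\<in>?I. \<omega> e) = distr ?M ?M (\<lambda>\<omega>. \<omega>)"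
      by (rule distr_cong) (auto simp: gaussian_entries_def space_PiM PiE_restrict)
    also have "\<dots> = PiM ?I (\<lambda>e. complex_gaussian (1 / m))" by (simp add: gaussian_entries_def)
    also have "\<dots> = PiM ?I (\<lambda>e. distr ?M (complex_gaussian (1 / m)) (\<lambda>\<omega>. \<omega> e))"
      unfolding gaussian_entries_def using pc
      by (intro PiM_cong refl distr_PiM_component[symmetric]) auto
    finally show ?thesis
      using False by (subst indep_vars_iff_distr_eq_PiM') (auto simp: gaussian_entries_def)
  qed
qed

text \<open>The measurement with index \<open>l\<close> of an arbitrary matrix \<open>Z\<close>;
  polarization leads beyond rank one.\<close>

definition entry_form ::
  "nat \<Rightarrow> nat \<Rightarrow> (nat \<times> nat \<times> nat \<Rightarrow> complex) \<Rightarrow> (nat \<Rightarrow> nat \<Rightarrow> complex) \<Rightarrow> nat \<Rightarrow> complex" where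
  "entry_form n1 n2 \<omega> Z l = (\<Sum>i<n1. \<Sum>j<n2. cnj (\<omega> (l, i, j)) * Z i j)"

text \<open>Different \<open>l\<close> use disjoint blocks of entries, hence independence. Within a
  block the real part is a sum of independent normals of variances |Z i j|^2 / (2 m).\<close>

lemma entry_form_real_part:
  assumes m: "0 < m" and Z: "0 < (\<Sum>i<n1. \<Sum>j<n2. (cmod (Z i j))\<^sup>2)"
  defines "\<sigma> \<equiv> sqrt ((\<Sum>i<n1. \<Sum>j<n2. (cmod (Z i j))\<^sup>2) / (2 * m))"
  shows "prob_space.indep_vars (gaussian_entries n1 n2 m) (\<lambda>_. borel) (\<lambda>l \<omega>. Re (entry_form n1 n2 \<omega> Z l)) {..<m}"
    and "\<And>l. l < m \<Longrightarrow> distributed (gaussian_entries n1 n2 m) lborel (\<lambda>\<omega>. Re (entry_form n1 n2 \<omega> Z l)) (normal_density 0 \<sigma>)"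
proof -
  let ?M = "gaussian_entries n1 n2 m" and ?I = "{..<m} \<times> {..<n1} \<times> {..<n2}"
  interpret prob_space ?M by (rule gaussian_entries_prob_space[OF m])
  define K where "K l = {l} \<times> {..<n1} \<times> {..<n2}" for l :: nat
  define z where "z e = (case e of (l, i, j) \<Rightarrow> Z i j)" for e :: "nat \<times> nat \<times> nat"
  have form: "Re (entry_form n1 n2 \<omega> Z l) = (\<Sum>e\<in>K l. Re (cnj (\<omega> e) * z e))" for \<omega> l
    unfolding K_def sum_singleton_times sum.cartesian_product' by (simp add: entry_form_def z_def)
  have KI: "K l \<subseteq> ?I" if "l < m" for l using that by (auto simp: K_def)
  have disj: "disjoint_family_on K {..<m}" by (auto simp: disjoint_family_on_def K_def)
  have ind: "indep_vars (\<lambda>_. complex_gaussian (1 / m)) (\<lambda>e \<omega>. \<omega> e) ?I" by (rule gaussian_entries_indep[OF m])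
  have "indep_vars (\<lambda>_. borel) (\<lambda>l \<omega>. \<Sum>e\<in>K l. Re (cnj (restrict (\<lambda>e. \<omega> e) (K l) e) * z e)) {..<m}"
  proof (rule indep_vars_compose2[OF indep_vars_restrict[OF ind KI disj]])
    fix l assume "l \<in> {..<m}"
    show "(\<lambda>x. \<Sum>e\<in>K l. Re (cnj (x e) * z e)) \<in> borel_measurable (Pi\<^sub>M (K l) (\<lambda>_. complex_gaussian (1 / m)))"
    proof (rule borel_measurable_sum)
      fix e assume e: "e \<in> K l"
      have "(\<lambda>x. x e) \<in> borel_measurable (Pi\<^sub>M (K l) (\<lambda>_. complex_gaussian (1 / m)))"
        using measurable_component_singleton[OF e, of "\<lambda>_. complex_gaussian (1 / m)"]
        unfolding measurable_cong_sets[OF refl sets_complex_gaussian] .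
      from measurable_compose[OF this borel_measurable_real_form]
      show "(\<lambda>x. Re (cnj (x e) * z e)) \<in> borel_measurable (Pi\<^sub>M (K l) (\<lambda>_. complex_gaussian (1 / m)))" .
    qed
  qed auto
  thus "indep_vars (\<lambda>_. borel) (\<lambda>l \<omega>. Re (entry_form n1 n2 \<omega> Z l)) {..<m}"
    unfolding form by simp
  fix l assume l: "l < m"
  \<comment> \<open>Entries with coefficient zero contribute nothing but would have no density; the
    hypothesis on \<open>Z\<close> ensures that some entry remains.\<close>
  define K' where "K' = {e \<in> K l. z e \<noteq> 0}"
  have form': "Re (entry_form n1 n2 \<omega> Z l) = (\<Sum>e\<in>K'. Re (cnj (\<omega> e) * z e))" for \<omega>
    unfolding form K'_def by (rule sum.mono_neutral_right) (auto simp: K_def)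
  have sum_z: "(\<Sum>e\<in>K'. (cmod (z e))\<^sup>2) = (\<Sum>i<n1. \<Sum>j<n2. (cmod (Z i j))\<^sup>2)"
  proof -
    have "(\<Sum>e\<in>K'. (cmod (z e))\<^sup>2) = (\<Sum>e\<in>K l. (cmod (z e))\<^sup>2)"
      unfolding K'_def by (rule sum.mono_neutral_left) (auto simp: K_def)
    also have "\<dots> = (\<Sum>i<n1. \<Sum>j<n2. (cmod (Z i j))\<^sup>2)"
      unfolding K_def sum_singleton_times sum.cartesian_product' by (simp add: z_def)
    finally show ?thesis .
  qed
  have "K' \<noteq> {}"
  proof
    assume "K' = {}"
    thus False using sum_z Z by simp
  qed
  hence K': "finite K'" "K' \<noteq> {}" "K' \<subseteq> ?I" using KI[OF l] by (auto simp: K'_def K_def)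
  have ind': "indep_vars (\<lambda>_. borel) (\<lambda>e \<omega>. Re (cnj (\<omega> e) * z e)) K'"
  proof (rule indep_vars_compose2[OF indep_vars_subset[OF ind K'(3)]])
    show "(\<lambda>w. Re (cnj w * z e)) \<in> borel_measurable (complex_gaussian (1 / m))" for e
      unfolding measurable_cong_sets[OF sets_complex_gaussian refl] by (rule borel_measurable_real_form)
  qed
  have dist: "distributed ?M lborel (\<lambda>\<omega>. Re (cnj (\<omega> e) * z e)) (normal_density 0 (cmod (z e) * sqrt (1 / m / 2)))"
    if e: "e \<in> K'" for e
  proof -
    have eI: "e \<in> ?I" and ze: "z e \<noteq> 0" using e K'(3) by (auto simp: K'_def)
    let ?C = "complex_gaussian (1 / m)"
    have pc: "prob_space ?C" using m by (intro prob_space_complex_gaussian) simp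
    have C: "distributed ?C lborel (\<lambda>w. Re (cnj w * z e)) (normal_density 0 (cmod (z e) * sqrt (1 / m / 2)))"
      using m ze by (intro complex_gaussian_real_form) auto
    have comp: "(\<lambda>\<omega>. \<omega> e) \<in> measurable ?M ?C"
      unfolding gaussian_entries_def by (rule measurable_component_singleton[OF eI])
    have dc: "distr ?M ?C (\<lambda>\<omega>. \<omega> e) = ?C"
      unfolding gaussian_entries_def using pc eI by (intro distr_PiM_component) auto
    have "distr ?M lborel ((\<lambda>w. Re (cnj w * z e)) \<circ> (\<lambda>\<omega>. \<omega> e)) = distr (distr ?M ?C (\<lambda>\<omega>. \<omega> e)) lborel (\<lambda>w. Re (cnj w * z e))"
      using C comp by (intro distr_distr[symmetric]) (auto simp: distributed_def)
    thus ?thesis using C measurable_compose[OF comp, of "\<lambda>w. Re (cnj w * z e)" lborel]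
      by (simp add: distributed_def dc comp_def)
  qed
  have "distributed ?M lborel (\<lambda>\<omega>. \<Sum>e\<in>K'. Re (cnj (\<omega> e) * z e))
      (normal_density (\<Sum>e\<in>K'. 0) (sqrt (\<Sum>e\<in>K'. (cmod (z e) * sqrt (1 / m / 2))\<^sup>2)))"
    using dist m by (intro sum_indep_normal[OF K'(1,2) ind']) (auto simp: K'_def)
  moreover have "(\<Sum>e\<in>K'. (cmod (z e) * sqrt (1 / m / 2))\<^sup>2) = (\<Sum>i<n1. \<Sum>j<n2. (cmod (Z i j))\<^sup>2) / (2 * m)"
    unfolding sum_z[symmetric] using m by (simp add: power_mult_distrib sum_divide_distrib mult.commute)
  ultimately show "distributed ?M lborel (\<lambda>\<omega>. Re (entry_form n1 n2 \<omega> Z l)) (normal_density 0 \<sigma>)"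
    unfolding form' by (simp add: \<sigma>_def)
qed

section \<open>Restricted isometry of Gaussian operators\<close>

lemma entry_form_scale: "entry_form n1 n2 \<omega> (\<lambda>i j. c * Z i j) l = c * entry_form n1 n2 \<omega> Z l"
  by (simp add: entry_form_def sum_distrib_left mult_ac)

lemma entry_form_measurable:
  assumes "l < m"
  shows "(\<lambda>\<omega>. entry_form n1 n2 \<omega> Z l) \<in> borel_measurable (gaussian_entries n1 n2 m)"
  unfolding entry_form_def
proof (intro borel_measurable_sum)
  fix i j assume "i \<in> {..<n1}" "j \<in> {..<n2}"
  hence "(\<lambda>\<omega>. \<omega> (l, i, j)) \<in> borel_measurable (gaussian_entries n1 n2 m)"
    using assms by (intro gaussian_entry_measurable) auto
  moreover have "(\<lambda>w. cnj w * Z i j) \<in> borel_measurable borel"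
    by (intro borel_measurable_continuous_onI continuous_intros)
  ultimately show "(\<lambda>\<omega>. cnj (\<omega> (l, i, j)) * Z i j) \<in> borel_measurable (gaussian_entries n1 n2 m)"
    by (rule measurable_compose)
qed

definition deviation_event :: "nat \<Rightarrow> nat \<Rightarrow> nat \<Rightarrow> real \<Rightarrow> (nat \<Rightarrow> nat \<Rightarrow> complex) \<Rightarrow> (nat \<times> nat \<times> nat \<Rightarrow> complex) set" where
  "deviation_event n1 n2 m t Z = {\<omega> \<in> space (gaussian_entries n1 n2 m).
     t * (\<Sum>i<n1. \<Sum>j<n2. (cmod (Z i j))\<^sup>2) < \<bar>(nrm {..<m} (entry_form n1 n2 \<omega> Z))\<^sup>2 - (\<Sum>i<n1. \<Sum>j<n2. (cmod (Z i j))\<^sup>2)\<bar>}"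

lemma deviation_event_sets: "deviation_event n1 n2 m t Z \<in> sets (gaussian_entries n1 n2 m)"
proof -
  have [measurable]: "(\<lambda>\<omega>. \<Sum>l<m. (cmod (entry_form n1 n2 \<omega> Z l))\<^sup>2) \<in> borel_measurable (gaussian_entries n1 n2 m)"
    using entry_form_measurable by (intro borel_measurable_sum borel_measurable_power borel_measurable_norm) auto
  show ?thesis unfolding deviation_event_def nrm_sq by measurable
qed

text \<open>Real and imaginary parts are treated separately, so that their joint law is never needed.\<close>

lemma deviation_event_prob:
  assumes m: "0 < m" and t: "0 < t" "t \<le> 1"
  shows "measure (gaussian_entries n1 n2 m) (deviation_event n1 n2 m t Z) \<le> 4 * exp (- (t\<^sup>2 * m / 16))"
proof -
  let ?M = "gaussian_entries n1 n2 m"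
  define q where "q = (\<Sum>i<n1. \<Sum>j<n2. (cmod (Z i j))\<^sup>2)"
  interpret prob_space ?M by (rule gaussian_entries_prob_space[OF m])
  have q0: "0 \<le> q" by (simp add: q_def sum_nonneg)
  show ?thesis
  proof (cases "q = 0")
    case True
    \<comment> \<open>If \<open>Z\<close> vanishes, so do all its measurements, and the strict
      inequality makes the event empty.\<close>
    hence "\<forall>i\<in>{..<n1}. (\<Sum>j<n2. (cmod (Z i j))\<^sup>2) = 0"
      unfolding q_def by (subst (asm) sum_nonneg_eq_0_iff) (auto simp: sum_nonneg)
    hence "Z i j = 0" if "i < n1" "j < n2" for i j
      using that by (auto simp: sum_nonneg_eq_0_iff)
    hence "entry_form n1 n2 \<omega> Z l = 0" for \<omega> l by (simp add: entry_form_def)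
    hence "deviation_event n1 n2 m t Z = {}"
      using True by (simp add: deviation_event_def nrm_sq q_def[symmetric])
    thus ?thesis by simp
  next
    case False
    define \<sigma> where "\<sigma> = sqrt (q / (2 * m))"
    have \<sigma>: "0 < \<sigma>" "m * \<sigma>\<^sup>2 = q / 2" using False q0 m by (simp_all add: \<sigma>_def)
    \<comment> \<open>Since Re (- \<i> w) = Im w, the imaginary parts are the real parts of the
      measurements of a matrix of the same norm.\<close>
    let ?Z' = "\<lambda>i j. - \<i> * Z i j"
    have q': "(\<Sum>i<n1. \<Sum>j<n2. (cmod (?Z' i j))\<^sup>2) = q" by (simp add: q_def norm_mult)
    have im: "Re (entry_form n1 n2 \<omega> ?Z' l) = Im (entry_form n1 n2 \<omega> Z l)" for \<omega> l
      unfolding entry_form_scale by simp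
    have qpos: "0 < q" using False q0 by simp
    let ?R = "{\<omega> \<in> space ?M. t * (m * \<sigma>\<^sup>2) < \<bar>(\<Sum>l<m. (Re (entry_form n1 n2 \<omega> Z l))\<^sup>2) - m * \<sigma>\<^sup>2\<bar>}"
    let ?I = "{\<omega> \<in> space ?M. t * (m * \<sigma>\<^sup>2) < \<bar>(\<Sum>l<m. (Im (entry_form n1 n2 \<omega> Z l))\<^sup>2) - m * \<sigma>\<^sup>2\<bar>}"
    have R: "prob ?R \<le> 2 * exp (- (t\<^sup>2 * m / 16))"
      using entry_form_real_part[OF m qpos[unfolded q_def], folded q_def] t \<sigma>(1)
      by (intro chi_square_concentration) (auto simp: \<sigma>_def)
    have I: "prob ?I \<le> 2 * exp (- (t\<^sup>2 * m / 16))"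
      using entry_form_real_part[OF m, where Z = ?Z' and ?n1.0 = n1 and ?n2.0 = n2, unfolded q' im] t \<sigma>(1) qpos
      by (intro chi_square_concentration) (auto simp: \<sigma>_def)
    have [measurable]: "(\<lambda>\<omega>. \<Sum>l<m. (Re (entry_form n1 n2 \<omega> Z l))\<^sup>2) \<in> borel_measurable ?M"
      "(\<lambda>\<omega>. \<Sum>l<m. (Im (entry_form n1 n2 \<omega> Z l))\<^sup>2) \<in> borel_measurable ?M"
      using measurable_compose[OF entry_form_measurable borel_measurable_Re]
        measurable_compose[OF entry_form_measurable borel_measurable_Im]
      by (auto intro!: borel_measurable_sum borel_measurable_power)
    have "deviation_event n1 n2 m t Z \<subseteq> ?R \<union> ?I"
    proof
      fix \<omega> assume "\<omega> \<in> deviation_event n1 n2 m t Z"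
      hence \<omega>: "\<omega> \<in> space ?M" "t * q < \<bar>(nrm {..<m} (entry_form n1 n2 \<omega> Z))\<^sup>2 - q\<bar>"
        by (auto simp: deviation_event_def q_def)
      have "(nrm {..<m} (entry_form n1 n2 \<omega> Z))\<^sup>2 =
          (\<Sum>l<m. (Re (entry_form n1 n2 \<omega> Z l))\<^sup>2) + (\<Sum>l<m. (Im (entry_form n1 n2 \<omega> Z l))\<^sup>2)"
        by (simp add: nrm_sq cmod_power2 sum.distrib)
      hence "t * (q / 2) < \<bar>(\<Sum>l<m. (Re (entry_form n1 n2 \<omega> Z l))\<^sup>2) - q / 2\<bar> \<or>
          t * (q / 2) < \<bar>(\<Sum>l<m. (Im (entry_form n1 n2 \<omega> Z l))\<^sup>2) - q / 2\<bar>"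
        using \<omega>(2) by (simp only: times_divide_eq_right) linarith
      thus "\<omega> \<in> ?R \<union> ?I" using \<omega>(1) unfolding \<sigma>(2) by blast
    qed
    hence "prob (deviation_event n1 n2 m t Z) \<le> prob (?R \<union> ?I)" by (rule finite_measure_mono) measurable
    also have "\<dots> \<le> prob ?R + prob ?I" by (rule measure_Un_le) measurable
    finally show ?thesis using R I by simp
  qed
qed

definition polar :: "(nat \<Rightarrow> complex) \<Rightarrow> (nat \<Rightarrow> complex) \<Rightarrow> (nat \<Rightarrow> complex) \<Rightarrow> (nat \<Rightarrow> complex) \<Rightarrow> complex \<Rightarrow> nat \<Rightarrow> nat \<Rightarrow> complex" where
  "polar p q p' q' c i j = p i * cnj (q j) + c * (p' i * cnj (q' j))"

lemma bil_meas_mats: "bil n1 n2 (meas_mats n1 n2 \<omega>) x y l = entry_form n1 n2 \<omega> (\<lambda>i j. x i * cnj (y j)) l"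
  by (simp add: bil_def entry_form_def meas_mats_def mult.assoc)

text \<open>Net points have norm at most 1, so each of the four matrices in the polarization has
  Frobenius norm at most 2 and deviates by at most 4 t; the inner product is their average up to
  phases.\<close>

lemma net_form_bound:
  assumes net: "p \<in> net n1 s1" "p' \<in> net n1 s1" "q \<in> net n2 s2" "q' \<in> net n2 s2" and t: "0 \<le> t"
    and \<omega>: "\<omega> \<in> space (gaussian_entries n1 n2 m)"
    and good: "\<And>c. c \<in> {1, -1, \<i>, -\<i>} \<Longrightarrow> \<omega> \<notin> deviation_event n1 n2 m t (polar p q p' q' c)"
  defines "M \<equiv> meas_mats n1 n2 \<omega>"
  shows "cmod (ip m (bil n1 n2 M p q) (bil n1 n2 M p' q') - ip n1 p p' * ip n2 q' q) \<le> 4 * t"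
proof -
  let ?I = "{..<n1} \<times> {..<n2}"
  define w where "w = (\<lambda>(i, j). p i * cnj (q j))"
  define w' where "w' = (\<lambda>(i, j). p' i * cnj (q' j))"
  define a where "a = bil n1 n2 M p q"
  define a' where "a' = bil n1 n2 M p' q'"
  define D where "D c = (nrm {..<m} (\<lambda>l. a l + c * a' l))\<^sup>2 - (nrm ?I (\<lambda>e. w e + c * w' e))\<^sup>2" for c
  have ww: "ip n1 p p' * ip n2 q' q = (\<Sum>e\<in>?I. cnj (w e) * w' e)"
    unfolding sum.cartesian_product'
    by (simp add: w_def w'_def ip_def sum_product mult_ac)
  have "4 * (ip m a a' - ip n1 p p' * ip n2 q' q) = (\<Sum>c\<in>{1, -1, \<i>, -\<i>}. cnj c * of_real (D c))"
    unfolding ww ip_def[of m] right_diff_distrib polarization D_def by (simp only: of_real_diff right_diff_distrib sum_subtractf)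
  also have "cmod \<dots> \<le> (\<Sum>c\<in>{1, -1, \<i>, -\<i>}. 4 * t)"
  proof (rule sum_norm_le)
    fix c :: complex assume c: "c \<in> {1, -1, \<i>, -\<i>}"
    have c1: "cmod c = 1" using c by auto
    have nw: "nrm ?I w \<le> 1" "nrm ?I w' \<le> 1"
      unfolding w_def w'_def nrm_outer using net_norm_le[OF net(1)] net_norm_le[OF net(2)] net_norm_le[OF net(3)] net_norm_le[OF net(4)]
      by (auto intro!: mult_le_one)
    have "nrm ?I (\<lambda>e. w e + c * w' e) \<le> 2"
      using nrm_add[of ?I w "\<lambda>e. c * w' e"] nw by (simp add: nrm_scale c1)
    hence nz: "(nrm ?I (\<lambda>e. w e + c * w' e))\<^sup>2 \<le> 2\<^sup>2" by (intro power_mono) auto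
    have eq1: "(\<lambda>l. a l + c * a' l) = entry_form n1 n2 \<omega> (polar p q p' q' c)"
      by (auto simp: a_def a'_def M_def bil_meas_mats polar_def entry_form_def sum.distrib sum_distrib_left algebra_simps)
    have eq2: "(\<Sum>i<n1. \<Sum>j<n2. (cmod (polar p q p' q' c i j))\<^sup>2) = (nrm ?I (\<lambda>e. w e + c * w' e))\<^sup>2"
      unfolding nrm_sq sum.cartesian_product' by (simp add: polar_def w_def w'_def)
    have "\<bar>D c\<bar> \<le> t * (nrm ?I (\<lambda>e. w e + c * w' e))\<^sup>2"
      using good[OF c] \<omega> by (simp add: deviation_event_def eq2 D_def eq1)
    also have "\<dots> \<le> t * 2\<^sup>2" using nz t by (intro mult_left_mono) auto
    finally show "cmod (cnj c * of_real (D c)) \<le> 4 * t" by (simp add: norm_mult c1)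
  qed
  also have "\<dots> = 4 * (4 * t)"
  proof -
    have "card {1, -1, \<i>, -\<i>} = 4"
      by (simp add: complex_eq_iff)
    thus ?thesis by simp
  qed
  finally have "cmod (4 * (ip m a a' - ip n1 p p' * ip n2 q' q)) \<le> 4 * (4 * t)" .
  thus ?thesis unfolding norm_mult a_def a'_def by simp
qed

text \<open>The union bound over quadruples of net points and four phases gives 16 N1^2 N2^2 exp (-
  t^2 m / 16), where N1^2 N2^2 is at most exp (26 (s1 + s2) H). Since 1664 = 26 * 64, the nets use
  up a quarter of the exponent, and the factor 16 fits into another quarter. The level 5184 t is
  1296 times the deviation 4 t on the net.\<close>

theorem gaussian_bilinear_rip:
  assumes s: "1 \<le> s1" "s1 \<le> n1" "1 \<le> s2" "s2 \<le> n2" and t: "0 < t" "t \<le> 1"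
    and m: "1664 / t\<^sup>2 * real (s1 + s2) * ln (max (exp 1 * n1 / s1) (exp 1 * n2 / s2)) \<le> real m"
  shows "\<exists>E\<in>sets (gaussian_entries n1 n2 m). 1 - exp (- (t\<^sup>2 / 32) * m) \<le> measure (gaussian_entries n1 n2 m) E \<and>
    (\<forall>\<omega>\<in>E. bilinear_rip (5184 * t) n1 n2 m (3 * s1) (3 * s2) (meas_mats n1 n2 \<omega>))"
proof -
  let ?M = "gaussian_entries n1 n2 m"
  define H where "H = ln (max (exp 1 * n1 / s1) (exp 1 * n2 / s2))"
  have ge1: "exp 1 \<le> exp 1 * real n / real s" if "1 \<le> s" "s \<le> n" for n s
    using that mult_left_mono[of 1 "real n / real s" "exp 1"] by simp
  have ln1: "ln (exp 1 * n1 / s1) \<le> H" "ln (exp 1 * n2 / s2) \<le> H"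
    unfolding H_def using s by (auto intro!: ln_mono)
  have H1: "1 \<le> H"
    using ln1(1) ge1[OF s(1,2)] ln_mono[of "exp 1" "exp 1 * n1 / s1"] by auto
  have t2: "t\<^sup>2 > 0" using t by simp
  have mH: "1664 * (real (s1 + s2) * H) \<le> t\<^sup>2 * m"
    using m t2 unfolding H_def[symmetric] by (simp add: field_simps)
  \<comment> \<open>The sample bound itself forces \<open>m\<close> to be positive, which the
    variance 1 / m requires.\<close>
  have "2 * 1 \<le> real (s1 + s2) * H" using s H1 by (intro mult_mono) auto
  hence big: "3328 \<le> t\<^sup>2 * m" using mH by simp
  have m0: "0 < m" using big by (cases m) auto
  interpret prob_space ?M by (rule gaussian_entries_prob_space[OF m0])
  define A where "A = (net n1 s1 \<times> net n1 s1) \<times> (net n2 s2 \<times> net n2 s2) \<times> {1, -1, \<i>, -\<i>}"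
  define bad where "bad a = (case a of ((p, p'), (q, q'), c) \<Rightarrow> deviation_event n1 n2 m t (polar p q p' q' c))" for a
  have finA: "finite A" by (simp add: A_def finite_net)
  have badS: "bad a \<in> sets ?M" for a by (auto simp: bad_def deviation_event_sets split: prod.splits)
  define E where "E = space ?M - (\<Union>a\<in>A. bad a)"
  have US: "(\<Union>a\<in>A. bad a) \<in> sets ?M" using finA badS by (intro sets.finite_UN) auto
  have ES: "E \<in> sets ?M" unfolding E_def using US by (intro sets.Diff) auto
  define N1 where "N1 = real (card (net n1 s1))"
  define N2 where "N2 = real (card (net n2 s2))"
  have N: "N1 \<le> exp (13 * (s1 * H))" "N2 \<le> exp (13 * (s2 * H))"
  proof -
    have "13 * real s1 * ln (exp 1 * real n1 / real s1) \<le> 13 * (s1 * H)" using ln1(1) s by simp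
    thus "N1 \<le> exp (13 * (s1 * H))" unfolding N1_def using card_net_le[OF s(1,2)] by (meson exp_le_cancel_iff order_trans)
    have "13 * real s2 * ln (exp 1 * real n2 / real s2) \<le> 13 * (s2 * H)" using ln1(2) s by simp
    thus "N2 \<le> exp (13 * (s2 * H))" unfolding N2_def using card_net_le[OF s(3,4)] by (meson exp_le_cancel_iff order_trans)
  qed
  have N0: "0 \<le> N1" "0 \<le> N2" by (simp_all add: N1_def N2_def)
  have card4: "card {1, -1, \<i>, -\<i>} = 4" by (simp add: complex_eq_iff)
  have "prob (\<Union>a\<in>A. bad a) \<le> (\<Sum>a\<in>A. prob (bad a))"
    using finA badS by (intro finite_measure_subadditive_finite) auto
  also have "\<dots> \<le> (\<Sum>a\<in>A. 4 * exp (- (t\<^sup>2 * m / 16)))"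
    using deviation_event_prob[OF m0 t] by (intro sum_mono) (auto simp: bad_def split: prod.splits)
  also have "\<dots> = 16 * (N1 * N1 * (N2 * N2)) * exp (- (t\<^sup>2 * m / 16))"
    by (simp add: A_def card_cartesian_product card4 N1_def N2_def)
  also have "\<dots> \<le> exp 3 * (exp (26 * (s1 * H)) * exp (26 * (s2 * H))) * exp (- (t\<^sup>2 * m / 16)) * exp 1"
  proof -
    have "N1 * N1 \<le> exp (13 * (s1 * H)) * exp (13 * (s1 * H))" "N2 * N2 \<le> exp (13 * (s2 * H)) * exp (13 * (s2 * H))"
      using N N0 by (auto intro!: mult_mono)
    hence NN: "N1 * N1 \<le> exp (26 * (s1 * H))" "N2 * N2 \<le> exp (26 * (s2 * H))"
      by (simp_all add: exp_add[symmetric] mult.commute)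
    have "(2::real) ^ 4 \<le> exp 1 ^ 4" using exp_ge_add_one_self[of 1] by (intro power_mono) auto
    also have "exp 1 ^ 4 = exp (3::real) * exp 1" by (simp add: exp_of_nat_mult[symmetric] exp_add[symmetric])
    finally have e: "16 \<le> exp (3::real) * exp 1" by simp
    have "16 * (N1 * N1 * (N2 * N2)) \<le> exp 3 * exp 1 * (exp (26 * (s1 * H)) * exp (26 * (s2 * H)))"
      using e NN N0 by (intro mult_mono) auto
    hence "16 * (N1 * N1 * (N2 * N2)) * exp (- (t\<^sup>2 * m / 16)) \<le>
        exp 3 * exp 1 * (exp (26 * (s1 * H)) * exp (26 * (s2 * H))) * exp (- (t\<^sup>2 * m / 16))"
      by (intro mult_right_mono) auto
    thus ?thesis by (simp add: mult_ac)
  qed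
  also have "\<dots> = exp (4 + 26 * (real (s1 + s2) * H) - t\<^sup>2 * m / 16)"
    by (simp add: exp_add[symmetric] algebra_simps)
  also have "\<dots> \<le> exp (- (t\<^sup>2 / 32) * m)"
    using mH big by simp
  finally have "prob (\<Union>a\<in>A. bad a) \<le> exp (- (t\<^sup>2 / 32) * m)" .
  hence "1 - exp (- (t\<^sup>2 / 32) * m) \<le> prob E"
    unfolding E_def using prob_compl[OF US] by simp
  moreover have "bilinear_rip (5184 * t) n1 n2 m (3 * s1) (3 * s2) (meas_mats n1 n2 \<omega>)" if "\<omega> \<in> E" for \<omega>
  proof -
    have "cmod (ip m (bil n1 n2 (meas_mats n1 n2 \<omega>) p q) (bil n1 n2 (meas_mats n1 n2 \<omega>) p' q') - ip n1 p p' * ip n2 q' q) \<le> 4 * t"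
      if "p \<in> net n1 s1" "p' \<in> net n1 s1" "q \<in> net n2 s2" "q' \<in> net n2 s2" for p p' q q'
    proof (rule net_form_bound[OF that])
      show "\<omega> \<in> space ?M" using \<open>\<omega> \<in> E\<close> by (simp add: E_def)
      fix c :: complex assume c: "c \<in> {1, -1, \<i>, -\<i>}"
      have "((p, p'), (q, q'), c) \<in> A" unfolding A_def using that c by blast
      hence "\<omega> \<notin> bad ((p, p'), (q, q'), c)" using \<open>\<omega> \<in> E\<close> unfolding E_def by blast
      thus "\<omega> \<notin> deviation_event n1 n2 m t (polar p q p' q' c)" by (simp add: bad_def)
    qed (use t in simp)
    from bilinear_rip_from_net[OF s _ this] show ?thesis using t by simp
  qed
  ultimately show ?thesis using ES by blast
qed

text \<open>The event is the restricted isometry alone, so one event serves all signals, noises and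
  runs. \<open>t\<close> is set so that the isometry constant is 1/1000; c3 = 1/2000 and |A(X)| <= 2
  lam bound the noise relative to \<open>lam\<close> by 1/1000; C = 2 * 460 converts back to noise
  relative to A(X); K = 5 is the iteration count per sparsity level, and c4 = 99/100 is what the
  thresholding needs.\<close>

theorem mainTheorem1:
  "\<exists>c1 c2 c3 c4 C L K :: real.
     0 < c1 \<and> 0 < c2 \<and> 0 < c3 \<and> 0 < c4 \<and> c4 < 1 \<and> 0 < C \<and> 0 < L \<and> 0 < K \<and>
     (\<forall>n1 n2 m s1 s2 :: nat.
        s1 \<in> {1..n1} \<longrightarrow> s2 \<in> {1..n2} \<longrightarrow>
        real m \<ge> c1 * real (s1 + s2) *
          ln (max (exp 1 * real n1 / real s1) (exp 1 * real n2 / real s2)) \<longrightarrow>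
        (\<exists>E \<in> sets (gaussian_entries n1 n2 m).
           measure (gaussian_entries n1 n2 m) E \<ge> 1 - exp (- c2 * real m) \<and>
           (\<forall>\<omega>\<in>E. \<forall>lam u v X z b v0 Xs.
              lam > 0 \<longrightarrow>
              u \<in> carrier_vec n1 \<longrightarrow> v \<in> carrier_vec n2 \<longrightarrow>
              X = complex_of_real lam \<cdot>\<^sub>m outer_prod u v \<longrightarrow>
              vec_norm2 u = 1 \<longrightarrow> vec_norm2 v = 1 \<longrightarrow>
              vec_norm0 u \<le> s1 \<longrightarrow> vec_norm0 v \<le> s2 \<longrightarrow>
              (if s2 = n2 then vec_norm_inf u \<ge> c4
               else min (vec_norm_inf u) (vec_norm_inf v) \<ge> c4) \<longrightarrow>
              z \<in> carrier_vec m \<longrightarrow>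
              vec_norm2 z \<le> c3 * vec_norm2 (meas_op m (meas_mats n1 n2 \<omega>) X) \<longrightarrow>
              b = meas_op m (meas_mats n1 n2 \<omega>) X + z \<longrightarrow>
              thresholding_init n1 n2 s1 s2 (meas_adj n1 n2 m (meas_mats n1 n2 \<omega>) b) v0 \<longrightarrow>
              SPF_run (\<lambda>s. nat \<lceil>L + K * real s\<rceil>)
                n1 n2 m (meas_mats n1 n2 \<omega>) b s1 s2 v0 Xs \<longrightarrow>
              limsup (\<lambda>t. ereal (frob_norm (Xs t - X) / frob_norm X))
                \<le> ereal (C * (vec_norm2 z / vec_norm2 (meas_op m (meas_mats n1 n2 \<omega>) X))))))"
proof -
  define t :: real where "t = 1 / 5184000"
  define N where "N = (\<lambda>s. nat \<lceil>1 + 5 * real s\<rceil>)"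
  have N: "5 * s \<le> N s" for s unfolding N_def by linarith
  have recovery: "limsup (\<lambda>t. ereal (frob_norm (Xs t - X) / frob_norm X))
      \<le> ereal (920 * (vec_norm2 z / vec_norm2 (meas_op m (meas_mats n1 n2 \<omega>) X)))"
    if s: "s1 \<in> {1..n1}" "s2 \<in> {1..n2}"
      and rip: "bilinear_rip (1 / 1000) n1 n2 m (3 * s1) (3 * s2) (meas_mats n1 n2 \<omega>)"
      and lam: "lam > 0" and u: "u \<in> carrier_vec n1" and v: "v \<in> carrier_vec n2"
      and X: "X = complex_of_real lam \<cdot>\<^sub>m outer_prod u v"
      and un: "vec_norm2 u = 1" and vn: "vec_norm2 v = 1"
      and us: "vec_norm0 u \<le> s1" and vs: "vec_norm0 v \<le> s2"
      and peak: "if s2 = n2 then vec_norm_inf u \<ge> 99 / 100 else min (vec_norm_inf u) (vec_norm_inf v) \<ge> 99 / 100"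
      and z: "z \<in> carrier_vec m" "vec_norm2 z \<le> 1 / 2000 * vec_norm2 (meas_op m (meas_mats n1 n2 \<omega>) X)"
      and b: "b = meas_op m (meas_mats n1 n2 \<omega>) X + z"
      and init: "thresholding_init n1 n2 s1 s2 (meas_adj n1 n2 m (meas_mats n1 n2 \<omega>) b) v0"
      and run: "SPF_run N n1 n2 m (meas_mats n1 n2 \<omega>) b s1 s2 v0 Xs"
    for n1 n2 m s1 s2 \<omega> lam u v X z b v0 Xs
  proof -
    define M where "M = meas_mats n1 n2 \<omega>"
    have M: "M l \<in> carrier_mat n1 n2" for l by (simp add: M_def meas_mats_def)
    note rip = rip[folded M_def]
    have u': "sparse n1 s1 (fn u)" "nrm {..<n1} (fn u) = 1"
      using us un u vec_norm2_nrm[OF u] by (auto simp: vec_norm0_def vec_supp_def sparse_def)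
    have v': "sparse n2 s2 (fn v)" "nrm {..<n2} (fn v) = 1"
      using vs vn v vec_norm2_nrm[OF v] by (auto simp: vec_norm0_def vec_supp_def sparse_def)
    have u3: "sparse n1 (3 * s1) (fn u)" and v3: "sparse n2 (3 * s2) (fn v)"
      using sparse_mono[OF u'(1), of "3 * s1"] sparse_mono[OF v'(1), of "3 * s2"] by auto
    define y where "y = meas_op m M X"
    have y: "y $ l = of_real lam * bil n1 n2 M (fn u) (fn v) l" if "l < m" for l
    proof -
      have "y $ l = (\<Sum>j<n2. \<Sum>i<n1. cnj (M l $$ (i, j)) * (of_real lam * (u $ i * cnj (v $ j))))"
        using M[of l] that u v
        by (auto simp: y_def X meas_op_def mat_inner_def mat_trace_def outer_prod_def mat_adjoint_def scalar_prod_def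
            mat_of_rows_def atLeast0LessThan intro!: sum.cong)
      also have "\<dots> = of_real lam * bil n1 n2 M (fn u) (fn v) l"
        by (subst sum.swap) (simp add: bil_def sum_distrib_left mult_ac)
      finally show ?thesis .
    qed
    have yc: "y \<in> carrier_vec m" by (simp add: y_def meas_op_def)
    have ynorm: "vec_norm2 y = lam * nrm {..<m} (bil n1 n2 M (fn u) (fn v))"
    proof -
      have "vec_norm2 y = nrm {..<m} (\<lambda>l. of_real lam * bil n1 n2 M (fn u) (fn v) l)"
        unfolding vec_norm2_nrm[OF yc] by (rule nrm_cong) (simp add: y)
      thus ?thesis unfolding nrm_scale using lam by simp
    qed
    have upper: "nrm {..<m} (bil n1 n2 M (fn u) (fn v)) \<le> 2"
      using bil_norm_le[OF rip _ u3 v3] u'(2) v'(2) by simp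
    \<comment> \<open>Positivity makes the quotient in the claim a genuine one, not a division by
      zero with value zero.\<close>
    have lower: "0 < nrm {..<m} (bil n1 n2 M (fn u) (fn v))"
    proof (rule ccontr)
      assume "\<not> ?thesis"
      hence "nrm {..<m} (bil n1 n2 M (fn u) (fn v)) = 0" using nrm_nonneg[of "{..<m}" "bil n1 n2 M (fn u) (fn v)"] by linarith
      thus False
        using bilinear_ripD[OF rip u3 u3 v3 v3] u'(2) v'(2) by (simp add: ip_self)
    qed
    define \<nu> where "\<nu> = vec_norm2 z / lam"
    have zn: "nrm {..<m} (fn z) = lam * \<nu>" using lam vec_norm2_nrm[OF z(1)] by (simp add: \<nu>_def)
    have y2: "vec_norm2 y \<le> 2 * lam" "0 < vec_norm2 y" using upper lower lam by (simp_all add: ynorm)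
    have z2: "vec_norm2 z \<le> 1 / 2000 * vec_norm2 y" using z(2) by (simp add: y_def M_def)
    have z0: "0 \<le> vec_norm2 z" unfolding vec_norm2_nrm[OF z(1)] by simp
    have \<nu>: "0 \<le> \<nu>" "\<nu> \<le> 1 / 1000" using z2 y2 z0 lam by (auto simp: \<nu>_def divide_le_eq)
    have \<nu>y: "\<nu> \<le> 2 * (vec_norm2 z / vec_norm2 y)"
    proof -
      have "vec_norm2 z * vec_norm2 y \<le> vec_norm2 z * (2 * lam)" using y2(1) z0 by (rule mult_left_mono)
      thus ?thesis using y2(2) lam by (simp add: \<nu>_def divide_simps mult_ac)
    qed
    have bl: "b $ l = of_real lam * bil n1 n2 M (fn u) (fn v) l + z $ l" if "l < m" for l
      using that z(1) yc y[OF that] by (auto simp: b M_def[symmetric] y_def[symmetric])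
    have bc: "b \<in> carrier_vec m" using z(1) yc by (simp add: b M_def[symmetric] y_def[symmetric])
    define A where "A = meas_adj n1 n2 m M b"
    have Ac: "A \<in> carrier_mat n1 n2" by (simp add: A_def meas_adj_def)
    have big: "\<exists>i<n. 99 / 100 \<le> cmod (x $ i)" if "99 / 100 \<le> vec_norm_inf x" "x \<in> carrier_vec n" "1 \<le> n" for x n
    proof -
      have "Max ((\<lambda>i. cmod (x $ i)) ` {..<n}) \<in> (\<lambda>i. cmod (x $ i)) ` {..<n}"
        using that(3) by (intro Max_in) (auto simp: lessThan_empty_iff)
      thus ?thesis using that by (auto simp: vec_norm_inf_def)
    qed
    have peak_u: "\<exists>i<n1. 99 / 100 \<le> cmod (u $ i)" using peak s u by (intro big) (auto split: if_splits)
    have peak_v: "s2 = n2 \<or> (\<exists>i<n2. 99 / 100 \<le> cmod (v $ i))"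
    proof (cases "s2 = n2")
      case False
      hence "99 / 100 \<le> vec_norm_inf v" using peak by simp
      from big[OF this v] show ?thesis using s by simp
    qed simp
    have v0: "v0 \<in> carrier_vec n2 \<and> nrm {..<n2} (fn v0) = 1 \<and> sparse n2 s2 (fn v0) \<and> 1 / 2 \<le> cmod (ip n2 (fn v0) (fn v))"
    proof -
      \<comment> \<open>The isometry contributes lam / 1000 and the noise 2 lam / 1000, well within
        lam / 100.\<close>
      interpret near_rank_one n1 n2 s1 s2 A lam "lam / 100" "fn u" "fn v"
      proof
        fix x y' assume x: "sparse n1 s1 x" and y': "sparse n2 s2 y'"
        have x3: "sparse n1 (3 * s1) x" and y3: "sparse n2 (3 * s2) y'"
          using sparse_mono[OF x, of "3 * s1"] sparse_mono[OF y', of "3 * s2"] by auto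
        let ?a = "bil n1 n2 M x y'" and ?a' = "bil n1 n2 M (fn u) (fn v)"
        define q where "q = nrm {..<n1} x * nrm {..<n2} y'"
        have q: "0 \<le> lam * q" using lam by (simp add: q_def)
        have "ip m ?a (fn b) = of_real lam * ip m ?a ?a' + ip m ?a (fn z)"
          unfolding ip_scale_right[symmetric] ip_add_right[symmetric] by (rule ip_cong) (simp_all add: bl)
        hence eq: "(\<Sum>j<n2. (\<Sum>k<n1. cnj (x k) * A $$ (k, j)) * y' j) - of_real lam * ip n1 x (fn u) * ip n2 (fn v) y' =
            of_real lam * (ip m ?a ?a' - ip n1 x (fn u) * ip n2 (fn v) y') + ip m ?a (fn z)"
          unfolding A_def meas_adj_form by (simp add: algebra_simps)
        define r where "r = ip m ?a ?a' - ip n1 x (fn u) * ip n2 (fn v) y'"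
        have "cmod (of_real lam * r + ip m ?a (fn z)) \<le> cmod (of_real lam * r) + cmod (ip m ?a (fn z))"
          by (rule norm_triangle_ineq)
        also have "cmod (of_real lam * r) = lam * cmod r" using lam by (simp add: norm_mult)
        also have "lam * cmod r + cmod (ip m ?a (fn z)) \<le> lam * (1 / 1000 * q) + 2 * q * (lam * (1 / 1000))"
        proof (intro add_mono mult_left_mono)
          show "cmod r \<le> 1 / 1000 * q"
            unfolding r_def using bilinear_ripD[OF rip x3 u3 y3 v3] u'(2) v'(2) by (simp add: q_def mult.assoc)
          have "cmod (ip m ?a (fn z)) \<le> nrm {..<m} ?a * nrm {..<m} (fn z)" by (rule cauchy_schwarz)
          also have "\<dots> \<le> 2 * q * (lam * (1 / 1000))"
            unfolding zn q_def using bil_norm_le[OF rip _ x3 y3] \<nu> lam by (intro mult_mono) auto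
          finally show "cmod (ip m ?a (fn z)) \<le> 2 * q * (lam * (1 / 1000))" .
        qed (use lam in simp)
        also have "\<dots> = 3 / 1000 * (lam * q)" by simp
        also have "\<dots> \<le> lam / 100 * q" using q by simp
        finally show "cmod ((\<Sum>j<n2. (\<Sum>k<n1. cnj (x k) * A $$ (k, j)) * y' j) - of_real lam * ip n1 x (fn u) * ip n2 (fn v) y')
            \<le> lam / 100 * nrm {..<n1} x * nrm {..<n2} y'" unfolding eq r_def by (simp only: q_def mult.assoc)
      qed (use Ac lam s u' v' in simp_all)
      show ?thesis
        using thresholding_init_aligned[OF init[folded M_def, folded A_def] peak_u peak_v] by blast
    qed
    have frobX: "frob_norm X = lam"
    proof -
      have "frob_norm X = nrm ({..<n1} \<times> {..<n2}) (\<lambda>ij. X $$ ij)"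
        by (rule frob_norm_nrm) (use u v in \<open>auto simp: X outer_prod_def\<close>)
      also have "\<dots> = nrm ({..<n1} \<times> {..<n2}) (\<lambda>ij. of_real lam * (case ij of (i, j) \<Rightarrow> u $ i * cnj (v $ j)))"
        by (rule nrm_cong) (use u v in \<open>auto simp: X outer_prod_def\<close>)
      also have "\<dots> = lam" unfolding nrm_scale nrm_outer using u' v' lam by simp
      finally show ?thesis .
    qed
    have bound: "frob_norm (Xs t - X) / frob_norm X \<le> 2 * (1 / 4) ^ t + 460 * \<nu>" if "1 \<le> t" for t
    proof -
      have "frob_norm (Xs t - X) \<le> lam * (2 * (1 / 4) ^ t + 460 * \<nu>)"
        unfolding X
        using SPF_error_bound(2)[where N = N and M = M and \<delta> = "1 / 1000" and z = "fn z" and \<nu> = \<nu> and b = b and X = Xs,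
            OF M rip _ _ u u' v v' lam _ \<nu>(2) bc bl _ N _ N _ _ _ _ run[folded M_def] that] s zn v0 by simp
      thus ?thesis using lam by (simp add: frobX divide_le_eq mult.commute)
    qed
    have lim: "(\<lambda>t. 2 * (1 / 4) ^ t + 460 * \<nu>) \<longlonglongrightarrow> 2 * 0 + 460 * \<nu>"
      by (intro tendsto_intros LIMSEQ_power_zero) simp
    \<comment> \<open>The bound starts at t = 1; \<open>Xs 0\<close> is arbitrary, which the limit
      superior does not see.\<close>
    have "limsup (\<lambda>t. ereal (frob_norm (Xs t - X) / frob_norm X)) \<le> limsup (\<lambda>t. ereal (2 * (1 / 4) ^ t + 460 * \<nu>))"
      using bound by (intro Limsup_mono eventually_sequentiallyI[of 1]) auto
    also have "\<dots> = ereal (460 * \<nu>)"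
      using lim by (intro lim_imp_Limsup) auto
    also have "\<dots> \<le> ereal (920 * (vec_norm2 z / vec_norm2 y))" using \<nu>y by simp
    finally show ?thesis by (simp add: y_def M_def)
  qed
  have t: "0 < t" "t \<le> 1" "5184 * t = 1 / 1000" by (simp_all add: t_def)
  show ?thesis
  proof (rule exI[of _ "1664 / t\<^sup>2"], rule exI[of _ "t\<^sup>2 / 32"], rule exI[of _ "1 / 2000"],
      rule exI[of _ "99 / 100"], rule exI[of _ 920], rule exI[of _ 1], rule exI[of _ 5], intro conjI allI impI, goal_cases)
    case (9 n1 n2 m s1 s2)
    obtain E where E: "E \<in> sets (gaussian_entries n1 n2 m)" "1 - exp (- (t\<^sup>2 / 32) * m) \<le> measure (gaussian_entries n1 n2 m) E"
      "\<And>\<omega>. \<omega> \<in> E \<Longrightarrow> bilinear_rip (1 / 1000) n1 n2 m (3 * s1) (3 * s2) (meas_mats n1 n2 \<omega>)"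
      using gaussian_bilinear_rip[OF _ _ _ _ t(1,2) 9(3)] 9(1,2) unfolding t(3) by auto
    show ?case
    proof (intro bexI[OF _ E(1)] conjI E(2) ballI allI impI, goal_cases)
      case (1 \<omega> lam u v X z b v0 Xs)
      show ?case by (rule recovery[OF 9(1,2) E(3)[OF 1(1)] 1(2-15)[folded N_def]])
    qed
  qed (use t in auto)
qed

end
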